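(* Let $\{Z_n:n\geq 0\}$ be a critical Galton--Watson process in a varying environment $Q=\{q_n:n\ge1\}$, i.e. a regular one with $\rho_{0,n}\to\infty$ and $\mu_n\rho_{0,n}\to\infty$ as $n\to\infty$. Assume that there exists $c>0$ such that $$f_n'''(1)\leq c\, f_n''(1)\,(1+f_n'(1))\qquad\text{for any } n\geq 1,$$ and define $b_n:=\mathbb{E}[Z_n\mid Z_n>0]$, $n\geq0$. Assume that there exist $0<a\leq A<\infty$ such that $a\leq f_n'(1)\leq A$ and $a\leq f_n''(1)\leq A$ for all $n\geq1$. Let $$s_n:=\sum_{k=2}^{n-1}\left(\log(\rho_{0,k}\mu_k)+\log\left(f_k'(1)\right)\right)\left|\frac{1}{\mu_{k-2}}-\frac{1}{\mu_k}\right|,\qquad n\geq3.$$ Then $$d_W\left(\left\{\left.\frac{1}{b_n}Z_n\ \right|\ Z_n>0\right\},\mathbf{e}\right)\leq C\left(\frac{\log(\mu_n\rho_{0,n})}{\mu_n\rho_{0,n}}+\frac{s_n}{\rho_{0,n}}\right),$$ where $\mathbf{e}$ is a standard exponentially distributed random variable and $C>0$ is a constant which is independent of $n$. In particular, if we also assume $\lim_{n\to\infty}s_n<\infty$, we have $$d_W\left(\left\{\left.\frac{1}{b_n}Z_n\ \right|\ Z_n>0\right\},\mathbf{e}\right)\leq C\left(\frac{\log(\mu_n\rho_{0,n})}{\mu_n\rho_{0,n}}+\frac{1}{\rho_{0,n}}\right),$$ where again $C>0$ is a constant which is independent of $n$.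
   Context: An environment is a sequence $Q=\{q_n:n\geq1\}$ of probability measures on $\mathbb{N}_0=\{0,1,2,\dots\}$. The Galton--Watson process in the varying environment $Q$ (GWVE) is defined by $Z_0=1$ and $Z_n=\sum_{i=1}^{Z_{n-1}}\chi_i^{(n)}$, $n\geq1$, where $\{\chi_i^{(n)}:i,n\geq1\}$ are independent and $\chi_i^{(n)}$ has law $q_n$. It is assumed throughout that $0<\mathbb{E}[\chi_i^{(n)}]<\infty$ for every $n$. The GWVE is called regular if for every $\epsilon>0$ there is a finite constant $c_\epsilon$ such that for all $n\geq1$, with $\chi^{(n)}\sim q_n$, $$\mathbb{E}\left[(\chi^{(n)})^2\mathbf{1}_{\{\chi^{(n)}>c_\epsilon(1+\mathbb{E}[\chi^{(n)}])\}}\right]\leq\epsilon\,\mathbb{E}\left[(\chi^{(n)})^2\mathbf{1}_{\{\chi^{(n)}>2\}}\right]<\infty.$$ Let $f_n(s)=\sum_{k\ge0}s^kq_n[k]$, $0\le s\le 1$, be the generating function of $q_n$ (so $f_n'(1),f_n''(1),f_n'''(1)$ are its first, second and third factorial moments). Set $\mu_0:=1$ and, for $n\geq1$, $$\mu_n:=f_1'(1)\cdots f_n'(1),\qquad \nu_n:=\frac{f_n''(1)}{f_n'(1)^2},\qquad \rho_{0,n}:=\sum_{k=0}^{n-1}\frac{\nu_{k+1}}{\mu_k}.$$ $\{X\mid Z_n>0\}$ denotes the conditional law of $X$ given $\{Z_n>0\}$. The Wasserstein distance between probability measures $\mu,\nu$ on $\mathbb{R}$ is $d_W(\mu,\nu)=\sup_{f\in\mathcal{F}}\left|\int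 f\,d\mu-\int f\,d\nu\right|$, where $\mathcal{F}$ is the set of Lipschitz functions $f:\mathbb{R}\to\mathbb{R}$ with $\|f'\|\leq1$; for random variables it means the distance of their laws.
   Formalization: As stated, the right-hand sides can be negative (the first even for all large n), so the bounds can fail. The first bound is proved for n ≥ 3 with μ_nρ_{0,n} > 1 and s_n ≥ 0, the second for n ≥ 1 with μ_nρ_{0,n} ≥ 1. *)

theory Defs
  imports "HOL-Probability.Probability"
begin

text \<open>
  An environment is a sequence \<open>q\<close> of probability mass functions on the natural numbers; only the
  entries \<open>q n\<close> with \<open>n \<ge> 1\<close> are used. The variable \<open>\<xi> n i\<close> is the number of children of the
  \<open>i\<close>-th individual of generation \<open>n - 1\<close>, with \<open>n, i \<ge> 1\<close>.
\<close>

locale gwve = prob_space M for M :: "'a measure" +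
  fixes q :: "nat \<Rightarrow> nat pmf" and \<xi> :: "nat \<Rightarrow> nat \<Rightarrow> 'a \<Rightarrow> nat"
  assumes indep: "indep_vars (\<lambda>_. count_space UNIV) (\<lambda>(n, i). \<xi> n i) ({1..} \<times> {1..})"
    and law: "\<And>n i. n \<ge> 1 \<Longrightarrow> i \<ge> 1 \<Longrightarrow> distr M (count_space UNIV) (\<xi> n i) = measure_pmf (q n)"
    and mean_finite: "\<And>n. n \<ge> 1 \<Longrightarrow> integrable (measure_pmf (q n)) real"
    and mean_pos: "\<And>n. n \<ge> 1 \<Longrightarrow> 0 < measure_pmf.expectation (q n) real"

primrec gw_process :: "(nat \<Rightarrow> nat \<Rightarrow> 'a \<Rightarrow> nat) \<Rightarrow> nat \<Rightarrow> 'a \<Rightarrow> nat" where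
  "gw_process \<xi> 0 \<omega> = 1"
| "gw_process \<xi> (Suc n) \<omega> = (\<Sum>i = 1..gw_process \<xi> n \<omega>. \<xi> (Suc n) i \<omega>)"

definition regular_env :: "(nat \<Rightarrow> nat pmf) \<Rightarrow> bool" where
  "regular_env q \<longleftrightarrow>
    (\<forall>\<epsilon>::real. \<epsilon> > 0 \<longrightarrow> (\<exists>c::real. \<forall>n\<ge>1.
       (\<integral>\<^sup>+ k. ennreal ((real k)\<^sup>2) *
           indicator {k. real k > c * (1 + measure_pmf.expectation (q n) real)} k \<partial>measure_pmf (q n))
         \<le> ennreal \<epsilon> * (\<integral>\<^sup>+ k. ennreal ((real k)\<^sup>2) * indicator {k. k > 2} k \<partial>measure_pmf (q n))
       \<and> ennreal \<epsilon> * (\<integral>\<^sup>+ k. ennreal ((real k)\<^sup>2) * indicator {k. k > 2} k \<partial>measure_pmf (q n)) < \<infinity>))"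

definition falling_fact :: "nat \<Rightarrow> nat \<Rightarrow> real" where
  "falling_fact j k = (\<Prod>i<j. real k - real i)"

text \<open>
  The \<open>j\<close>-th factorial moment, i.e. the \<open>j\<close>-th derivative (from the left) at 1 of the generating
  function of \<open>p\<close>. As a Bochner integral it is 0 when \<open>falling_fact j\<close> is not integrable, so
  finiteness of a moment has to be stated separately.
\<close>

definition fmoment :: "nat \<Rightarrow> nat pmf \<Rightarrow> real" where
  "fmoment j p = measure_pmf.expectation p (falling_fact j)"

definition mu :: "(nat \<Rightarrow> nat pmf) \<Rightarrow> nat \<Rightarrow> real" where
  "mu q n = (\<Prod>k = 1..n. fmoment 1 (q k))"

definition nu :: "(nat \<Rightarrow> nat pmf) \<Rightarrow> nat \<Rightarrow> real" where
  "nu q n = fmoment 2 (q n) / (fmoment 1 (q n))\<^sup>2"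

text \<open>This is \<open>\<rho>\<close> with first index 0 and second index \<open>n\<close>.\<close>

definition rho :: "(nat \<Rightarrow> nat pmf) \<Rightarrow> nat \<Rightarrow> real" where
  "rho q n = (\<Sum>k<n. nu q (Suc k) / mu q k)"

definition critical_env :: "(nat \<Rightarrow> nat pmf) \<Rightarrow> bool" where
  "critical_env q \<longleftrightarrow> regular_env q \<and>
     filterlim (rho q) at_top sequentially \<and>
     filterlim (\<lambda>n. mu q n * rho q n) at_top sequentially"

text \<open>Only meaningful for \<open>n \<ge> 3\<close>. Finitely many of the summands can be negative.\<close>

definition s_env :: "(nat \<Rightarrow> nat pmf) \<Rightarrow> nat \<Rightarrow> real" where
  "s_env q n = (\<Sum>k = 2..n - 1.
     (ln (rho q k * mu q k) + ln (fmoment 1 (q k))) * \<bar>1 / mu q (k - 2) - 1 / mu q k\<bar>)"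

text \<open>The probability measure \<open>M\<close> conditioned on survival up to generation \<open>n\<close>.\<close>

definition survival_measure :: "'a measure \<Rightarrow> (nat \<Rightarrow> nat \<Rightarrow> 'a \<Rightarrow> nat) \<Rightarrow> nat \<Rightarrow> 'a measure" where
  "survival_measure M \<xi> n = uniform_measure M {\<omega> \<in> space M. gw_process \<xi> n \<omega> > 0}"

definition cond_mean :: "'a measure \<Rightarrow> (nat \<Rightarrow> nat \<Rightarrow> 'a \<Rightarrow> nat) \<Rightarrow> nat \<Rightarrow> real" where
  "cond_mean M \<xi> n = (\<integral>\<omega>. real (gw_process \<xi> n \<omega>) \<partial>survival_measure M \<xi> n)"

definition scaled_cond_law :: "'a measure \<Rightarrow> (nat \<Rightarrow> nat \<Rightarrow> 'a \<Rightarrow> nat) \<Rightarrow> nat \<Rightarrow> real measure" where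
  "scaled_cond_law M \<xi> n =
     distr (survival_measure M \<xi> n) borel (\<lambda>\<omega>. 1 / cond_mean M \<xi> n * real (gw_process \<xi> n \<omega>))"

definition std_exponential :: "real measure" where
  "std_exponential = density lborel (\<lambda>x. ennreal (exponential_density 1 x))"

text \<open>
  For a Lipschitz function, \<open>\<parallel>f'\<parallel> \<le> 1\<close> means that its Lipschitz constant is at most 1. The supremum
  is taken in the extended reals, so that it is not an arbitrary value if it is infinite. For laws
  with finite first moments every Lipschitz function is integrable.
\<close>

definition wasserstein :: "real measure \<Rightarrow> real measure \<Rightarrow> ereal" where
  "wasserstein N N' =
     (SUP f \<in> {f :: real \<Rightarrow> real. 1-lipschitz_on UNIV f}. ereal \<bar>(\<integral>x. f x \<partial>N) - (\<integral>x. f x \<partial>N')\<bar>)"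

end

(*
  Let Y be the law of Z_n given Z_n > 0, and let T be the equilibrium law of Z_n, with weights
  proportional to P(Z_n >= j) for j >= 1. Stein's method for the exponential law bounds the
  Wasserstein distance of Y / b_n from the exponential law by 2 / b_n (1 + d(T, Y)), where d is the
  Wasserstein distance on the integers.

  Both laws are divided differences of the generating function F of Z_n, of the form
  (F(s) - F(x)) / (s - x) with x = 1 for T and x = 0 for Y. As F is the composition of f_1, ..., f_n,
  the chain rule for divided differences writes T and Y as sums of n independent terms, one for
  each generation; this is the spine decomposition without trees. The k-th terms are random sums of
  copies of the population after generation k, with numbers of summands whose distance is of the order
  of the probability S_k to survive from generation k to n. Hence d(T, Y) is of the order of
  the sum of mu_n / mu_k S_k.

  A recursion for 1 / S_k gives S_k <= C / (mu_k (r_(n+1) - r_k)) with r_k the sum of 1 / mu_i for i < k,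
  which is comparable to rho. In the remaining sum of (1 / mu_k) (r_(k+1) - r_k) / (r_(n+1) - r_k) the
  second factor sums up to a logarithm, and summation by parts in steps of two generations produces s_n.
*)

theory Submission
  imports Defs
begin

subsection \<open>Divided differences of generating functions\<close>

text \<open>The spine decomposition makes the comparison of T and Y local. In generation k both use
  a divided difference of f_k, with second point 1 for T and the extinction probability 1 - S_k for
  Y; this is why only S_k enters. The bound on third moments makes the divided difference Lipschitz
  in that point. It also keeps the second moment from escaping to infinity, so that two or more
  children have a probability bounded away from 0, which drives the recursion for 1 / S_k.

  The obstacle in the summation is that mu may oscillate with period two: the one-step increments of
  1 / mu then do not add up to anything bounded, while the two-step increments vanish. A second
  obstacle is that s_n can be zero or negative, whereas constants lost on finitely many generations
  must still be absorbed.

  Test functions are bounded until the very end. Adding the bound turns an expectation into an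
  integral of a nonnegative function, where sums and integrals commute freely; arbitrary Lipschitz
  functions are reached by truncation.\<close>

lemma integrable_pmf_bounded:
  fixes h :: "'b \<Rightarrow> real"
  assumes "\<And>x. \<bar>h x\<bar> \<le> K"
  shows "integrable (measure_pmf p) h"
  by (rule measure_pmf.integrable_const_bound[where B = K]) (use assms in auto)

lemma abs_expectation_le:
  fixes h :: "'b \<Rightarrow> real"
  assumes "\<And>x. \<bar>h x\<bar> \<le> K"
  shows "\<bar>measure_pmf.expectation p h\<bar> \<le> K"
proof -
  have "\<bar>measure_pmf.expectation p h\<bar> \<le> measure_pmf.expectation p (\<lambda>x. \<bar>h x\<bar>)"
    by (rule integral_abs_bound)
  also have "\<dots> \<le> measure_pmf.expectation p (\<lambda>_. K)"
    using assms by (intro integral_mono integrable_abs integrable_pmf_bounded[OF assms]) auto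
  finally show ?thesis by simp
qed

text \<open>Adding \<open>K\<close> makes a bounded function nonnegative. Identities for
  \<open>nn_integral\<close>, which need no integrability, can then be transferred to
  expectations.\<close>

lemma nn_integral_shift:
  fixes h :: "'b \<Rightarrow> real"
  assumes "\<And>x. \<bar>h x\<bar> \<le> K"
  shows "(\<integral>\<^sup>+x. ennreal (h x + K) \<partial>measure_pmf p) = ennreal (measure_pmf.expectation p h + K)"
proof -
  have i: "integrable (measure_pmf p) h"
    using assms by (rule integrable_pmf_bounded)
  have "0 \<le> h x + K" for x
    using assms[of x] by linarith
  then have "(\<integral>\<^sup>+x. ennreal (h x + K) \<partial>measure_pmf p)
      = ennreal (measure_pmf.expectation p (\<lambda>x. h x + K))"
    by (intro nn_integral_eq_integral) (use i in auto)
  then show ?thesis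
    using i by simp
qed

lemma expectation_bind_pmf:
  fixes h :: "'c \<Rightarrow> real"
  assumes h: "\<And>x. \<bar>h x\<bar> \<le> K"
  shows "measure_pmf.expectation (bind_pmf p N) h
    = measure_pmf.expectation p (\<lambda>x. measure_pmf.expectation (N x) h)"
proof -
  have b: "\<bar>measure_pmf.expectation r h\<bar> \<le> K" for r
    using h by (rule abs_expectation_le)
  have "ennreal (measure_pmf.expectation (bind_pmf p N) h + K)
      = (\<integral>\<^sup>+x. ennreal (measure_pmf.expectation (N x) h + K) \<partial>measure_pmf p)"
    by (simp add: nn_integral_shift[OF h, symmetric])
  also have "\<dots> = ennreal (measure_pmf.expectation p (\<lambda>x. measure_pmf.expectation (N x) h) + K)"
    by (rule nn_integral_shift[OF b])
  finally have "measure_pmf.expectation (bind_pmf p N) h + K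
      = measure_pmf.expectation p (\<lambda>x. measure_pmf.expectation (N x) h) + K"
  proof (subst (asm) ennreal_inj)
    show "0 \<le> measure_pmf.expectation (bind_pmf p N) h + K"
      using b[of "bind_pmf p N"] by linarith
    show "0 \<le> measure_pmf.expectation p (\<lambda>x. measure_pmf.expectation (N x) h) + K"
      using abs_expectation_le[of "\<lambda>x. measure_pmf.expectation (N x) h" K p] b by (simp add: abs_le_iff)
  qed
  then show ?thesis by simp
qed

text \<open>The m-fold convolution power of \<open>p\<close>. Mixing it over \<open>m\<close> with
  law \<open>r\<close> gives the law with generating function \<open>pgf r\<close> after
  \<open>pgf p\<close>.\<close>

primrec nsum :: "nat \<Rightarrow> nat pmf \<Rightarrow> nat pmf" where
  "nsum 0 p = return_pmf 0"
| "nsum (Suc m) p = bind_pmf p (\<lambda>x. map_pmf (\<lambda>s. x + s) (nsum m p))"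

definition pgf :: "nat pmf \<Rightarrow> real \<Rightarrow> real" where
  "pgf p x = measure_pmf.expectation p (\<lambda>z. x ^ z)"

text \<open>
  With \<open>f = pgf p\<close>, \<open>dquot p x\<close> is \<open>(f 1 - f x) / (1 - x)\<close> and the generating function of
  \<open>tl_pmf p x\<close> at \<open>s\<close> is \<open>(f s - f x) / (s - x)\<close> divided by \<open>dquot p x\<close>. Shifted by 1,
  \<open>tl_pmf p 0\<close> is \<open>p\<close> conditioned on being positive and \<open>tl_pmf p 1\<close> is the equilibrium law of \<open>p\<close>.
  For \<open>z > i\<close> no truncation occurs in the exponent \<open>z - 1 - i\<close>.
\<close>

definition tl_functional :: "nat pmf \<Rightarrow> real \<Rightarrow> (nat \<Rightarrow> ennreal) \<Rightarrow> ennreal" where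
  "tl_functional p x h = (\<integral>\<^sup>+z. (\<Sum>i<z. ennreal (x ^ (z - 1 - i)) * h i) \<partial>measure_pmf p)"

definition dquot :: "nat pmf \<Rightarrow> real \<Rightarrow> real" where
  "dquot p x = measure_pmf.expectation p (\<lambda>z. \<Sum>i<z. x ^ (z - 1 - i))"

definition tl_weight :: "nat pmf \<Rightarrow> real \<Rightarrow> nat \<Rightarrow> real" where
  "tl_weight p x i = measure_pmf.expectation p (\<lambda>z. if i < z then x ^ (z - 1 - i) else 0)"

definition tl_pmf :: "nat pmf \<Rightarrow> real \<Rightarrow> nat pmf" where
  "tl_pmf p x = embed_pmf (\<lambda>i. tl_weight p x i / dquot p x)"

lemma pgf_bounds:
  assumes "0 \<le> x" "x \<le> 1"
  shows "0 \<le> pgf p x" "pgf p x \<le> 1"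
proof -
  show "0 \<le> pgf p x"
    unfolding pgf_def using assms by (intro integral_nonneg_AE) auto
  have "\<bar>pgf p x\<bar> \<le> 1"
    unfolding pgf_def using assms by (intro abs_expectation_le) (auto simp: power_le_one)
  then show "pgf p x \<le> 1" by simp
qed

lemma nn_integral_pgf:
  assumes "0 \<le> x" "x \<le> 1"
  shows "(\<integral>\<^sup>+z. ennreal (x ^ z) \<partial>measure_pmf p) = ennreal (pgf p x)"
  unfolding pgf_def using assms
  by (intro nn_integral_eq_integral integrable_pmf_bounded[where K = 1]) (auto simp: power_le_one)

text \<open>With f = \<open>pgf p\<close> this is the factorization of f(s)^m - f(x)^m into f(s) -
  f(x) and the sum of f(x)^(m-1-i) f(s)^i over i < m, divided by s - x. The shift by a sum of
  \<open>i\<close> copies stands for f(s)^i.\<close>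

lemma tl_functional_nsum:
  assumes x: "0 \<le> x" "x \<le> 1"
  shows "tl_functional (nsum m p) x h
    = (\<Sum>i<m. ennreal (pgf p x ^ (m - 1 - i)) * tl_functional p x (\<lambda>l. \<integral>\<^sup>+s. h (l + s) \<partial>nsum i p))"
proof (induction m)
  case 0
  then show ?case by (simp add: tl_functional_def)
next
  case (Suc m)
  \<comment> \<open>The positions below \<open>s\<close> are those of the old sum and gain the
    factor x^y; the \<open>y\<close> positions from \<open>s\<close> on belong to the new
    summand.\<close>
  have split: "(\<Sum>i<y + s. ennreal (x ^ (y + s - 1 - i)) * h i)
      = ennreal (x ^ y) * (\<Sum>i<s. ennreal (x ^ (s - 1 - i)) * h i)
        + (\<Sum>i<y. ennreal (x ^ (y - 1 - i)) * h (i + s))" for y s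
  proof -
    have "(\<Sum>i<y + s. ennreal (x ^ (y + s - 1 - i)) * h i)
        = (\<Sum>i<s. ennreal (x ^ (y + s - 1 - i)) * h i) + (\<Sum>i=s..<y+s. ennreal (x ^ (y + s - 1 - i)) * h i)"
      by (simp add: lessThan_atLeast0 sum.atLeastLessThan_concat)
    also have "(\<Sum>i<s. ennreal (x ^ (y + s - 1 - i)) * h i)
        = ennreal (x ^ y) * (\<Sum>i<s. ennreal (x ^ (s - 1 - i)) * h i)"
    proof -
      have "ennreal (x ^ (y + s - 1 - i)) = ennreal (x ^ y) * ennreal (x ^ (s - 1 - i))" if "i < s" for i
      proof -
        have "y + s - 1 - i = y + (s - 1 - i)" using that by simp
        then show ?thesis using x by (simp add: power_add ennreal_mult)
      qed
      then show ?thesis by (simp add: sum_distrib_left mult.assoc)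
    qed
    also have "(\<Sum>i=s..<y+s. ennreal (x ^ (y + s - 1 - i)) * h i)
        = (\<Sum>i<y. ennreal (x ^ (y - 1 - i)) * h (i + s))"
      using sum.shift_bounds_nat_ivl[of "\<lambda>i. ennreal (x ^ (y + s - 1 - i)) * h i" 0 s y]
      by (simp add: lessThan_atLeast0)
    finally show ?thesis .
  qed
  have "tl_functional (nsum (Suc m) p) x h
      = (\<integral>\<^sup>+y. (\<integral>\<^sup>+s. ennreal (x ^ y) * (\<Sum>i<s. ennreal (x ^ (s - 1 - i)) * h i)
        + (\<Sum>i<y. ennreal (x ^ (y - 1 - i)) * h (i + s)) \<partial>nsum m p) \<partial>p)"
    unfolding tl_functional_def nsum.simps nn_integral_bind_pmf nn_integral_map_pmf split ..
  also have "\<dots> = (\<integral>\<^sup>+y. ennreal (x ^ y) * tl_functional (nsum m p) x h \<partial>p)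
      + tl_functional p x (\<lambda>l. \<integral>\<^sup>+s. h (l + s) \<partial>nsum m p)"
    by (simp add: nn_integral_add nn_integral_cmult nn_integral_sum tl_functional_def)
  also have "(\<integral>\<^sup>+y. ennreal (x ^ y) * tl_functional (nsum m p) x h \<partial>p) = ennreal (pgf p x) * tl_functional (nsum m p) x h"
    by (simp add: nn_integral_multc nn_integral_pgf[OF x])
  also have "\<dots> = (\<Sum>i<m. ennreal (pgf p x ^ (m - i)) * tl_functional p x (\<lambda>l. \<integral>\<^sup>+s. h (l + s) \<partial>nsum i p))"
    unfolding Suc sum_distrib_left
  proof (intro sum.cong refl)
    fix i assume "i \<in> {..<m}"
    then have "pgf p x ^ (m - i) = pgf p x * pgf p x ^ (m - 1 - i)"
      by (simp flip: power_Suc add: Suc_diff_Suc)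
    then show "ennreal (pgf p x) * (ennreal (pgf p x ^ (m - 1 - i)) * tl_functional p x (\<lambda>l. \<integral>\<^sup>+s. h (l + s) \<partial>nsum i p))
        = ennreal (pgf p x ^ (m - i)) * tl_functional p x (\<lambda>l. \<integral>\<^sup>+s. h (l + s) \<partial>nsum i p)"
      using pgf_bounds[OF x, of p] by (simp add: ennreal_mult mult.assoc)
  qed
  finally show ?case by simp
qed

lemma tl_functional_bind_nsum:
  assumes "0 \<le> x" "x \<le> 1"
  shows "tl_functional (bind_pmf r (\<lambda>m. nsum m p)) x h
    = tl_functional r (pgf p x) (\<lambda>i. tl_functional p x (\<lambda>l. \<integral>\<^sup>+s. h (l + s) \<partial>nsum i p))"
  using tl_functional_nsum[OF assms, of _ p h] by (simp add: tl_functional_def[of "bind_pmf _ _"] tl_functional_def[of r] tl_functional_def[of "nsum _ _"])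

lemma power_sum_bounds:
  fixes x :: real
  assumes "0 \<le> x" "x \<le> 1"
  shows "0 \<le> (\<Sum>i<z. x ^ (z - 1 - i))" "(\<Sum>i<z. x ^ (z - 1 - i)) \<le> real z"
proof -
  show "0 \<le> (\<Sum>i<z. x ^ (z - 1 - i))"
    using assms by (intro sum_nonneg) auto
  show "(\<Sum>i<z. x ^ (z - 1 - i)) \<le> real z"
    using assms sum_bounded_above[of "{..<z}" "\<lambda>i. x ^ (z - 1 - i)" 1] by (simp add: power_le_one)
qed

text \<open>As 0 ^ 0 = 1, only the top position survives. This is why the point 0 leads to the law
  conditioned on being positive.\<close>

lemma sum_zero_power: "(\<Sum>i<z. (0::real) ^ (z - 1 - i) * h i) = (if z = 0 then 0 else h (z - 1))"
proof (cases z)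
  case (Suc k)
  have "(\<Sum>i<k. (0::real) ^ (k - i) * h i) = 0"
    by (intro sum.neutral) auto
  then show ?thesis using Suc by simp
qed auto

section \<open>Divided differences as probability laws\<close>

locale offspring =
  fixes p :: "nat pmf"
  assumes integrable: "integrable (measure_pmf p) real"
    and mean_pos: "0 < measure_pmf.expectation p real"
begin

lemma integrable_linear:
  assumes "\<And>z. \<bar>h z\<bar> \<le> K * real z"
  shows "integrable (measure_pmf p) h"
  by (rule Bochner_Integration.integrable_bound[where f = "\<lambda>z. K * real z"])
    (use assms integrable in \<open>auto intro: order_trans[OF _ abs_ge_self]\<close>)

lemma tl_functional_one:
  assumes "0 \<le> x" "x \<le> 1"
  shows "tl_functional p x (\<lambda>_. 1) = ennreal (dquot p x)"
proof -
  have "integrable (measure_pmf p) (\<lambda>z. \<Sum>i<z. x ^ (z - 1 - i))"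
    using power_sum_bounds[OF assms] by (intro integrable_linear[where K = 1]) auto
  then have "(\<integral>\<^sup>+z. ennreal (\<Sum>i<z. x ^ (z - 1 - i)) \<partial>p) = ennreal (dquot p x)"
    unfolding dquot_def using power_sum_bounds[OF assms] by (intro nn_integral_eq_integral) auto
  then show ?thesis
    using assms by (simp add: tl_functional_def sum_ennreal)
qed

text \<open>If \<open>z\<close> is positive, the position \<open>z - 1\<close> has exponent 0 and
  contributes 1. The bound does not depend on \<open>x\<close> and later serves as a uniform
  denominator.\<close>

lemma dquot_ge:
  assumes "0 \<le> x" "x \<le> 1"
  shows "measure_pmf.prob p {1..} \<le> dquot p x"
proof -
  have "measure_pmf.prob p {1..} = measure_pmf.expectation p (indicator {1..})"
    by simp
  also have "\<dots> \<le> dquot p x"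
    unfolding dquot_def
  proof (rule integral_mono)
    show "integrable (measure_pmf p) (indicator {1..} :: nat \<Rightarrow> real)"
      by (rule integrable_pmf_bounded[where K = 1]) (auto simp: indicator_def)
    show "integrable (measure_pmf p) (\<lambda>z. \<Sum>i<z. x ^ (z - 1 - i))"
      using power_sum_bounds[OF assms] by (intro integrable_linear[where K = 1]) auto
    show "indicator {1..} z \<le> (\<Sum>i<z. x ^ (z - 1 - i))" for z
    proof (cases z)
      case (Suc k)
      then show ?thesis using power_sum_bounds(1)[OF assms, of 0] assms
        by (auto intro!: sum_nonneg)
    qed auto
  qed
  finally show ?thesis .
qed

lemma surv_pos: "0 < measure_pmf.prob p {1..}"
proof (rule ccontr)
  assume "\<not> ?thesis"
  then have "measure_pmf.prob p {1..} = 0"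
    using measure_nonneg[of "measure_pmf p" "{1..}"] by linarith
  then have "AE z in p. real z = 0"
    by (auto simp: AE_measure_pmf_iff measure_pmf_zero_iff)
  then have "measure_pmf.expectation p real = 0"
    by (simp add: integral_eq_zero_AE)
  then show False using mean_pos by simp
qed

lemma dquot_pos: "0 \<le> x \<Longrightarrow> x \<le> 1 \<Longrightarrow> 0 < dquot p x"
  using dquot_ge surv_pos by fastforce

lemma dquot_1: "dquot p 1 = measure_pmf.expectation p real"
  by (simp add: dquot_def)

lemma dquot_0: "dquot p 0 = measure_pmf.prob p {1..}"
proof -
  have "(\<Sum>i<z. (0::real) ^ (z - 1 - i)) = indicator {1..} z" for z
    using sum_zero_power[of z "\<lambda>_. 1"] by (auto simp: indicator_def)
  then have "dquot p 0 = measure_pmf.expectation p (indicator {1..})"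
    unfolding dquot_def by metis
  then show ?thesis by simp
qed

lemma tl_weight_sum:
  assumes x: "0 \<le> x" "x \<le> 1"
  shows "(\<integral>\<^sup>+i. ennreal (tl_weight p x i) * h i \<partial>count_space UNIV) = tl_functional p x h"
proof -
  have w: "ennreal (tl_weight p x i) = (\<integral>\<^sup>+z. ennreal (if i < z then x ^ (z - 1 - i) else 0) \<partial>p)" for i
    unfolding tl_weight_def using x
    by (intro nn_integral_eq_integral[symmetric] integrable_pmf_bounded[where K = 1]) (auto simp: power_le_one)
  have "(\<integral>\<^sup>+i. ennreal (tl_weight p x i) * h i \<partial>count_space UNIV)
      = (\<Sum>i. \<integral>\<^sup>+z. ennreal (if i < z then x ^ (z - 1 - i) else 0) * h i \<partial>p)"
    by (simp add: nn_integral_count_space_nat w nn_integral_multc)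
  also have "\<dots> = (\<integral>\<^sup>+z. (\<Sum>i. ennreal (if i < z then x ^ (z - 1 - i) else 0) * h i) \<partial>p)"
    by (rule nn_integral_suminf[symmetric]) simp
  also have "\<dots> = tl_functional p x h"
    unfolding tl_functional_def
    by (intro nn_integral_cong trans[OF suminf_finite[OF finite_lessThan]]) auto
  finally show ?thesis .
qed

lemma tl_weight_nonneg: "0 \<le> x \<Longrightarrow> 0 \<le> tl_weight p x i"
  unfolding tl_weight_def by (intro integral_nonneg_AE) auto

lemma nn_integral_tl_pmf:
  assumes x: "0 \<le> x" "x \<le> 1"
  shows "tl_functional p x h = ennreal (dquot p x) * (\<integral>\<^sup>+i. h i \<partial>tl_pmf p x)"
proof -
  note d = dquot_pos[OF x]
  have 0: "ennreal (dquot p x) * ennreal (tl_weight p x i / dquot p x) = ennreal (tl_weight p x i)" for i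
    using d tl_weight_nonneg[OF x(1), of i] by (simp flip: ennreal_mult)
  have *: "ennreal (dquot p x) * (\<integral>\<^sup>+i. ennreal (tl_weight p x i / dquot p x) * h i \<partial>count_space UNIV) = tl_functional p x h" for h
    by (simp flip: nn_integral_cmult tl_weight_sum[OF x] add: mult.assoc[symmetric] 0)
  have "(\<integral>\<^sup>+i. ennreal (tl_weight p x i / dquot p x) \<partial>count_space UNIV) = 1"
    using *[of "\<lambda>_. 1"] d tl_functional_one[OF x] by (simp add: ennreal_mult_cancel_left[of _ _ 1, simplified])
  \<comment> \<open>The case h = 1 has just shown that the normalized weights have total mass 1, as
    \<open>embed_pmf\<close> demands.\<close>
  then have "pmf (tl_pmf p x) i = tl_weight p x i / dquot p x" for i
    unfolding tl_pmf_def using d tl_weight_nonneg[OF x(1)] by (intro pmf_embed_pmf) auto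
  then show ?thesis
    by (simp add: nn_integral_measure_pmf *)
qed

lemma expectation_tl_pmf:
  assumes x: "0 \<le> x" "x \<le> 1" and h: "\<And>i. \<bar>h i\<bar> \<le> K"
  shows "dquot p x * measure_pmf.expectation (tl_pmf p x) h
    = measure_pmf.expectation p (\<lambda>z. \<Sum>i<z. x ^ (z - 1 - i) * h i)"
proof -
  have K: "0 \<le> K" using h[of 0] by linarith
  have b: "\<bar>\<Sum>i<z. x ^ (z - 1 - i) * h i\<bar> \<le> K * real z" for z
  proof -
    have "\<bar>\<Sum>i<z. x ^ (z - 1 - i) * h i\<bar> \<le> (\<Sum>i<z. \<bar>x ^ (z - 1 - i) * h i\<bar>)"
      by (rule sum_abs)
    also have "\<dots> \<le> (\<Sum>i<z. 1 * K)"
      unfolding abs_mult using x h by (intro sum_mono mult_mono) (auto simp: power_le_one)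
    finally show ?thesis by (simp add: mult.commute)
  qed
  have i1: "integrable (measure_pmf p) (\<lambda>z. \<Sum>i<z. x ^ (z - 1 - i) * h i)"
    using b by (rule integrable_linear)
  have i2: "integrable (measure_pmf p) (\<lambda>z. \<Sum>i<z. x ^ (z - 1 - i))"
    using power_sum_bounds[OF x] by (intro integrable_linear[where K = 1]) auto
  \<comment> \<open>The identity is read off from \<open>nn_integral_tl_pmf\<close> for the shifted
    function; the shift contributes \<open>dquot p x * K\<close> to both sides.\<close>
  have nn: "0 \<le> h i + K" for i using h[of i] by linarith
  have e: "0 \<le> measure_pmf.expectation (tl_pmf p x) h + K"
    using abs_expectation_le[of h K "tl_pmf p x"] h by (simp add: abs_le_iff)
  have "tl_functional p x (\<lambda>i. ennreal (h i + K)) = (\<integral>\<^sup>+z. ennreal (\<Sum>i<z. x ^ (z - 1 - i) * (h i + K)) \<partial>p)"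
    unfolding tl_functional_def using x nn
    by (intro nn_integral_cong, subst sum_ennreal[symmetric]) (auto simp: ennreal_mult)
  also have "\<dots> = ennreal (measure_pmf.expectation p (\<lambda>z. \<Sum>i<z. x ^ (z - 1 - i) * (h i + K)))"
  proof (rule nn_integral_eq_integral)
    show "integrable (measure_pmf p) (\<lambda>z. \<Sum>i<z. x ^ (z - 1 - i) * (h i + K))"
      using i1 i2 by (simp add: distrib_left sum.distrib flip: sum_distrib_right)
    show "AE z in p. 0 \<le> (\<Sum>i<z. x ^ (z - 1 - i) * (h i + K))"
      using x nn by (auto intro!: sum_nonneg)
  qed
  also have "measure_pmf.expectation p (\<lambda>z. \<Sum>i<z. x ^ (z - 1 - i) * (h i + K))
      = measure_pmf.expectation p (\<lambda>z. \<Sum>i<z. x ^ (z - 1 - i) * h i) + dquot p x * K"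
    using i1 i2 by (simp add: distrib_left sum.distrib dquot_def flip: sum_distrib_right)
  finally have "ennreal (dquot p x * (measure_pmf.expectation (tl_pmf p x) h + K))
      = ennreal (measure_pmf.expectation p (\<lambda>z. \<Sum>i<z. x ^ (z - 1 - i) * h i) + dquot p x * K)" (is "ennreal ?l = ennreal ?r")
    using dquot_pos[OF x] e by (simp add: nn_integral_tl_pmf[OF x] nn_integral_shift[OF h] ennreal_mult)
  moreover have "0 \<le> ?l"
    using dquot_pos[OF x] e by (intro mult_nonneg_nonneg) auto
  moreover have "0 \<le> ?r"
  proof -
    have "0 \<le> measure_pmf.expectation p (\<lambda>z. \<Sum>i<z. x ^ (z - 1 - i) * (h i + K))"
      using x nn by (intro integral_nonneg_AE) (auto intro!: sum_nonneg)
    then show ?thesis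
      using i1 i2 by (simp add: distrib_left sum.distrib dquot_def flip: sum_distrib_right)
  qed
  ultimately show ?thesis by (simp add: distrib_left)
qed

end

section \<open>Random sums: means and the chain rule\<close>

lemma nn_integral_nsum_real:
  "(\<integral>\<^sup>+s. ennreal (real s) \<partial>nsum m p) = of_nat m * (\<integral>\<^sup>+z. ennreal (real z) \<partial>measure_pmf p)"
proof (induction m)
  case (Suc m)
  have "(\<integral>\<^sup>+s. ennreal (real s) \<partial>nsum (Suc m) p)
      = (\<integral>\<^sup>+z. ennreal (real z) \<partial>measure_pmf p) + (\<integral>\<^sup>+s. ennreal (real s) \<partial>nsum m p)"
    by (simp add: ennreal_plus nn_integral_add)
  then show ?case
    by (simp add: Suc distrib_right)
qed simp

lemma (in offspring) nn_integral_real: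
  "(\<integral>\<^sup>+z. ennreal (real z) \<partial>measure_pmf p) = ennreal (measure_pmf.expectation p real)"
  using integrable by (intro nn_integral_eq_integral) auto

lemma
  assumes "offspring r" "offspring p"
  defines "Z \<equiv> bind_pmf r (\<lambda>m. nsum m p)"
  shows expectation_bind_nsum:
      "measure_pmf.expectation Z real = measure_pmf.expectation r real * measure_pmf.expectation p real" (is ?e)
    and offspring_bind_nsum: "offspring Z"
proof -
  interpret r: offspring r by fact
  interpret p: offspring p by fact
  have "(\<integral>\<^sup>+s. ennreal (real s) \<partial>Z)
      = (\<integral>\<^sup>+m. ennreal (real m) * ennreal (measure_pmf.expectation p real) \<partial>r)"
    unfolding Z_def nn_integral_bind_pmf nn_integral_nsum_real p.nn_integral_real ennreal_of_nat_eq_real_of_nat ..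
  also have "\<dots> = ennreal (measure_pmf.expectation r real * measure_pmf.expectation p real)"
    using r.mean_pos p.mean_pos by (subst nn_integral_multc) (auto simp: r.nn_integral_real ennreal_mult)
  finally have *: "(\<integral>\<^sup>+s. ennreal (real s) \<partial>Z)
      = ennreal (measure_pmf.expectation r real * measure_pmf.expectation p real)" .
  then have i: "integrable (measure_pmf Z) real"
    by (intro integrableI_nonneg) auto
  then show ?e
    using * r.mean_pos p.mean_pos
    by (subst (asm) nn_integral_eq_integral) (auto intro!: integral_nonneg_AE)
  then show "offspring Z"
    using i r.mean_pos p.mean_pos by unfold_locales auto
qed

text \<open>
  This is the chain rule for divided differences of generating functions: with \<open>y = f x\<close> and
  \<open>v = f u\<close>, it reads \<open>(g v - g y) / (u - x) = (g v - g y) / (v - y) \<sqdot> (f u - f x) / (u - x)\<close>.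
\<close>

lemma tl_pmf_bind_nsum:
  assumes r: "offspring r" and p: "offspring p" and x: "0 \<le> x" "x \<le> 1"
  shows "tl_pmf (bind_pmf r (\<lambda>m. nsum m p)) x
    = bind_pmf (tl_pmf p x) (\<lambda>l. bind_pmf (tl_pmf r (pgf p x)) (\<lambda>i. map_pmf ((+) l) (nsum i p)))"
    (is "tl_pmf ?Z x = ?R")
proof -
  interpret r: offspring r by fact
  interpret p: offspring p by fact
  interpret Z: offspring ?Z using r p by (rule offspring_bind_nsum)
  define y where "y = pgf p x"
  have y: "0 \<le> y" "y \<le> 1"
    using pgf_bounds[OF x] by (auto simp: y_def)
  define d where "d = dquot r y * dquot p x"
  have d: "0 < d"
    using r.dquot_pos[OF y] p.dquot_pos[OF x] by (simp add: d_def)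
  have "?R = bind_pmf (tl_pmf r y) (\<lambda>i. bind_pmf (tl_pmf p x) (\<lambda>l. map_pmf ((+) l) (nsum i p)))"
    unfolding y_def by (rule bind_commute_pmf)
  then have R: "(\<integral>\<^sup>+k. h k \<partial>?R)
      = (\<integral>\<^sup>+i. (\<integral>\<^sup>+l. (\<integral>\<^sup>+s. h (l + s) \<partial>nsum i p) \<partial>tl_pmf p x) \<partial>tl_pmf r y)" for h
    by simp
  have *: "ennreal (dquot ?Z x) * (\<integral>\<^sup>+k. h k \<partial>tl_pmf ?Z x) = ennreal d * (\<integral>\<^sup>+k. h k \<partial>?R)" for h
  proof -
    have "ennreal (dquot ?Z x) * (\<integral>\<^sup>+k. h k \<partial>tl_pmf ?Z x)
        = tl_functional r y (\<lambda>i. tl_functional p x (\<lambda>l. \<integral>\<^sup>+s. h (l + s) \<partial>nsum i p))"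
      unfolding Z.nn_integral_tl_pmf[OF x, symmetric] tl_functional_bind_nsum[OF x] y_def ..
    also have "\<dots> = ennreal (dquot r y) * (ennreal (dquot p x) * (\<integral>\<^sup>+k. h k \<partial>?R))"
      unfolding r.nn_integral_tl_pmf[OF y] p.nn_integral_tl_pmf[OF x] R by (subst nn_integral_cmult) auto
    also have "\<dots> = ennreal d * (\<integral>\<^sup>+k. h k \<partial>?R)"
      using r.dquot_pos[OF y] p.dquot_pos[OF x] by (simp add: d_def ennreal_mult mult.assoc)
    finally show ?thesis .
  qed
  \<comment> \<open>A constant function compares the normalizing factors: divided differences at (1,
    x) multiply under composition. Being positive and finite, the factor can then be
    cancelled.\<close>
  have "dquot ?Z x = d"
    using *[of "\<lambda>_. 1"] d Z.dquot_pos[OF x] by simp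
  then have **: "(\<integral>\<^sup>+k. h k \<partial>tl_pmf ?Z x) = (\<integral>\<^sup>+k. h k \<partial>?R)" for h
    using *[of h] d by (simp add: ennreal_mult_cancel_left)
  show ?thesis
  proof (rule pmf_eqI)
    fix j
    show "pmf (tl_pmf ?Z x) j = pmf ?R j"
      using **[of "indicator {j}"] by (simp add: emeasure_pmf_single del: nn_integral_bind_pmf nn_integral_map_pmf)
  qed
qed

subsection \<open>Comparison of the equilibrium law and the conditional law\<close>

text \<open>Wasserstein distance at most \<open>D\<close> for laws on the naturals. The test
  functions are bounded, so that no expectation falls back to its default value 0, but the bound
  \<open>K\<close> does not enter the estimate.\<close>

definition lip_close :: "nat pmf \<Rightarrow> nat pmf \<Rightarrow> real \<Rightarrow> bool" where
  "lip_close P Q D \<longleftrightarrow> (\<forall>h K L. (\<forall>i. \<bar>h i\<bar> \<le> K) \<longrightarrow> (\<forall>i. \<bar>h (Suc i) - h i\<bar> \<le> L) \<longrightarrow>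
     \<bar>measure_pmf.expectation P h - measure_pmf.expectation Q h\<bar> \<le> L * D)"

lemma lip_closeD:
  assumes "lip_close P Q D" "\<And>i. \<bar>h i\<bar> \<le> K" "\<And>i. \<bar>h (Suc i) - h i\<bar> \<le> L"
  shows "\<bar>measure_pmf.expectation P h - measure_pmf.expectation Q h\<bar> \<le> L * D"
  using assms unfolding lip_close_def by blast

lemma lip_close_mono:
  assumes "lip_close P Q D" "D \<le> D'"
  shows "lip_close P Q D'"
  unfolding lip_close_def
proof (intro allI impI)
  fix h :: "nat \<Rightarrow> real" and K L :: real
  assume h: "\<forall>i. \<bar>h i\<bar> \<le> K" and l: "\<forall>i. \<bar>h (Suc i) - h i\<bar> \<le> L"
  have "0 \<le> L" using l by (metis abs_ge_zero order_trans)
  then show "\<bar>measure_pmf.expectation P h - measure_pmf.expectation Q h\<bar> \<le> L * D'"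
    using lip_closeD[OF assms(1)] h l assms(2) by (meson mult_left_mono order_trans)
qed

lemma lipschitz_nat:
  fixes h :: "nat \<Rightarrow> real"
  assumes "\<And>i. \<bar>h (Suc i) - h i\<bar> \<le> L"
  shows "\<bar>h (i + k) - h i\<bar> \<le> L * real k"
proof (induction k)
  case (Suc k)
  then show ?case using assms[of "i + k"] by (simp add: algebra_simps)
qed simp

text \<open>The two sums can share \<open>i\<close> summands. They then differ by one copy of
  \<open>p\<close>, and its mean bounds the expected shift of the argument of
  \<open>h\<close>.\<close>

lemma (in offspring) nsum_lipschitz:
  fixes h :: "nat \<Rightarrow> real"
  assumes h: "\<And>i. \<bar>h i\<bar> \<le> K" and L: "\<And>i. \<bar>h (Suc i) - h i\<bar> \<le> L"
  shows "\<bar>measure_pmf.expectation (nsum (Suc i) p) h - measure_pmf.expectation (nsum i p) h\<bar>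
    \<le> L * measure_pmf.expectation p real"
proof -
  let ?E = "measure_pmf.expectation"
  have L0: "0 \<le> L" using L[of 0] by linarith
  have b: "\<bar>?E (nsum i p) (\<lambda>s. h (z + s))\<bar> \<le> K" for z
    by (rule abs_expectation_le) (rule h)
  have "\<bar>?E (nsum i p) (\<lambda>s. h (z + s)) - ?E (nsum i p) h\<bar> \<le> L * real z" for z
  proof -
    have "?E (nsum i p) (\<lambda>s. h (z + s)) - ?E (nsum i p) h = ?E (nsum i p) (\<lambda>s. h (z + s) - h s)"
      by (intro Bochner_Integration.integral_diff[symmetric] integrable_pmf_bounded[OF h])
    also have "\<bar>\<dots>\<bar> \<le> L * real z"
      using lipschitz_nat[of h L] L by (intro abs_expectation_le) (simp add: add.commute)
    finally show ?thesis .
  qed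
  note d = this
  have "?E (nsum (Suc i) p) h - ?E (nsum i p) h
      = ?E p (\<lambda>z. ?E (nsum i p) (\<lambda>s. h (z + s))) - ?E (nsum i p) h"
    by (simp add: expectation_bind_pmf[OF h])
  also have "\<dots> = ?E p (\<lambda>z. ?E (nsum i p) (\<lambda>s. h (z + s)) - ?E (nsum i p) h)"
    using b by (subst Bochner_Integration.integral_diff) (auto intro: integrable_pmf_bounded)
  also have "\<bar>\<dots>\<bar> \<le> ?E p (\<lambda>z. \<bar>?E (nsum i p) (\<lambda>s. h (z + s)) - ?E (nsum i p) h\<bar>)"
    by (rule integral_abs_bound)
  also have "\<dots> \<le> ?E p (\<lambda>z. L * real z)"
    using d integrable L0 by (intro integral_mono integrable_linear[where K = L]) auto
  finally show ?thesis by simp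
qed

text \<open>By the chain rule \<open>tl_pmf Z x\<close> is the law of l plus a sum of i copies of
  \<open>p\<close>, where l and i are independent. Changing the law of l costs \<open>D\<close>.
  Changing the law of i costs \<open>D'\<close> times the mean of \<open>p\<close>, since the sum is
  Lipschitz in the number of summands.\<close>

lemma lip_close_bind_nsum:
  assumes r: "offspring r" and p: "offspring p"
    and D: "lip_close (tl_pmf p 1) (tl_pmf p 0) D"
    and D': "lip_close (tl_pmf r 1) (tl_pmf r (pgf p 0)) D'"
  defines "Z \<equiv> bind_pmf r (\<lambda>m. nsum m p)"
  shows "lip_close (tl_pmf Z 1) (tl_pmf Z 0) (D + measure_pmf.expectation p real * D')"
  unfolding lip_close_def
proof (intro allI impI)
  let ?E = "measure_pmf.expectation"
  interpret p: offspring p by fact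
  fix h :: "nat \<Rightarrow> real" and K L :: real
  assume h: "\<forall>i. \<bar>h i\<bar> \<le> K" and L: "\<forall>i. \<bar>h (Suc i) - h i\<bar> \<le> L"
  define \<phi> where "\<phi> l i = ?E (nsum i p) (\<lambda>s. h (l + s))" for l i
  \<comment> \<open>The expectation of \<open>h\<close> under \<open>tl_pmf Z x\<close> is that of
    \<open>H x\<close> under \<open>tl_pmf p x\<close>. So \<open>x\<close> enters twice and is
    changed in two stages: in the law of \<open>l\<close> with \<open>H 1\<close> kept, then in
    \<open>H\<close>.\<close>
  define H where "H x l = ?E (tl_pmf r (pgf p x)) (\<phi> l)" for x l
  have p1: "pgf p 1 = 1" by (simp add: pgf_def)
  have \<phi>b: "\<bar>\<phi> l i\<bar> \<le> K" for l i
    unfolding \<phi>_def using h by (intro abs_expectation_le) auto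
  then have Hb: "\<bar>H x l\<bar> \<le> K" for x l
    unfolding H_def by (intro abs_expectation_le)
  have E: "?E (tl_pmf Z x) h = ?E (tl_pmf p x) (H x)" if "0 \<le> x" "x \<le> 1" for x
    unfolding Z_def tl_pmf_bind_nsum[OF r p that] H_def \<phi>_def
    using h by (subst expectation_bind_pmf[where K = K], simp, subst expectation_bind_pmf[where K = K]) auto
  have \<phi>L: "\<bar>\<phi> (Suc l) i - \<phi> l i\<bar> \<le> L" for l i
  proof -
    have "\<phi> (Suc l) i - \<phi> l i = ?E (nsum i p) (\<lambda>s. h (Suc l + s) - h (l + s))"
      unfolding \<phi>_def using h
      by (intro Bochner_Integration.integral_diff[symmetric] integrable_pmf_bounded[where K = K]) auto
    also have "\<bar>\<dots>\<bar> \<le> L"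
      using L by (intro abs_expectation_le) simp
    finally show ?thesis .
  qed
  have HL: "\<bar>H x (Suc l) - H x l\<bar> \<le> L" for x l
  proof -
    have "H x (Suc l) - H x l = ?E (tl_pmf r (pgf p x)) (\<lambda>i. \<phi> (Suc l) i - \<phi> l i)"
      unfolding H_def by (intro Bochner_Integration.integral_diff[symmetric] integrable_pmf_bounded[OF \<phi>b])
    also have "\<bar>\<dots>\<bar> \<le> L"
      using \<phi>L by (rule abs_expectation_le)
    finally show ?thesis .
  qed
  have "\<bar>?E (tl_pmf p 1) (H 1) - ?E (tl_pmf p 0) (H 1)\<bar> \<le> L * D"
    using D Hb HL by (rule lip_closeD)
  moreover have "\<bar>H 1 l - H 0 l\<bar> \<le> L * ?E p real * D'" for l
    unfolding H_def p1 using D' \<phi>b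
  proof (rule lip_closeD)
    show "\<bar>\<phi> l (Suc i) - \<phi> l i\<bar> \<le> L * ?E p real" for i
      unfolding \<phi>_def using h L by (intro p.nsum_lipschitz[where K = K]) auto
  qed
  then have "\<bar>?E (tl_pmf p 0) (\<lambda>l. H 1 l - H 0 l)\<bar> \<le> L * ?E p real * D'"
    by (rule abs_expectation_le)
  then have "\<bar>?E (tl_pmf p 0) (H 1) - ?E (tl_pmf p 0) (H 0)\<bar> \<le> L * ?E p real * D'"
    using integrable_pmf_bounded[OF Hb] by (subst (asm) Bochner_Integration.integral_diff) auto
  ultimately show "\<bar>?E (tl_pmf Z 1) h - ?E (tl_pmf Z 0) h\<bar> \<le> L * (D + ?E p real * D')"
    by (simp add: E distrib_left mult.assoc)
qed

section \<open>One offspring law: dependence of \<open>tl_pmf\<close> on its point\<close>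

lemma falling_fact_2: "falling_fact 2 z = real z * (real z - 1)"
  by (simp add: falling_fact_def numeral_2_eq_2)

lemma falling_fact_3: "falling_fact 3 z = real z * (real z - 1) * (real z - 2)"
  by (simp add: falling_fact_def numeral_3_eq_3)

lemma sum_pairs: "(\<Sum>i<z. real i) = falling_fact 2 z / 2"
  by (induction z) (auto simp: falling_fact_2 field_simps)

lemma sum_pairs_rev: "(\<Sum>i<z. real (z - 1 - i)) = falling_fact 2 z / 2"
  using sum.nat_diff_reindex[of real z] sum_pairs[of z] by simp

text \<open>Both sides count the three-element subsets of {0..<z}: with middle element
  \<open>i\<close> there are \<open>i\<close> choices below and \<open>z - 1 - i\<close> above. This
  is where third factorial moments come from.\<close>

lemma sum_triples: "(\<Sum>i<z. real i * real (z - 1 - i)) = falling_fact 3 z / 6"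
proof (induction z)
  case (Suc z)
  have "(\<Sum>i<Suc z. real i * real (Suc z - 1 - i)) = (\<Sum>i<z. real i * real (z - i))"
    by simp
  also have "\<dots> = (\<Sum>i<z. real i * real (z - 1 - i) + real i)"
    by (intro sum.cong refl) (auto simp: of_nat_diff algebra_simps)
  also have "\<dots> = falling_fact 3 z / 6 + falling_fact 2 z / 2"
    unfolding sum.distrib Suc sum_pairs ..
  also have "\<dots> = falling_fact 3 (Suc z) / 6"
    by (simp add: falling_fact_2 falling_fact_3 field_simps)
  finally show ?case .
qed (simp add: falling_fact_3)

lemma one_minus_power_le:
  fixes x :: real
  assumes "0 \<le> x" "x \<le> 1"
  shows "1 - x ^ k \<le> real k * (1 - x)"
  using Bernoulli_inequality[of "x - 1" k] assms by (simp add: algebra_simps)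

lemma falling_fact_nonneg: "0 \<le> falling_fact j z"
proof (cases "j \<le> z")
  case True
  then show ?thesis unfolding falling_fact_def by (intro prod_nonneg) auto
next
  case False
  then have "falling_fact j z = 0" unfolding falling_fact_def
    by (intro prod_zero) (auto intro: bexI[of _ z])
  then show ?thesis by simp
qed

locale offspring3 = offspring +
  assumes integrable3: "integrable (measure_pmf p) (falling_fact 3)"
begin

lemma integrable2: "integrable (measure_pmf p) (falling_fact 2)"
proof (rule Bochner_Integration.integrable_bound[where f = "\<lambda>z. falling_fact 3 z + 2 * real z"])
  show "integrable (measure_pmf p) (\<lambda>z. falling_fact 3 z + 2 * real z)"
    using integrable integrable3 by simp
  \<comment> \<open>From z = 3 on the third falling factorial dominates the second. At z = 2 it
    vanishes, which is the reason for the term \<open>2 * real z\<close>.\<close>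
  have "falling_fact 2 z \<le> falling_fact 3 z + 2 * real z" for z
  proof -
    consider "z = 0" | "z = 1" | "z = 2" | "z \<ge> 3" by linarith
    then show ?thesis
    proof cases
      case 4
      then have "falling_fact 2 z \<le> falling_fact 3 z"
        unfolding falling_fact_2 falling_fact_3
        using mult_left_mono[of 1 "real z - 2" "real z * (real z - 1)"] by simp
      then show ?thesis by simp
    qed (auto simp: falling_fact_2 falling_fact_3)
  qed
  then show "AE z in p. norm (falling_fact 2 z) \<le> norm (falling_fact 3 z + 2 * real z)"
    by (simp add: falling_fact_nonneg)
qed simp

text \<open>Let m and d be the normalizing factors at 1 and x, and e, e' the expectations. Then d (e
  - e') = (m e - d e') - (m - d) e. Both differences on the right are of order 1 - x, because 1 -
  x^k is at most k (1 - x): the first one produces the third factorial moment, the product the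
  square of the second. Dividing by d is controlled by \<open>dquot_ge\<close>.\<close>

lemma lip_close_tl_pmf:
  assumes x: "0 \<le> x" "x \<le> 1"
  shows "lip_close (tl_pmf p 1) (tl_pmf p x)
    ((1 - x) * ((fmoment 2 p)\<^sup>2 / (4 * measure_pmf.expectation p real) + fmoment 3 p / 6)
      / measure_pmf.prob p {1..})"
  unfolding lip_close_def
proof (intro allI impI)
  let ?E = "measure_pmf.expectation"
  fix h :: "nat \<Rightarrow> real" and K L :: real
  assume h: "\<forall>i. \<bar>h i\<bar> \<le> K" and L: "\<forall>i. \<bar>h (Suc i) - h i\<bar> \<le> L"
  have L0: "0 \<le> L" using L by (metis abs_ge_zero order_trans)
  \<comment> \<open>Subtracting the value at 0 leaves differences of expectations unchanged and
    gives a function of at most linear growth with slope \<open>L\<close>.\<close>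
  define \<psi> where "\<psi> i = h i - h 0" for i
  have \<psi>K: "\<bar>\<psi> i\<bar> \<le> 2 * K" for i
    using h[rule_format, of i] h[rule_format, of 0] unfolding \<psi>_def by linarith
  have \<psi>L: "\<bar>\<psi> i\<bar> \<le> L * real i" for i
    using lipschitz_nat[of h L 0 i] L by (simp add: \<psi>_def)
  define m where "m = ?E p real"
  define d where "d = dquot p x"
  define e where "e = ?E (tl_pmf p 1) \<psi>"
  have m: "0 < m" using mean_pos by (simp add: m_def)
  have d: "0 < d" using dquot_pos[OF x] by (simp add: d_def)
  have f2: "0 \<le> fmoment 2 p" and f3: "0 \<le> fmoment 3 p"
    unfolding fmoment_def using falling_fact_nonneg by (auto intro!: integral_nonneg_AE)
  have s\<psi>: "\<bar>\<Sum>i<z. \<psi> i\<bar> \<le> 2 * K * real z" for z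
  proof -
    have "\<bar>\<Sum>i<z. \<psi> i\<bar> \<le> (\<Sum>i<z. 2 * K)"
      using \<psi>K by (intro order_trans[OF sum_abs] sum_mono)
    then show ?thesis by (simp add: algebra_simps)
  qed
  have sx\<psi>: "\<bar>\<Sum>i<z. x ^ (z - 1 - i) * \<psi> i\<bar> \<le> 2 * K * real z" for z
  proof -
    have "\<bar>x ^ (z - 1 - i) * \<psi> i\<bar> \<le> 1 * (2 * K)" for i
      unfolding abs_mult using x \<psi>K[of i] by (intro mult_mono) (auto simp: power_le_one)
    then have "\<bar>\<Sum>i<z. x ^ (z - 1 - i) * \<psi> i\<bar> \<le> (\<Sum>i<z. 1 * (2 * K))"
      by (intro order_trans[OF sum_abs] sum_mono)
    then show ?thesis by (simp add: algebra_simps)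
  qed
  have e1: "m * e = ?E p (\<lambda>z. \<Sum>i<z. \<psi> i)"
    using expectation_tl_pmf[of 1 \<psi> "2 * K"] \<psi>K by (simp add: dquot_1 m_def e_def)
  have "\<bar>m * e\<bar> \<le> ?E p (\<lambda>z. \<bar>\<Sum>i<z. \<psi> i\<bar>)"
    unfolding e1 by (rule integral_abs_bound)
  also have "\<dots> \<le> ?E p (\<lambda>z. L * (falling_fact 2 z / 2))"
  proof (rule integral_mono)
    show "integrable (measure_pmf p) (\<lambda>z. \<bar>\<Sum>i<z. \<psi> i\<bar>)"
      using s\<psi> by (intro integrable_linear[where K = "2 * K"]) auto
    show "integrable (measure_pmf p) (\<lambda>z. L * (falling_fact 2 z / 2))"
      using integrable2 by simp
    show "\<bar>\<Sum>i<z. \<psi> i\<bar> \<le> L * (falling_fact 2 z / 2)" for z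
      using \<psi>L by (intro order_trans[OF sum_abs]) (simp add: sum_distrib_left sum_mono flip: sum_pairs)
  qed
  also have "\<dots> = L * fmoment 2 p / 2"
    by (simp add: fmoment_def)
  \<comment> \<open>\<open>fmoment 2 p / (2 * m)\<close> is the mean of
    \<open>tl_pmf p 1\<close>.\<close>
  finally have e2: "\<bar>e\<bar> \<le> L * fmoment 2 p / (2 * m)"
    using m by (simp add: abs_mult field_simps)
  have md: "m - d = ?E p (\<lambda>z. \<Sum>i<z. 1 - x ^ (z - 1 - i))"
    unfolding m_def d_def dquot_def using power_sum_bounds[OF x] integrable
    by (simp add: sum_subtractf integrable_linear[where K = 1])
  have pw: "0 \<le> 1 - x ^ k" "1 - x ^ k \<le> real k * (1 - x)" for k
    using x one_minus_power_le[OF x, of k] by (auto simp: power_le_one)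
  have s1: "(\<Sum>i<z. 1 - x ^ (z - 1 - i)) \<le> (1 - x) * (falling_fact 2 z / 2)" for z
    unfolding sum_pairs_rev[symmetric] sum_distrib_left
    by (intro sum_mono order_trans[OF pw(2)] eq_refl mult.commute)
  have s0: "0 \<le> (\<Sum>i<z. 1 - x ^ (z - 1 - i))" for z
    using pw by (intro sum_nonneg) auto
  have s2: "(\<Sum>i<z. 1 - x ^ (z - 1 - i)) \<le> real z" for z
    using sum_mono[of "{..<z}" "\<lambda>i. 1 - x ^ (z - 1 - i)" "\<lambda>_. 1"] x by simp
  have si: "integrable (measure_pmf p) (\<lambda>z. \<Sum>i<z. 1 - x ^ (z - 1 - i))"
    using s0 s2 by (intro integrable_linear[where K = 1]) auto
  have md0: "0 \<le> m - d"
    unfolding md using s0 by (intro integral_nonneg_AE) auto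
  have "m - d \<le> ?E p (\<lambda>z. (1 - x) * (falling_fact 2 z / 2))"
    unfolding md using si s1 integrable2 by (intro integral_mono) auto
  then have md1: "m - d \<le> (1 - x) * fmoment 2 p / 2"
    by (simp add: fmoment_def)
  define g where "g = ?E p (\<lambda>z. \<Sum>i<z. (1 - x ^ (z - 1 - i)) * \<psi> i)"
  have g1: "g = m * e - d * ?E (tl_pmf p x) \<psi>"
  proof -
    have "d * ?E (tl_pmf p x) \<psi> = ?E p (\<lambda>z. \<Sum>i<z. x ^ (z - 1 - i) * \<psi> i)"
      unfolding d_def using x \<psi>K by (rule expectation_tl_pmf)
    then show ?thesis
      unfolding e1 g_def using s\<psi> sx\<psi>
      by (simp add: left_diff_distrib sum_subtractf integrable_linear[where K = "2 * K"])
  qed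
  have sg: "\<bar>\<Sum>i<z. (1 - x ^ (z - 1 - i)) * \<psi> i\<bar> \<le> L * (1 - x) * (falling_fact 3 z / 6)" for z
  proof -
    have "\<bar>\<Sum>i<z. (1 - x ^ (z - 1 - i)) * \<psi> i\<bar> \<le> (\<Sum>i<z. (real (z - 1 - i) * (1 - x)) * (L * real i))"
    proof (intro order_trans[OF sum_abs] sum_mono)
      fix i
      show "\<bar>(1 - x ^ (z - 1 - i)) * \<psi> i\<bar> \<le> (real (z - 1 - i) * (1 - x)) * (L * real i)"
        unfolding abs_mult using pw[of "z - 1 - i"] \<psi>L[of i] x by (intro mult_mono) auto
    qed
    also have "\<dots> = L * (1 - x) * (falling_fact 3 z / 6)"
      unfolding sum_triples[symmetric] sum_distrib_left by (intro sum.cong) auto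
    finally show ?thesis .
  qed
  have "\<bar>g\<bar> \<le> ?E p (\<lambda>z. \<bar>\<Sum>i<z. (1 - x ^ (z - 1 - i)) * \<psi> i\<bar>)"
    unfolding g_def by (rule integral_abs_bound)
  also have "\<dots> \<le> ?E p (\<lambda>z. L * (1 - x) * (falling_fact 3 z / 6))"
  proof (rule integral_mono)
    show i: "integrable (measure_pmf p) (\<lambda>z. L * (1 - x) * (falling_fact 3 z / 6))"
      using integrable3 by simp
    show "integrable (measure_pmf p) (\<lambda>z. \<bar>\<Sum>i<z. (1 - x ^ (z - 1 - i)) * \<psi> i\<bar>)"
      by (rule Bochner_Integration.integrable_bound[OF i]) (use sg in \<open>auto intro: order_trans[OF _ abs_ge_self]\<close>)
  qed (rule sg)
  finally have g2: "\<bar>g\<bar> \<le> L * (1 - x) * (fmoment 3 p / 6)"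
    by (simp add: fmoment_def)
  define B where "B = (1 - x) * ((fmoment 2 p)\<^sup>2 / (4 * m) + fmoment 3 p / 6)"
  have B0: "0 \<le> B"
    using x f2 f3 m by (simp add: B_def)
  have dp: "measure_pmf.prob p {1..} \<le> d"
    unfolding d_def by (rule dquot_ge[OF x])
  have "d * (e - ?E (tl_pmf p x) \<psi>) = g - (m - d) * e"
    by (simp add: g1 algebra_simps)
  also have "\<bar>\<dots>\<bar> \<le> \<bar>g\<bar> + (m - d) * \<bar>e\<bar>"
    using md0 abs_triangle_ineq4[of g "(m - d) * e"] by (simp add: abs_mult)
  also have "\<dots> \<le> L * (1 - x) * (fmoment 3 p / 6) + ((1 - x) * fmoment 2 p / 2) * (L * fmoment 2 p / (2 * m))"
    using g2 md1 e2 x f2 by (intro add_mono mult_mono) auto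
  also have "\<dots> = L * B"
    using m by (simp add: B_def field_simps power2_eq_square)
  finally have "d * \<bar>e - ?E (tl_pmf p x) \<psi>\<bar> \<le> L * B"
    using d by (simp add: abs_mult)
  then have "\<bar>e - ?E (tl_pmf p x) \<psi>\<bar> \<le> L * B / d"
    using d by (simp add: field_simps)
  also have "\<dots> \<le> L * B / measure_pmf.prob p {1..}"
    using dp surv_pos L0 B0 by (intro divide_left_mono mult_nonneg_nonneg mult_pos_pos) auto
  finally have "\<bar>e - ?E (tl_pmf p x) \<psi>\<bar> \<le> L * (B / measure_pmf.prob p {1..})"
    by simp
  moreover have "?E r \<psi> = ?E r h - h 0" for r
    unfolding \<psi>_def using h by (simp add: integrable_pmf_bounded[where K = K])
  ultimately show "\<bar>?E (tl_pmf p 1) h - ?E (tl_pmf p x) h\<bar>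
      \<le> L * ((1 - x) * ((fmoment 2 p)\<^sup>2 / (4 * ?E p real) + fmoment 3 p / 6) / measure_pmf.prob p {1..})"
    by (simp add: e_def B_def m_def)
qed

end

subsection \<open>Stein's method for the exponential law\<close>

lemma prob_space_std_exponential: "prob_space std_exponential"
  unfolding std_exponential_def by (rule prob_space_exponential_density) simp

lemma sets_std_exponential [measurable_cong]: "sets std_exponential = sets borel"
  by (simp add: std_exponential_def)

lemma integral_std_exponential:
  fixes f :: "real \<Rightarrow> real"
  assumes [measurable]: "f \<in> borel_measurable borel"
  shows "(\<integral>x. f x \<partial>std_exponential) = (\<integral>x. exponential_density 1 x * f x \<partial>lborel)"
  unfolding std_exponential_def by (subst integral_density) (auto simp: exponential_density_nonneg)

lemma integrable_std_exponential_id: "integrable std_exponential (\<lambda>x. x)"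
proof -
  interpret E: prob_space std_exponential by (rule prob_space_std_exponential)
  have "distributed std_exponential lborel (\<lambda>x. x) (exponential_density 1)"
    unfolding distributed_def
  proof (intro conjI)
    show "distr std_exponential lborel (\<lambda>x. x) = density lborel (\<lambda>x. ennreal (exponential_density 1 x))"
      unfolding std_exponential_def by (rule distr_id2) simp
  qed (auto simp: std_exponential_def)
  from E.erlang_ith_moment_integrable[OF _ this, of 1] show ?thesis by simp
qed

lemma lipschitz_measurable:
  fixes f :: "real \<Rightarrow> real"
  assumes "L-lipschitz_on UNIV f"
  shows "f \<in> borel_measurable borel"
  by (rule borel_measurable_continuous_onI[OF lipschitz_on_continuous_on[OF assms]])

lemma integrable_std_exponential_bounded:
  fixes f :: "real \<Rightarrow> real"
  assumes "f \<in> borel_measurable borel" "\<And>x. \<bar>f x\<bar> \<le> K"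
  shows "integrable std_exponential f"
proof -
  interpret E: prob_space std_exponential by (rule prob_space_std_exponential)
  show ?thesis
    by (rule E.integrable_const_bound[where B = K]) (use assms in \<open>auto simp: measurable_cong_sets[OF sets_std_exponential]\<close>)
qed

text \<open>
  The Stein equation \<open>g' - g = f - c\<close> of the exponential law is solved by
  \<open>g x = c - E f (x + e)\<close>.
\<close>

lemma stein_equation:
  fixes f :: "real \<Rightarrow> real"
  assumes lip: "1-lipschitz_on UNIV f" and K: "\<And>x. \<bar>f x\<bar> \<le> K"
  defines "c \<equiv> (\<integral>x. f x \<partial>std_exponential)"
  defines "g \<equiv> \<lambda>x. c - (\<integral>u. f (x + u) \<partial>std_exponential)"
  defines "h \<equiv> \<lambda>x. g x + f x - c"
  shows "g 0 = 0" and "\<bar>g x\<bar> \<le> 2 * K" and "\<bar>h x\<bar> \<le> 4 * K"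
    and "\<bar>h x - h y\<bar> \<le> 2 * \<bar>x - y\<bar>"
    and "0 \<le> x \<Longrightarrow> x \<le> y \<Longrightarrow> \<exists>\<xi>\<in>{x..y}. g y - g x = h \<xi> * (y - x)"
proof -
  interpret E: prob_space std_exponential by (rule prob_space_std_exponential)
  have [measurable]: "f \<in> borel_measurable borel"
    using lip by (rule lipschitz_measurable)
  have i: "integrable std_exponential (\<lambda>u. f (x + u))" for x
    using K by (intro integrable_std_exponential_bounded) auto
  have bd: "\<bar>\<integral>u. k u \<partial>std_exponential\<bar> \<le> B" if "integrable std_exponential k" "\<And>u. \<bar>k u\<bar> \<le> B"
    for k :: "real \<Rightarrow> real" and B
  proof -
    have "\<bar>\<integral>u. k u \<partial>std_exponential\<bar> \<le> (\<integral>u. \<bar>k u\<bar> \<partial>std_exponential)"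
      by (rule integral_abs_bound)
    also have "\<dots> \<le> (\<integral>u. B \<partial>std_exponential)"
      using that by (intro integral_mono) auto
    finally show ?thesis by (simp add: E.prob_space)
  qed
  have c: "\<bar>c\<bar> \<le> K"
    unfolding c_def using i[of 0] K by (intro bd) auto
  show "g 0 = 0" by (simp add: g_def c_def)
  have gb: "\<bar>g x\<bar> \<le> 2 * K" for x
    using bd[OF i[of x] K] c unfolding g_def by linarith
  then show "\<bar>g x\<bar> \<le> 2 * K" .
  show "\<bar>h x\<bar> \<le> 4 * K"
    using gb[of x] K[of x] c unfolding h_def by linarith
  have fl: "\<bar>f x - f y\<bar> \<le> \<bar>x - y\<bar>" for x y
    using lipschitz_onD[OF lip, of x y] by (simp add: dist_real_def)
  have gl: "\<bar>g x - g y\<bar> \<le> \<bar>x - y\<bar>"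
  proof -
    have "g x - g y = (\<integral>u. f (y + u) - f (x + u) \<partial>std_exponential)"
      unfolding g_def using i by simp
    also have "\<bar>\<dots>\<bar> \<le> \<bar>x - y\<bar>"
    proof (rule bd)
      show "\<bar>f (y + u) - f (x + u)\<bar> \<le> \<bar>x - y\<bar>" for u
        using fl[of "y + u" "x + u"] by (simp add: abs_minus_commute)
    qed (use i in auto)
    finally show ?thesis .
  qed
  then show "\<bar>h x - h y\<bar> \<le> 2 * \<bar>x - y\<bar>"
    using fl[of x y] abs_triangle_ineq[of "g x - g y" "f x - f y"]
    by (simp add: h_def algebra_simps)
  define w where "w t = exp (- t) * f t" for t
  have wc: "continuous_on S w" for S
    unfolding w_def using lipschitz_on_continuous_on[OF lip]
    by (auto intro!: continuous_intros intro: continuous_on_subset)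
  have [measurable]: "w \<in> borel_measurable borel"
    unfolding w_def by measurable
  \<comment> \<open>After the substitution t = x + u the point \<open>x\<close> appears only in the
    factor exp x and in a limit of integration, so that the fundamental theorem of calculus shows
    that \<open>g\<close> is differentiable, with derivative \<open>h\<close>.\<close>
  have tail: "(\<integral>u. f (x + u) \<partial>std_exponential) = exp x * (c - integral {0..x} w)" if "0 \<le> x" for x
  proof -
    have si: "set_integrable lborel {0..x} w"
      by (rule borel_integrable_atLeastAtMost'[OF wc])
    have wi: "set_integrable lborel {0..} w"
    proof -
      have "integrable lborel (\<lambda>u. exponential_density 1 u *\<^sub>R f u)"
        using i[of 0] unfolding std_exponential_def
        by (subst (asm) integrable_density) (auto simp: exponential_density_nonneg)
      moreover have "exponential_density 1 u *\<^sub>R f u = indicator {0..} u *\<^sub>R w u" for u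
        by (auto simp: exponential_density_def w_def indicator_def)
      ultimately show ?thesis by (simp add: set_integrable_def)
    qed
    have cw: "c = (LINT u:{0..}|lborel. w u)"
      unfolding c_def integral_std_exponential[OF \<open>f \<in> _\<close>] set_lebesgue_integral_def
      by (intro Bochner_Integration.integral_cong) (auto simp: exponential_density_def w_def indicator_def)
    have "(\<integral>u. f (x + u) \<partial>std_exponential) = (\<integral>u. exponential_density 1 u * f (x + u) \<partial>lborel)"
      by (rule integral_std_exponential) measurable
    also have "\<dots> = (\<integral>t. exponential_density 1 (- x + t) * f (x + (- x + t)) \<partial>lborel)"
      using lborel_integral_real_affine[of 1 "\<lambda>u. exponential_density 1 u * f (x + u)" "- x"] by simp
    also have "\<dots> = (\<integral>t. exp x * (indicator {x..} t *\<^sub>R w t) \<partial>lborel)"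
      by (intro Bochner_Integration.integral_cong)
        (auto simp: exponential_density_def w_def indicator_def mult_exp_exp mult.assoc[symmetric])
    also have "\<dots> = exp x * (LINT t:{x..}|lborel. w t)"
      by (simp add: set_lebesgue_integral_def)
    also have "(LINT t:{x..}|lborel. w t) = (LINT t:{x<..}|lborel. w t)"
      unfolding set_lebesgue_integral_def
    proof (rule integral_cong_AE)
      show "AE t in lborel. indicator {x..} t *\<^sub>R w t = indicator {x<..} t *\<^sub>R w t"
        using AE_lborel_singleton[of x] by eventually_elim (auto simp: indicator_def)
    qed auto
    also have "\<dots> = c - (LINT t:{0..x}|lborel. w t)"
    proof -
      have "{0..} = {0..x} \<union> {x<..}" using that by auto
      then have "c = (LINT t:{0..x}|lborel. w t) + (LINT t:{x<..}|lborel. w t)"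
        unfolding cw using si wi that
        by (simp, intro set_integral_Un) (auto intro: set_integrable_subset[OF wi])
      then show ?thesis by simp
    qed
    also have "(LINT t:{0..x}|lborel. w t) = integral {0..x} w"
      using si by (rule set_borel_integral_eq_integral(2))
    finally show ?thesis .
  qed
  show "\<exists>\<xi>\<in>{x..y}. g y - g x = h \<xi> * (y - x)" if xy: "0 \<le> x" "x \<le> y"
  proof -
    have "\<exists>\<xi>\<in>{x..y}. g y - g x = (\<lambda>d. h \<xi> * d) (y - x)"
    proof (rule mvt_very_simple[OF xy(2)])
      fix t assume t: "x \<le> t" "t \<le> y"
      have "((\<lambda>x. integral {0..x} w) has_real_derivative w t) (at t within {0..y})"
        using t xy wc by (intro integral_has_real_derivative) auto
      then have d: "((\<lambda>x. integral {0..x} w) has_real_derivative w t) (at t within {x..y})"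
        by (rule DERIV_subset) (use xy in auto)
      have "((\<lambda>x. c - exp x * (c - integral {0..x} w)) has_real_derivative
          - (exp t * (c - integral {0..t} w) + (0 - w t) * exp t)) (at t within {x..y})"
        by (auto intro!: derivative_eq_intros d)
      moreover have "- (exp t * (c - integral {0..t} w) + (0 - w t) * exp t) = h t"
      proof -
        have "w t * exp t = f t" by (simp add: w_def exp_minus)
        then show ?thesis using tail[of t] t xy by (simp add: h_def g_def algebra_simps)
      qed
      ultimately have "(g has_real_derivative h t) (at t within {x..y})"
        using t xy tail by (auto simp: g_def elim!: has_field_derivative_transform_within[where d = 1])
      then show "(g has_derivative (\<lambda>d. h t * d)) (at t within {x..y})"
        by (simp add: has_field_derivative_def mult_commute_abs)
    qed
    then show ?thesis by simp
  qed
qed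

text \<open>By the Stein equation the quantity to bound is the mean of g' - g under the conditional
  law. Since g 0 = 0, the mean of g is a mean over \<open>p\<close> of sums of increments, hence
  nearly the mean of \<open>h\<close>, the derivative, under the equilibrium law; this costs 2 / b.
  Passing from the equilibrium to the conditional law costs 2 / b times \<open>D\<close>, as
  \<open>h\<close> is 2-Lipschitz.\<close>

lemma (in offspring) exponential_approximation:
  fixes f :: "real \<Rightarrow> real"
  assumes D: "lip_close (tl_pmf p 1) (tl_pmf p 0) D"
    and lip: "1-lipschitz_on UNIV f" and K: "\<And>x. \<bar>f x\<bar> \<le> K"
  defines "b \<equiv> measure_pmf.expectation p real / measure_pmf.prob p {1..}"
  shows "\<bar>measure_pmf.expectation (tl_pmf p 0) (\<lambda>i. f (real (Suc i) / b)) - (\<integral>x. f x \<partial>std_exponential)\<bar>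
    \<le> 2 / b * (1 + D)"
proof -
  let ?E = "measure_pmf.expectation"
  define c where "c = (\<integral>x. f x \<partial>std_exponential)"
  define g where "g x = c - (\<integral>u. f (x + u) \<partial>std_exponential)" for x
  define h where "h x = g x + f x - c" for x
  note gh = stein_equation[OF lip K, folded c_def, folded g_def, folded h_def]
  define S where "S = measure_pmf.prob p {1..}"
  define m where "m = ?E p real"
  have m: "0 < m" using mean_pos by (simp add: m_def)
  have S: "0 < S" using surv_pos by (simp add: S_def)
  have b: "0 < b" and bmS: "b = m / S" using m S by (auto simp: b_def m_def S_def)
  define G where "G = ?E (tl_pmf p 0) (\<lambda>i. g (real (Suc i) / b))"
  define H where "H x = ?E (tl_pmf p x) (\<lambda>i. h (real (Suc i) / b))" for x
  have K0: "0 \<le> K" using K[of 0] by linarith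
  have step: "\<bar>g (real z / b) - 1 / b * (\<Sum>i<z. h (real (Suc i) / b))\<bar> \<le> 2 / b\<^sup>2 * real z" for z
  proof (induction z)
    case (Suc z)
    have "real z / b \<le> real (Suc z) / b" using b by (simp add: divide_right_mono)
    then obtain \<xi> where \<xi>: "\<xi> \<in> {real z / b..real (Suc z) / b}"
      "g (real (Suc z) / b) - g (real z / b) = h \<xi> * (real (Suc z) / b - real z / b)"
      using gh(5)[of "real z / b" "real (Suc z) / b"] b by auto
    have dz: "real (Suc z) / b - real z / b = 1 / b" by (simp add: diff_divide_distrib[symmetric])
    have "\<bar>h \<xi> - h (real (Suc z) / b)\<bar> \<le> 2 * \<bar>\<xi> - real (Suc z) / b\<bar>" by (rule gh(4))
    also have "\<dots> \<le> 2 * (1 / b)" using \<xi>(1) dz by (intro mult_left_mono) auto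
    finally have "\<bar>(h \<xi> - h (real (Suc z) / b)) / b\<bar> \<le> 2 / b\<^sup>2"
      using b by (simp add: abs_mult divide_right_mono power2_eq_square field_simps)
    moreover have "g (real (Suc z) / b) - 1 / b * (\<Sum>i<Suc z. h (real (Suc i) / b))
      = (g (real z / b) - 1 / b * (\<Sum>i<z. h (real (Suc i) / b))) + (h \<xi> - h (real (Suc z) / b)) / b"
      using \<xi>(2) unfolding dz by (simp add: add_divide_distrib diff_divide_distrib)
    ultimately show ?case
      using Suc abs_triangle_ineq[of "g (real z / b) - 1 / b * (\<Sum>i<z. h (real (Suc i) / b))"
          "(h \<xi> - h (real (Suc z) / b)) / b"]
      by (simp only: of_nat_Suc distrib_left mult_1_right)
  qed (simp add: gh(1))
  have ig: "integrable (measure_pmf p) (\<lambda>z. g (real z / b))"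
    using gh(2) by (rule integrable_pmf_bounded)
  have ih: "integrable (measure_pmf p) (\<lambda>z. \<Sum>i<z. h (real (Suc i) / b))"
  proof (rule integrable_linear)
    fix z
    have "\<bar>\<Sum>i<z. h (real (Suc i) / b)\<bar> \<le> (\<Sum>i<z. 4 * K)"
      using gh(3) by (intro order_trans[OF sum_abs] sum_mono)
    then show "\<bar>\<Sum>i<z. h (real (Suc i) / b)\<bar> \<le> 4 * K * real z" by (simp add: mult.commute)
  qed
  have "S * G = ?E p (\<lambda>z. \<Sum>i<z. 0 ^ (z - 1 - i) * g (real (Suc i) / b))"
    unfolding S_def G_def dquot_0[symmetric] using gh(2) by (intro expectation_tl_pmf[where K = "2 * K"]) auto
  also have "\<dots> = ?E p (\<lambda>z. g (real z / b))"
    by (intro Bochner_Integration.integral_cong refl)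
      (simp only: sum_zero_power, simp add: gh(1))
  finally have G: "S * G = ?E p (\<lambda>z. g (real z / b))" .
  have H: "m * H 1 = ?E p (\<lambda>z. \<Sum>i<z. h (real (Suc i) / b))"
    unfolding m_def H_def dquot_1[symmetric] using gh(3) by (subst expectation_tl_pmf[where K = "4 * K"]) auto
  have "S * G - 1 / b * (m * H 1) = ?E p (\<lambda>z. g (real z / b) - 1 / b * (\<Sum>i<z. h (real (Suc i) / b)))"
    unfolding G H using ig ih by simp
  also have "\<bar>\<dots>\<bar> \<le> ?E p (\<lambda>z. \<bar>g (real z / b) - 1 / b * (\<Sum>i<z. h (real (Suc i) / b))\<bar>)"
    by (rule integral_abs_bound)
  also have "\<dots> \<le> ?E p (\<lambda>z. 2 / b\<^sup>2 * real z)"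
    using ig ih integrable step by (intro integral_mono) auto
  also have "\<dots> = S * (2 / b)"
    using m S by (simp add: m_def[symmetric] bmS field_simps power2_eq_square)
  \<comment> \<open>The scaling by the conditional mean b = m / S is exactly the one that gives
    \<open>G\<close> and \<open>H 1\<close> the same factor.\<close>
  also have "1 / b * (m * H 1) = S * H 1"
    using m S by (simp add: bmS)
  finally have "S * \<bar>G - H 1\<bar> \<le> S * (2 / b)"
    using S by (simp add: abs_mult flip: right_diff_distrib)
  then have 1: "\<bar>G - H 1\<bar> \<le> 2 / b"
    using S by (simp only: mult_le_cancel_left_pos)
  have 2: "\<bar>H 1 - H 0\<bar> \<le> 2 / b * D"
    unfolding H_def using D gh(3)
  proof (rule lip_closeD)
    fix i
    have "\<bar>h (real (Suc (Suc i)) / b) - h (real (Suc i) / b)\<bar> \<le> 2 * \<bar>real (Suc (Suc i)) / b - real (Suc i) / b\<bar>"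
      by (rule gh(4))
    also have "\<dots> = 2 / b"
      using b by (simp add: diff_divide_distrib[symmetric])
    finally show "\<bar>h (real (Suc (Suc i)) / b) - h (real (Suc i) / b)\<bar> \<le> 2 / b" .
  qed
  have "H 0 = G + ?E (tl_pmf p 0) (\<lambda>i. f (real (Suc i) / b)) - c"
    unfolding H_def G_def h_def using gh(2) K
    by (simp add: integrable_pmf_bounded[where K = K] integrable_pmf_bounded[where K = "2 * K"])
  then show ?thesis
    using 1 2 by (simp add: c_def distrib_left)
qed

section \<open>From bounded to arbitrary Lipschitz test functions\<close>

lemma lipschitz_truncation:
  fixes f :: "real \<Rightarrow> real"
  assumes "1-lipschitz_on UNIV f"
  shows "1-lipschitz_on UNIV (\<lambda>x. max (- r) (min r (f x)))"
proof (rule lipschitz_onI)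
  fix x y
  show "dist (max (- r) (min r (f x))) (max (- r) (min r (f y))) \<le> 1 * dist x y"
    using lipschitz_onD[OF assms, of x y] by (simp add: dist_real_def)
qed simp

lemma integral_truncation_tendsto:
  fixes f :: "real \<Rightarrow> real"
  assumes "prob_space N" and [measurable_cong]: "sets N = sets borel" and id: "integrable N (\<lambda>x. x)"
    and lip: "1-lipschitz_on UNIV f"
  shows "(\<lambda>n. \<integral>x. max (- real n) (min (real n) (f x)) \<partial>N) \<longlonglongrightarrow> (\<integral>x. f x \<partial>N)"
proof (rule integral_dominated_convergence[where w = "\<lambda>x. \<bar>f 0\<bar> + \<bar>x\<bar>"])
  interpret N: prob_space N by fact
  have [measurable]: "f \<in> borel_measurable borel"
    using lip by (rule lipschitz_measurable)
  show "f \<in> borel_measurable N" by measurable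
  show "(\<lambda>x. max (- real n) (min (real n) (f x))) \<in> borel_measurable N" for n by measurable
  show "integrable N (\<lambda>x. \<bar>f 0\<bar> + \<bar>x\<bar>)" using id by simp
  show "AE x in N. norm (max (- real n) (min (real n) (f x))) \<le> \<bar>f 0\<bar> + \<bar>x\<bar>" for n
  proof (rule AE_I2)
    fix x
    have "\<bar>f x - f 0\<bar> \<le> \<bar>x\<bar>"
      using lipschitz_onD[OF lip, of x 0] by (simp add: dist_real_def)
    then show "norm (max (- real n) (min (real n) (f x))) \<le> \<bar>f 0\<bar> + \<bar>x\<bar>" by simp
  qed
  show "AE x in N. (\<lambda>n. max (- real n) (min (real n) (f x))) \<longlonglongrightarrow> f x"
  proof (rule AE_I2)
    fix x
    have "eventually (\<lambda>n. max (- real n) (min (real n) (f x)) = f x) sequentially"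
      using eventually_ge_at_top[of "nat \<lceil>\<bar>f x\<bar>\<rceil>"] by eventually_elim linarith
    then show "(\<lambda>n. max (- real n) (min (real n) (f x))) \<longlonglongrightarrow> f x"
      by (rule tendsto_eventually)
  qed
qed

text \<open>Truncation at height n does not increase the Lipschitz constant, and dominated
  convergence removes it again because both laws have first moments.\<close>

lemma wasserstein_le:
  assumes N: "prob_space N" "sets N = sets borel" "integrable N (\<lambda>x. x)"
    and N': "prob_space N'" "sets N' = sets borel" "integrable N' (\<lambda>x. x)"
    and B: "\<And>f K. 1-lipschitz_on UNIV f \<Longrightarrow> (\<And>x. \<bar>f x\<bar> \<le> K) \<Longrightarrow> \<bar>(\<integral>x. f x \<partial>N) - (\<integral>x. f x \<partial>N')\<bar> \<le> B"
  shows "wasserstein N N' \<le> ereal B"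
  unfolding wasserstein_def
proof (rule SUP_least, clarify)
  fix f :: "real \<Rightarrow> real" assume lip: "1-lipschitz_on UNIV f"
  have "\<bar>(\<integral>x. f x \<partial>N) - (\<integral>x. f x \<partial>N')\<bar> \<le> B"
  proof (rule tendsto_upperbound)
    show "(\<lambda>n. \<bar>(\<integral>x. max (- real n) (min (real n) (f x)) \<partial>N) - (\<integral>x. max (- real n) (min (real n) (f x)) \<partial>N')\<bar>)
        \<longlonglongrightarrow> \<bar>(\<integral>x. f x \<partial>N) - (\<integral>x. f x \<partial>N')\<bar>"
      by (intro tendsto_intros integral_truncation_tendsto N N' lip)
    show "\<forall>\<^sub>F n in sequentially. \<bar>(\<integral>x. max (- real n) (min (real n) (f x)) \<partial>N) - (\<integral>x. max (- real n) (min (real n) (f x)) \<partial>N')\<bar> \<le> B"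
    proof (intro always_eventually allI)
      fix n
      show "\<bar>(\<integral>x. max (- real n) (min (real n) (f x)) \<partial>N) - (\<integral>x. max (- real n) (min (real n) (f x)) \<partial>N')\<bar> \<le> B"
        by (rule B[where K = "real n"], rule lipschitz_truncation[OF lip]) auto
    qed
  qed simp
  then show "ereal \<bar>(\<integral>x. f x \<partial>N) - (\<integral>x. f x \<partial>N')\<bar> \<le> ereal B" by simp
qed

subsection \<open>The law of the process\<close>

lemma nsum_add: "nsum (x + y) r = bind_pmf (nsum x r) (\<lambda>s. map_pmf ((+) s) (nsum y r))"
proof (induction x)
  case 0
  have "(+) (0::nat) = id" by auto
  then show ?case by (simp add: bind_return_pmf)
next
  case (Suc x)
  then show ?case
    by (simp add: bind_assoc_pmf map_bind_pmf bind_map_pmf map_pmf_comp add.assoc[symmetric])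
qed

text \<open>The branching property: grouping the grandchildren by their grandparents among the
  \<open>m\<close> individuals gives \<open>m\<close> independent families. For generating functions
  this is associativity of composition.\<close>

lemma nsum_bind: "bind_pmf (nsum m p) (\<lambda>z. nsum z r) = nsum m (bind_pmf p (\<lambda>z. nsum z r))"
proof (induction m)
  case (Suc m)
  have "bind_pmf (nsum (Suc m) p) (\<lambda>z. nsum z r)
      = bind_pmf p (\<lambda>x. bind_pmf (nsum m p) (\<lambda>s. bind_pmf (nsum x r) (\<lambda>u. map_pmf ((+) u) (nsum s r))))"
    by (simp add: bind_assoc_pmf bind_map_pmf nsum_add)
  also have "\<dots> = bind_pmf p (\<lambda>x. bind_pmf (nsum x r) (\<lambda>u. bind_pmf (nsum m p) (\<lambda>s. map_pmf ((+) u) (nsum s r))))"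
    by (intro bind_pmf_cong refl bind_commute_pmf)
  also have "\<dots> = nsum (Suc m) (bind_pmf p (\<lambda>z. nsum z r))"
    by (simp add: bind_assoc_pmf map_bind_pmf flip: Suc)
  finally show ?case .
qed (simp add: bind_return_pmf)

text \<open>The population in generation \<open>k + j\<close> that descends from one individual of
  generation \<open>k\<close>. The recursion splits off the first generation, since the comparison
  of laws peels off the oldest offspring law and needs the survival probability of what
  follows.\<close>

primrec generation_law :: "(nat \<Rightarrow> nat pmf) \<Rightarrow> nat \<Rightarrow> nat \<Rightarrow> nat pmf" where
  "generation_law q k 0 = return_pmf 1"
| "generation_law q k (Suc j) = bind_pmf (q (Suc k)) (\<lambda>m. nsum m (generation_law q (Suc k) j))"

text \<open>The same law with the last generation split off, which is how \<open>gw_process\<close>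
  recurses.\<close>

lemma generation_law_forward:
  "generation_law q k (Suc j) = bind_pmf (generation_law q k j) (\<lambda>z. nsum z (q (Suc (k + j))))"
proof (induction j arbitrary: k)
  case 0
  have "nsum m (return_pmf 1) = return_pmf m" for m
    by (induction m) (simp_all add: bind_return_pmf)
  then show ?case
    by (simp add: bind_return_pmf bind_return_pmf' map_pmf_def[symmetric] add.commute bind_assoc_pmf map_pmf_comp)
next
  case (Suc j)
  have "generation_law q k (Suc (Suc j)) = bind_pmf (q (Suc k)) (\<lambda>m. nsum m (generation_law q (Suc k) (Suc j)))"
    by (rule generation_law.simps)
  also have "\<dots> = bind_pmf (q (Suc k)) (\<lambda>m. bind_pmf (nsum m (generation_law q (Suc k) j)) (\<lambda>z. nsum z (q (Suc (k + Suc j)))))"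
    unfolding Suc nsum_bind by simp
  also have "\<dots> = bind_pmf (generation_law q k (Suc j)) (\<lambda>z. nsum z (q (Suc (k + Suc j))))"
    by (simp add: bind_assoc_pmf)
  finally show ?case .
qed

text \<open>On the event that \<open>X\<close> equals \<open>z\<close> the chosen variable is
  \<open>Y z\<close>, so independence of \<open>X\<close> from each single \<open>Y z\<close> is
  enough; the \<open>Y z\<close> may depend on each other in any way.\<close>

lemma (in prob_space) distr_countable_choice:
  fixes X :: "'a \<Rightarrow> nat" and Y :: "nat \<Rightarrow> 'a \<Rightarrow> nat"
  assumes X: "distr M (count_space UNIV) X = measure_pmf P"
    and Y: "\<And>z. distr M (count_space UNIV) (Y z) = measure_pmf (R z)"
    and ind: "\<And>z. indep_var (count_space UNIV) X (count_space UNIV) (Y z)"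
  shows "distr M (count_space UNIV) (\<lambda>\<omega>. Y (X \<omega>) \<omega>) = measure_pmf (bind_pmf P R)"
proof (rule measure_eqI_countable[where A = UNIV])
  have [measurable]: "X \<in> measurable M (count_space UNIV)" "Y z \<in> measurable M (count_space UNIV)" for z
    using indep_var_rv1[OF ind] indep_var_rv2[OF ind] by auto
  have [measurable]: "(\<lambda>\<omega>. Y (X \<omega>) \<omega>) \<in> measurable M (count_space UNIV)"
    by (rule measurable_compose_countable[where g = X]) auto
  fix j :: nat
  have "emeasure (distr M (count_space UNIV) (\<lambda>\<omega>. Y (X \<omega>) \<omega>)) {j}
      = emeasure M (\<Union>z. {\<omega> \<in> space M. X \<omega> = z \<and> Y z \<omega> = j})"
    by (subst emeasure_distr) (auto intro!: arg_cong2[where f = emeasure])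
  also have "\<dots> = (\<Sum>z. emeasure M {\<omega> \<in> space M. X \<omega> = z \<and> Y z \<omega> = j})"
    by (rule suminf_emeasure[symmetric]) (auto simp: disjoint_family_on_def)
  also have "\<dots> = (\<Sum>z. ennreal (pmf P z) * ennreal (pmf (R z) j))"
  proof (rule suminf_cong)
    fix z
    have x: "prob (X -` {z} \<inter> space M) = pmf P z"
      using arg_cong[OF X, of "\<lambda>N. measure N {z}"] by (simp add: measure_distr measure_pmf_single)
    have y: "prob (Y z -` {j} \<inter> space M) = pmf (R z) j"
      using arg_cong[OF Y[of z], of "\<lambda>N. measure N {j}"] by (simp add: measure_distr measure_pmf_single)
    have "prob ((\<lambda>\<omega>. (X \<omega>, Y z \<omega>)) -` ({z} \<times> {j}) \<inter> space M) = pmf P z * pmf (R z) j"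
      using indep_varD[OF ind, of "{z}" "{j}" z] by (simp add: x y)
    moreover have "(\<lambda>\<omega>. (X \<omega>, Y z \<omega>)) -` ({z} \<times> {j}) \<inter> space M = {\<omega> \<in> space M. X \<omega> = z \<and> Y z \<omega> = j}"
      by auto
    ultimately show "emeasure M {\<omega> \<in> space M. X \<omega> = z \<and> Y z \<omega> = j} = ennreal (pmf P z) * ennreal (pmf (R z) j)"
      by (simp add: emeasure_eq_measure ennreal_mult)
  qed
  also have "\<dots> = (\<integral>\<^sup>+z. ennreal (pmf (R z) j) \<partial>P)"
    by (simp add: nn_integral_measure_pmf nn_integral_count_space_nat)
  also have "\<dots> = emeasure (bind_pmf P R) {j}"
    by (simp add: emeasure_pmf_single ennreal_pmf_bind)
  finally show "emeasure (distr M (count_space UNIV) (\<lambda>\<omega>. Y (X \<omega>) \<omega>)) {j} = emeasure (bind_pmf P R) {j}" .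
qed auto

lemma measurable_sum_nat:
  fixes f :: "'i \<Rightarrow> 'b \<Rightarrow> nat"
  assumes "\<And>i. i \<in> I \<Longrightarrow> f i \<in> measurable N (count_space UNIV)"
  shows "(\<lambda>x. \<Sum>i\<in>I. f i x) \<in> measurable N (count_space UNIV)"
  using assms
proof (induction I rule: infinite_finite_induct)
  case (insert i I)
  have "(\<lambda>x. f i x + (\<Sum>i\<in>I. f i x)) \<in> measurable N (count_space UNIV)"
  proof (rule measurable_compose_countable[where f = "\<lambda>k x. k + (\<Sum>i\<in>I. f i x)" and g = "f i"])
    have "(\<lambda>x. \<Sum>i\<in>I. f i x) \<in> measurable N (count_space UNIV)"
      using insert by auto
    then show "(\<lambda>x. k + (\<Sum>i\<in>I. f i x)) \<in> measurable N (count_space UNIV)" for k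
      by (rule measurable_compose) simp
  qed (use insert in auto)
  then show ?case using insert by simp
qed auto

text \<open>The process as a function on the product space of all family sizes. It turns
  independence of generations into independence of functions of disjoint blocks of
  coordinates.\<close>

abbreviation "coord_process \<equiv> gw_process (\<lambda>k i x. x (k, i))"

lemma measurable_coord_process:
  assumes "{1..n} \<times> {1..} \<subseteq> A"
  shows "coord_process n \<in> measurable (PiM A (\<lambda>_. count_space UNIV)) (count_space UNIV)"
  using assms
proof (induction n)
  case 0
  have "coord_process 0 = (\<lambda>_. 1)" by auto
  then show ?case by simp
next
  case (Suc n)
  have "(\<lambda>x. \<Sum>i = 1..coord_process n x. x (Suc n, i))
      \<in> measurable (PiM A (\<lambda>_. count_space UNIV)) (count_space UNIV)"
  proof (rule measurable_compose_countable[where f = "\<lambda>z (x :: nat \<times> nat \<Rightarrow> nat). \<Sum>i = 1..z. x (Suc n, i)" and g = "coord_process n"])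
    show "(\<lambda>x :: nat \<times> nat \<Rightarrow> nat. \<Sum>i = 1..z. x (Suc n, i)) \<in> measurable (PiM A (\<lambda>_. count_space UNIV)) (count_space UNIV)" for z
      using Suc.prems by (intro measurable_sum_nat) (auto intro!: measurable_component_singleton)
    show "coord_process n \<in> measurable (PiM A (\<lambda>_. count_space UNIV)) (count_space UNIV)"
      using Suc.prems by (intro Suc.IH) (auto simp: subset_iff)
  qed
  then show ?case by simp
qed

lemma gw_process_restrict:
  assumes "{1..n} \<times> {1..} \<subseteq> A"
  shows "gw_process \<xi> n \<omega> = coord_process n (restrict (\<lambda>i. (case i of (k, i) \<Rightarrow> \<xi> k i) \<omega>) A)"
proof -
  define x where "x = restrict (\<lambda>i. (case i of (k, i) \<Rightarrow> \<xi> k i) \<omega>) A"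
  have x: "x (k, i) = \<xi> k i \<omega>" if "(k, i) \<in> A" for k i
    using that by (simp add: x_def)
  have "gw_process \<xi> n \<omega> = coord_process n x"
    using assms by (induction n) (auto intro!: sum.cong x[symmetric] simp: subset_iff)
  then show ?thesis by (simp only: x_def)
qed

context gwve
begin

lemma gw_process_eq:
  "gw_process \<xi> n = (\<lambda>\<omega>. coord_process n (restrict (\<lambda>i. (case i of (k, i) \<Rightarrow> \<xi> k i) \<omega>) ({1..n} \<times> {1..})))"
  by (intro ext gw_process_restrict) simp

lemma indep_blocks:
  assumes "A \<inter> B = {}" "A \<subseteq> {1..} \<times> {1..}" "B \<subseteq> {1..} \<times> {1..}"
    and "F \<in> measurable (PiM A (\<lambda>_. count_space UNIV)) (count_space UNIV)"
    and "G \<in> measurable (PiM B (\<lambda>_. count_space UNIV)) (count_space UNIV)"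
  shows "indep_var (count_space UNIV) (\<lambda>\<omega>. F (restrict (\<lambda>i. (case i of (k, i) \<Rightarrow> \<xi> k i) \<omega>) A))
    (count_space UNIV) (\<lambda>\<omega>. G (restrict (\<lambda>i. (case i of (k, i) \<Rightarrow> \<xi> k i) \<omega>) B))"
  using indep_var_compose[OF indep_var_restrict[OF indep assms(1-3)] assms(4,5)] by (simp add: comp_def)

lemma measurable_xi:
  assumes "n \<ge> 1" "i \<ge> 1"
  shows "\<xi> n i \<in> measurable M (count_space UNIV)"
proof -
  have "(n, i) \<in> {1..} \<times> {1..}" using assms by auto
  then have "(case (n, i) of (n, i) \<Rightarrow> \<xi> n i) \<in> measurable M (count_space UNIV)"
    using indep unfolding indep_vars_def by blast
  then show ?thesis by simp
qed

lemma law_generation_sum: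
  "distr M (count_space UNIV) (\<lambda>\<omega>. \<Sum>i = 1..z. \<xi> (Suc n) i \<omega>) = measure_pmf (nsum z (q (Suc n)))"
proof (induction z)
  case 0
  show ?case
  proof (rule measure_eqI_countable[where A = UNIV])
    fix j :: nat
    have "(\<lambda>\<omega>. \<Sum>i = 1..0. \<xi> (Suc n) i \<omega>) -` {j} \<inter> space M = (if j = 0 then space M else {})"
      by auto
    then show "emeasure (distr M (count_space UNIV) (\<lambda>\<omega>. \<Sum>i = 1..0. \<xi> (Suc n) i \<omega>)) {j} = emeasure (nsum 0 (q (Suc n))) {j}"
      by (subst emeasure_distr) (auto simp: emeasure_pmf_single emeasure_space_1)
  qed auto
next
  case (Suc z)
  let ?r = "q (Suc n)"
  have "distr M (count_space UNIV) (\<lambda>\<omega>. (\<lambda>s \<omega>. s + \<xi> (Suc n) (Suc z) \<omega>) (\<Sum>i = 1..z. \<xi> (Suc n) i \<omega>) \<omega>)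
      = measure_pmf (bind_pmf (nsum z ?r) (\<lambda>s. map_pmf ((+) s) ?r))"
  proof (rule distr_countable_choice[OF Suc])
    fix s
    have "distr M (count_space UNIV) (\<lambda>\<omega>. s + \<xi> (Suc n) (Suc z) \<omega>)
        = distr (distr M (count_space UNIV) (\<xi> (Suc n) (Suc z))) (count_space UNIV) ((+) s)"
      by (subst distr_distr) (auto simp: comp_def measurable_xi)
    then show "distr M (count_space UNIV) (\<lambda>\<omega>. s + \<xi> (Suc n) (Suc z) \<omega>) = measure_pmf (map_pmf ((+) s) ?r)"
      by (simp add: law map_pmf_rep_eq)
    let ?F = "\<lambda>x :: nat \<times> nat \<Rightarrow> nat. \<Sum>i = 1..z. x (Suc n, i)" and ?G = "\<lambda>x :: nat \<times> nat \<Rightarrow> nat. s + x (Suc n, Suc z)"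
    have "indep_var (count_space UNIV) (\<lambda>\<omega>. ?F (restrict (\<lambda>i. (case i of (k, i) \<Rightarrow> \<xi> k i) \<omega>) ({Suc n} \<times> {1..z})))
      (count_space UNIV) (\<lambda>\<omega>. ?G (restrict (\<lambda>i. (case i of (k, i) \<Rightarrow> \<xi> k i) \<omega>) {(Suc n, Suc z)}))"
    proof (rule indep_blocks)
      show "?F \<in> measurable (PiM ({Suc n} \<times> {1..z}) (\<lambda>_. count_space UNIV)) (count_space UNIV)"
        by (intro measurable_sum_nat) (auto intro!: measurable_component_singleton)
      show "?G \<in> measurable (PiM {(Suc n, Suc z)} (\<lambda>_. count_space UNIV)) (count_space UNIV)"
        by (rule measurable_compose[OF measurable_component_singleton]) auto
    qed auto
    then show "indep_var (count_space UNIV) (\<lambda>\<omega>. \<Sum>i = 1..z. \<xi> (Suc n) i \<omega>)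
      (count_space UNIV) (\<lambda>\<omega>. s + \<xi> (Suc n) (Suc z) \<omega>)"
      by simp
  qed
  \<comment> \<open>\<open>nsum\<close> puts the new summand first and the process puts it last;
    convolution commutes.\<close>
  also have "bind_pmf (nsum z ?r) (\<lambda>s. map_pmf ((+) s) ?r) = nsum (Suc z) ?r"
    by (simp add: map_pmf_def bind_commute_pmf[of ?r] add.commute)
  finally show ?case by simp
qed

lemma law_gw_process: "distr M (count_space UNIV) (gw_process \<xi> n) = measure_pmf (generation_law q 0 n)"
proof (induction n)
  case 0
  show ?case
  proof (rule measure_eqI_countable[where A = UNIV])
    fix j :: nat
    have "gw_process \<xi> 0 -` {j} \<inter> space M = (if j = 1 then space M else {})"
      by auto
    moreover have "gw_process \<xi> 0 = (\<lambda>_. 1)" by auto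
    then have "gw_process \<xi> 0 \<in> measurable M (count_space UNIV)" by simp
    ultimately show "emeasure (distr M (count_space UNIV) (gw_process \<xi> 0)) {j} = emeasure (generation_law q 0 0) {j}"
      by (subst emeasure_distr) (auto simp: emeasure_pmf_single emeasure_space_1)
  qed auto
next
  case (Suc n)
  have "distr M (count_space UNIV) (\<lambda>\<omega>. (\<lambda>z \<omega>. \<Sum>i = 1..z. \<xi> (Suc n) i \<omega>) (gw_process \<xi> n \<omega>) \<omega>)
      = measure_pmf (bind_pmf (generation_law q 0 n) (\<lambda>z. nsum z (q (Suc n))))"
  proof (rule distr_countable_choice[OF Suc law_generation_sum])
    fix z
    let ?G = "\<lambda>x :: nat \<times> nat \<Rightarrow> nat. \<Sum>i = 1..z. x (Suc n, i)"
    have "indep_var (count_space UNIV) (\<lambda>\<omega>. coord_process n (restrict (\<lambda>i. (case i of (k, i) \<Rightarrow> \<xi> k i) \<omega>) ({1..n} \<times> {1..})))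
      (count_space UNIV) (\<lambda>\<omega>. ?G (restrict (\<lambda>i. (case i of (k, i) \<Rightarrow> \<xi> k i) \<omega>) ({Suc n} \<times> {1..})))"
    proof (rule indep_blocks)
      show "?G \<in> measurable (PiM ({Suc n} \<times> {1..}) (\<lambda>_. count_space UNIV)) (count_space UNIV)"
        by (intro measurable_sum_nat) (auto intro!: measurable_component_singleton)
      show "coord_process n \<in> measurable (PiM ({1..n} \<times> {1..}) (\<lambda>_. count_space UNIV)) (count_space UNIV)"
        by (rule measurable_coord_process) auto
    qed auto
    then show "indep_var (count_space UNIV) (gw_process \<xi> n) (count_space UNIV) (\<lambda>\<omega>. \<Sum>i = 1..z. \<xi> (Suc n) i \<omega>)"
      by (subst gw_process_eq) simp
  qed
  also have "bind_pmf (generation_law q 0 n) (\<lambda>z. nsum z (q (Suc n))) = generation_law q 0 (Suc n)"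
    unfolding generation_law_forward by simp
  finally show ?case by (simp del: generation_law.simps)
qed

lemma measurable_gw_process: "gw_process \<xi> n \<in> measurable M (count_space UNIV)"
proof -
  have "(\<lambda>\<omega>. coord_process n (restrict (\<lambda>i. (case i of (k, i) \<Rightarrow> \<xi> k i) \<omega>) ({1..n} \<times> {1..}))) \<in> measurable M (count_space UNIV)"
    by (rule measurable_compose[OF measurable_restrict measurable_coord_process])
      (auto intro: measurable_xi)
  then show ?thesis by (subst gw_process_eq)
qed

end

section \<open>Conditioning on survival\<close>

context offspring
begin

lemma pmf_tl_pmf_0: "measure_pmf.prob p {1..} * pmf (tl_pmf p 0) i = pmf p (Suc i)"
proof -
  have "measure_pmf.prob p {1..} * measure_pmf.expectation (tl_pmf p 0) (indicator {i})
      = measure_pmf.expectation p (\<lambda>z. \<Sum>l<z. 0 ^ (z - 1 - l) * indicator {i} l)"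
    unfolding dquot_0[symmetric] by (rule expectation_tl_pmf[where K = 1]) (auto simp: indicator_def)
  also have "\<dots> = measure_pmf.expectation p (indicator {Suc i})"
    by (intro Bochner_Integration.integral_cong refl) (simp only: sum_zero_power, auto simp: indicator_def)
  finally show ?thesis by (simp add: measure_pmf_single)
qed

lemma
  shows integrable_tl_pmf_0: "integrable (measure_pmf (tl_pmf p 0)) (\<lambda>i. real (Suc i))"
    and expectation_tl_pmf_0: "measure_pmf.expectation (tl_pmf p 0) (\<lambda>i. real (Suc i))
      = measure_pmf.expectation p real / measure_pmf.prob p {1..}"
proof -
  let ?S = "measure_pmf.prob p {1..}"
  have "(\<Sum>i<z. ennreal (0 ^ (z - 1 - i)) * ennreal (real (Suc i))) = ennreal (real z)" for z
  proof -
    have "(\<Sum>i<z. ennreal (0 ^ (z - 1 - i)) * ennreal (real (Suc i))) = ennreal (\<Sum>i<z. 0 ^ (z - 1 - i) * real (Suc i))"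
      by (subst sum_ennreal[symmetric]) (auto simp: ennreal_mult)
    then show ?thesis by (simp only: sum_zero_power) simp
  qed
  then have "tl_functional p 0 (\<lambda>i. ennreal (real (Suc i))) = ennreal (measure_pmf.expectation p real)"
    by (simp only: tl_functional_def nn_integral_real)
  then have *: "ennreal ?S * (\<integral>\<^sup>+i. ennreal (real (Suc i)) \<partial>tl_pmf p 0) = ennreal (measure_pmf.expectation p real)"
    by (subst (asm) nn_integral_tl_pmf) (auto simp: dquot_0)
  have "ennreal ?S * (\<integral>\<^sup>+i. ennreal (real (Suc i)) \<partial>tl_pmf p 0) \<noteq> top"
    unfolding * by simp
  then have "(\<integral>\<^sup>+i. ennreal (real (Suc i)) \<partial>tl_pmf p 0) < \<infinity>"
    using surv_pos by (auto simp: ennreal_mult_eq_top_iff top.not_eq_extremum)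
  then show i: "integrable (measure_pmf (tl_pmf p 0)) (\<lambda>i. real (Suc i))"
    by (intro integrableI_nonneg) auto
  have "ennreal (?S * measure_pmf.expectation (tl_pmf p 0) (\<lambda>i. real (Suc i))) = ennreal (measure_pmf.expectation p real)"
    using * nn_integral_eq_integral[OF i] by (simp add: ennreal_mult)
  then have "?S * measure_pmf.expectation (tl_pmf p 0) (\<lambda>i. real (Suc i)) = measure_pmf.expectation p real"
    using mean_pos by (subst (asm) ennreal_inj) (auto intro!: mult_nonneg_nonneg integral_nonneg_AE)
  then show "measure_pmf.expectation (tl_pmf p 0) (\<lambda>i. real (Suc i)) = measure_pmf.expectation p real / ?S"
    using surv_pos by (simp add: field_simps)
qed

end

context gwve
begin

lemma law_survival:
  assumes "offspring (generation_law q 0 n)"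
  shows "distr (survival_measure M \<xi> n) (count_space UNIV) (gw_process \<xi> n)
    = measure_pmf (map_pmf Suc (tl_pmf (generation_law q 0 n) 0))"
proof (rule measure_eqI_countable[where A = UNIV])
  define p where "p = generation_law q 0 n"
  interpret p: offspring p using assms by (simp add: p_def)
  note Z = measurable_gw_process[of n]
  let ?Z = "gw_process \<xi> n"
  define U where "U = {\<omega> \<in> space M. ?Z \<omega> > 0}"
  have em: "emeasure M (?Z -` B \<inter> space M) = emeasure p B" for B
    using arg_cong[OF law_gw_process[of n], of "\<lambda>N. emeasure N B"] Z by (simp add: emeasure_distr p_def)
  have U: "U = ?Z -` {1..} \<inter> space M" by (auto simp: U_def)
  have Us: "U \<in> sets M" unfolding U using Z by measurable
  fix j :: nat
  have "emeasure (distr (survival_measure M \<xi> n) (count_space UNIV) ?Z) {j}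
      = emeasure (uniform_measure M U) (?Z -` {j} \<inter> space M)"
    using Z by (subst emeasure_distr) (auto simp: survival_measure_def U_def)
  also have "\<dots> = emeasure M (U \<inter> (?Z -` {j} \<inter> space M)) / emeasure M U"
    by (intro emeasure_uniform_measure Us measurable_sets[OF Z]) auto
  also have "U \<inter> (?Z -` {j} \<inter> space M) = ?Z -` ({1..} \<inter> {j}) \<inter> space M"
    by (auto simp: U)
  also have "emeasure M \<dots> / emeasure M U = emeasure p ({1..} \<inter> {j}) / emeasure p {1..}"
    unfolding U em ..
  also have "\<dots> = emeasure (map_pmf Suc (tl_pmf p 0)) {j}"
  proof (cases j)
    case 0
    then show ?thesis by (simp add: emeasure_pmf_single pmf_map_outside)
  next
    case (Suc i)
    have "pmf p (Suc i) / measure_pmf.prob p {1..} = pmf (tl_pmf p 0) i"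
      using p.pmf_tl_pmf_0[of i] p.surv_pos by (simp add: field_simps)
    then show ?thesis
      using p.surv_pos Suc
      by (simp add: emeasure_pmf_single pmf_map_inj' measure_pmf.emeasure_eq_measure divide_ennreal measure_pmf_single)
  qed
  finally show "emeasure (distr (survival_measure M \<xi> n) (count_space UNIV) ?Z) {j}
      = emeasure (map_pmf Suc (tl_pmf (generation_law q 0 n) 0)) {j}"
    by (simp add: p_def)
qed auto

lemma wasserstein_scaled_cond_law:
  assumes p: "offspring (generation_law q 0 n)"
    and D: "lip_close (tl_pmf (generation_law q 0 n) 1) (tl_pmf (generation_law q 0 n) 0) D"
  shows "wasserstein (scaled_cond_law M \<xi> n) std_exponential
    \<le> ereal (2 / (measure_pmf.expectation (generation_law q 0 n) real
        / measure_pmf.prob (generation_law q 0 n) {1..}) * (1 + D))"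
proof -
  define p where "p = generation_law q 0 n"
  interpret p: offspring p using assms by (simp add: p_def)
  define b where "b = measure_pmf.expectation p real / measure_pmf.prob p {1..}"
  define W where "W = map_pmf Suc (tl_pmf p 0)"
  have Z: "gw_process \<xi> n \<in> measurable (survival_measure M \<xi> n) (count_space UNIV)"
    using measurable_gw_process[of n] by (simp add: survival_measure_def)
  have W: "distr (survival_measure M \<xi> n) (count_space UNIV) (gw_process \<xi> n) = measure_pmf W"
    unfolding W_def p_def using p by (rule law_survival)
  have "cond_mean M \<xi> n = measure_pmf.expectation W real"
    unfolding cond_mean_def W[symmetric] using Z by (subst integral_distr) auto
  then have b: "cond_mean M \<xi> n = b"
    by (simp add: W_def b_def p.expectation_tl_pmf_0[simplified])
  have law: "scaled_cond_law M \<xi> n = distr (measure_pmf W) borel (\<lambda>z. 1 / b * real z)"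
    unfolding scaled_cond_law_def b W[symmetric] using Z by (subst distr_distr) (auto simp: comp_def)
  show ?thesis
    unfolding p_def[symmetric] b_def[symmetric] law
  proof (rule wasserstein_le)
    show "prob_space (distr (measure_pmf W) borel (\<lambda>z. 1 / b * real z))"
      by (rule measure_pmf.prob_space_distr) simp
    show "integrable (distr (measure_pmf W) borel (\<lambda>z. 1 / b * real z)) (\<lambda>x. x)"
      using p.integrable_tl_pmf_0 by (subst integrable_distr_eq) (auto simp: W_def)
    fix f :: "real \<Rightarrow> real" and K assume f: "1-lipschitz_on UNIV f" "\<And>x. \<bar>f x\<bar> \<le> K"
    have "(\<integral>x. f x \<partial>distr (measure_pmf W) borel (\<lambda>z. 1 / b * real z))
        = measure_pmf.expectation (tl_pmf p 0) (\<lambda>i. f (real (Suc i) / b))"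
      using lipschitz_measurable[OF f(1)] by (subst integral_distr) (auto simp: W_def)
    then show "\<bar>(\<integral>x. f x \<partial>distr (measure_pmf W) borel (\<lambda>z. 1 / b * real z)) - (\<integral>x. f x \<partial>std_exponential)\<bar> \<le> 2 / b * (1 + D)"
      using p.exponential_approximation[OF _ f] D by (simp add: b_def p_def)
  qed (auto simp: prob_space_std_exponential sets_std_exponential integrable_std_exponential_id)
qed

end

subsection \<open>Survival probabilities\<close>

lemma pgf_nsum:
  assumes "0 \<le> x" "x \<le> 1"
  shows "pgf (nsum m p) x = pgf p x ^ m"
proof (induction m)
  case 0
  then show ?case by (simp add: pgf_def)
next
  case (Suc m)
  have "pgf (nsum (Suc m) p) x = measure_pmf.expectation p (\<lambda>z. x ^ z * pgf (nsum m p) x)"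
    unfolding pgf_def using assms
    by (simp add: expectation_bind_pmf[where K = 1] power_le_one power_add)
  also have "\<dots> = pgf p x * pgf (nsum m p) x"
    by (simp add: pgf_def[of p])
  finally show ?case by (simp only: Suc power_Suc)
qed

lemma pgf_bind_nsum:
  assumes "0 \<le> x" "x \<le> 1"
  shows "pgf (bind_pmf r (\<lambda>m. nsum m p)) x = pgf r (pgf p x)"
proof -
  have "pgf (bind_pmf r (\<lambda>m. nsum m p)) x = measure_pmf.expectation r (\<lambda>m. pgf (nsum m p) x)"
    unfolding pgf_def using assms by (simp add: expectation_bind_pmf[where K = 1] power_le_one)
  then show ?thesis
    by (simp add: pgf_nsum[OF assms] pgf_def[of r])
qed

lemma pgf_0: "pgf p 0 = 1 - measure_pmf.prob p {1..}"
proof -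
  have "pgf p 0 = measure_pmf.expectation p (indicator {0})"
    unfolding pgf_def by (intro Bochner_Integration.integral_cong) (auto simp: indicator_def)
  also have "\<dots> = measure_pmf.prob p (space (measure_pmf p) - {1..})"
    by (auto intro!: arg_cong2[where f = measure])
  also have "\<dots> = 1 - measure_pmf.prob p {1..}"
    by (rule measure_pmf.prob_compl) simp
  finally show ?thesis .
qed

text \<open>Bernoulli's inequality with a gain of t^2 from k = 2 on: there it is an equality, and
  each further factor 1 - t lowers the right-hand side by at most t.\<close>

lemma one_minus_power_second_order:
  fixes t :: real
  assumes t: "0 \<le> t" "t \<le> 1"
  shows "1 - real k * t + t\<^sup>2 * indicator {2..} k \<le> (1 - t) ^ k"
proof -
  have *: "1 - real (k + 2) * t + t\<^sup>2 \<le> (1 - t) ^ (k + 2)" for k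
  proof (induction k)
    case (Suc k)
    have "t * (1 - t) ^ (k + 2) \<le> t"
      using t by (intro mult_left_le power_le_one) auto
    moreover have "(1 - t) ^ (Suc k + 2) = (1 - t) ^ (k + 2) - t * (1 - t) ^ (k + 2)"
      by (simp add: algebra_simps)
    ultimately show ?case using Suc by (simp add: algebra_simps)
  qed (simp add: power2_eq_square algebra_simps)
  consider "k = 0" | "k = 1" | l where "k = l + 2"
    by (metis One_nat_def add_2_eq_Suc' not0_implies_Suc)
  then show ?thesis
    by cases (use *[of "k - 2"] in auto)
qed

context offspring
begin

lemma pgf_ge:
  assumes t: "0 \<le> t" "t \<le> 1"
  shows "1 - measure_pmf.expectation p real * t + measure_pmf.prob p {2..} * t\<^sup>2 \<le> pgf p (1 - t)"
proof -
  have i: "integrable (measure_pmf p) (indicator {2..} :: nat \<Rightarrow> real)"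
    by (rule integrable_pmf_bounded[where K = 1]) (auto simp: indicator_def)
  have "1 - measure_pmf.expectation p real * t + measure_pmf.prob p {2..} * t\<^sup>2
      = measure_pmf.expectation p (\<lambda>k. 1 - real k * t + t\<^sup>2 * indicator {2..} k)"
    using integrable i by simp
  also have "\<dots> \<le> pgf p (1 - t)"
    unfolding pgf_def
  proof (rule integral_mono)
    show "integrable (measure_pmf p) (\<lambda>k. 1 - real k * t + t\<^sup>2 * indicator {2..} k)"
      using integrable i by simp
    show "integrable (measure_pmf p) (\<lambda>k. (1 - t) ^ k)"
      using t by (intro integrable_pmf_bounded[where K = 1]) (auto simp: power_le_one)
  qed (rule one_minus_power_second_order[OF t])
  finally show ?thesis .
qed

end

text \<open>The survival probabilities satisfy S' <= m S - \<delta> S^2. Taking reciprocals makes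
  this recursion linear, since (1 / (m S) + \<delta> / m^2) (m S - \<delta> S^2) = 1 - (\<delta> S /
  m)^2 is at most 1.\<close>

lemma survival_step:
  assumes r: "offspring r" and p: "offspring p"
    and \<delta>: "0 \<le> \<delta>" "\<delta> \<le> measure_pmf.prob r {2..}"
  shows "1 / (measure_pmf.expectation r real * measure_pmf.prob p {1..}) + \<delta> / (measure_pmf.expectation r real)\<^sup>2
    \<le> 1 / measure_pmf.prob (bind_pmf r (\<lambda>m. nsum m p)) {1..}"
proof -
  interpret r: offspring r by fact
  interpret p: offspring p by fact
  interpret Z: offspring "bind_pmf r (\<lambda>m. nsum m p)" using r p by (rule offspring_bind_nsum)
  define m where "m = measure_pmf.expectation r real"
  define S where "S = measure_pmf.prob p {1..}"
  define S' where "S' = measure_pmf.prob (bind_pmf r (\<lambda>m. nsum m p)) {1..}"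
  have m: "0 < m" using r.mean_pos by (simp add: m_def)
  have S: "0 < S" "S \<le> 1" using p.surv_pos by (auto simp: S_def)
  have S': "0 < S'" using Z.surv_pos by (simp add: S'_def)
  have "S' = 1 - pgf r (1 - S)"
    using pgf_0[of "bind_pmf r (\<lambda>m. nsum m p)"] pgf_bind_nsum[of 0 r p] pgf_0[of p]
    by (simp add: S'_def S_def)
  moreover have "1 - m * S + measure_pmf.prob r {2..} * S\<^sup>2 \<le> pgf r (1 - S)"
    using r.pgf_ge[of S] S by (simp add: m_def)
  moreover have "\<delta> * S\<^sup>2 \<le> measure_pmf.prob r {2..} * S\<^sup>2"
    using \<delta> by (intro mult_right_mono) auto
  ultimately have "S' \<le> m * S - \<delta> * S\<^sup>2" by linarith
  then have "(1 / (m * S) + \<delta> / m\<^sup>2) * S' \<le> (1 / (m * S) + \<delta> / m\<^sup>2) * (m * S - \<delta> * S\<^sup>2)"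
    using m S \<delta> by (intro mult_left_mono) auto
  also have "\<dots> = 1 - (\<delta> * S / m)\<^sup>2"
    using m S by (simp add: field_simps power2_eq_square)
  also have "\<dots> \<le> 1" by simp
  finally show ?thesis
    using S' by (simp add: m_def S_def S'_def field_simps)
qed

section \<open>Uniform estimates in an environment with bounded moments\<close>

lemma fmoment_1: "fmoment 1 p = measure_pmf.expectation p real"
proof -
  have "falling_fact 1 = real" by (auto simp: falling_fact_def)
  then show ?thesis by (simp add: fmoment_def)
qed

lemma mu_Suc: "mu q (Suc n) = mu q n * fmoment 1 (q (Suc n))"
  by (simp add: mu_def)

locale bounded_env =
  fixes q :: "nat \<Rightarrow> nat pmf" and a A B :: real
  assumes offspring3: "n \<ge> 1 \<Longrightarrow> offspring3 (q n)"
    and a_pos: "0 < a"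
    and moment1: "n \<ge> 1 \<Longrightarrow> a \<le> fmoment 1 (q n) \<and> fmoment 1 (q n) \<le> A"
    and moment2: "n \<ge> 1 \<Longrightarrow> a \<le> fmoment 2 (q n) \<and> fmoment 2 (q n) \<le> A"
    and moment3: "n \<ge> 1 \<Longrightarrow> fmoment 3 (q n) \<le> B"
begin

lemma a_le_A: "a \<le> A"
  using moment1[of 1] by auto

lemma A_pos: "0 < A"
  using a_pos a_le_A by linarith

lemma offspring: "n \<ge> 1 \<Longrightarrow> offspring (q n)"
  using offspring3 by (simp add: offspring3_def)

lemma mu_pos: "0 < mu q n"
proof (induction n)
  case (Suc n)
  then show ?case using moment1[of "Suc n"] a_pos by (auto simp: mu_Suc)
qed (simp add: mu_def)

lemma
  shows offspring_generation_law: "offspring (generation_law q k j)"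
    and mean_generation_law: "measure_pmf.expectation (generation_law q k j) real = mu q (k + j) / mu q k"
proof -
  have "offspring (generation_law q k j) \<and>
    measure_pmf.expectation (generation_law q k j) real = mu q (k + j) / mu q k"
  proof (induction j arbitrary: k)
    case 0
    have "offspring (return_pmf 1)"
      by unfold_locales (auto intro: integrable_measure_pmf_finite)
    then show ?case using mu_pos[of k] by simp
  next
    case (Suc j)
    let ?G = "generation_law q (Suc k) j"
    have r: "offspring (q (Suc k))" by (rule offspring) simp
    have G: "offspring ?G" "measure_pmf.expectation ?G real = mu q (Suc k + j) / mu q (Suc k)"
      using Suc[of "Suc k"] by auto
    have "0 < fmoment 1 (q (Suc k))" using moment1[of "Suc k"] a_pos by auto
    then have "fmoment 1 (q (Suc k)) * (mu q (Suc k + j) / mu q (Suc k)) = mu q (k + Suc j) / mu q k"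
      using mu_pos[of k] by (simp only: mu_Suc[of q k]) simp
    then show ?case
      using offspring_bind_nsum[OF r G(1)] expectation_bind_nsum[OF r G(1)]
      by (simp only: generation_law.simps fmoment_1 G(2))
  qed
  then show "offspring (generation_law q k j)"
    and "measure_pmf.expectation (generation_law q k j) real = mu q (k + j) / mu q k" by auto
qed

text \<open>The part of the second factorial moment above a level N is at most the third one divided
  by N - 1, the part below is at most N^2 times the probability in question. For large N the first
  part is at most half of \<open>a\<close>.\<close>

lemma ex_prob_ge_2: "\<exists>\<delta>>0. \<forall>n\<ge>1. \<delta> \<le> measure_pmf.prob (q n) {2..}"
proof -
  \<comment> \<open>Large enough for the third moment to contribute at most a / 2; the summand 2
    keeps N - 1 positive.\<close>
  define N where "N = nat \<lceil>2 * \<bar>B\<bar> / a\<rceil> + 2"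
  have N: "2 * \<bar>B\<bar> / a \<le> real N - 1" "1 < real N"
    unfolding N_def by linarith+
  have "a / (2 * (real N)\<^sup>2) \<le> measure_pmf.prob (q n) {2..}" if n: "n \<ge> 1" for n
  proof -
    interpret offspring3 "q n" using n by (rule offspring3)
    have i: "integrable (measure_pmf (q n)) (indicator {2..} :: nat \<Rightarrow> real)"
      by (rule integrable_pmf_bounded[where K = 1]) (auto simp: indicator_def)
    have pw: "falling_fact 2 z \<le> (real N)\<^sup>2 * indicator {2..} z + falling_fact 3 z / (real N - 1)" for z
    proof (cases "z \<le> N")
      case True
      have "falling_fact 2 z \<le> (real N)\<^sup>2 * indicator {2..} z"
      proof (cases "z \<ge> 2")
        case True
        then show ?thesis
          unfolding falling_fact_2 power2_eq_square using \<open>z \<le> N\<close> by (auto intro!: mult_mono)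
      next
        case False
        then have "z = 0 \<or> z = 1" by linarith
        then show ?thesis by (auto simp: falling_fact_2)
      qed
      moreover have "0 \<le> falling_fact 3 z / (real N - 1)"
        using falling_fact_nonneg[of 3 z] N by simp
      ultimately show ?thesis by linarith
    next
      case False
      then have "falling_fact 2 z * (real N - 1) \<le> falling_fact 2 z * (real z - 2)"
        using falling_fact_nonneg[of 2 z] by (intro mult_left_mono) auto
      also have "\<dots> = falling_fact 3 z"
        by (simp add: falling_fact_2 falling_fact_3)
      finally have "falling_fact 2 z \<le> falling_fact 3 z / (real N - 1)"
        using N by (simp add: field_simps)
      moreover have "0 \<le> (real N)\<^sup>2 * indicator {2..} z" by simp
      ultimately show ?thesis by linarith
    qed
    have "a \<le> fmoment 2 (q n)" using moment2[OF n] by simp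
    also have "\<dots> \<le> measure_pmf.expectation (q n) (\<lambda>z. (real N)\<^sup>2 * indicator {2..} z + falling_fact 3 z / (real N - 1))"
      unfolding fmoment_def using integrable2 integrable3 i pw by (intro integral_mono) auto
    also have "\<dots> = (real N)\<^sup>2 * measure_pmf.prob (q n) {2..} + fmoment 3 (q n) / (real N - 1)"
      using integrable3 i by (simp add: fmoment_def)
    also have "fmoment 3 (q n) / (real N - 1) \<le> \<bar>B\<bar> / (real N - 1)"
      using moment3[OF n] N by (intro divide_right_mono) auto
    also have "\<bar>B\<bar> / (real N - 1) \<le> a / 2"
      using N a_pos by (simp add: field_simps)
    finally show ?thesis
      using N by (simp add: field_simps)
  qed
  moreover have "0 < a / (2 * (real N)\<^sup>2)" using a_pos N by simp
  ultimately show ?thesis by blast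
qed

text \<open>Comparable to \<open>rho\<close>, since \<open>nu\<close> is bounded from above and from below.\<close>

definition rsum :: "nat \<Rightarrow> real" where
  "rsum n = (\<Sum>k<n. 1 / mu q k)"

lemma rsum_Suc: "rsum (Suc n) = rsum n + 1 / mu q n"
  by (simp add: rsum_def)

lemma rsum_mono: "i \<le> j \<Longrightarrow> rsum i \<le> rsum j"
  by (rule lift_Suc_mono_le[of rsum]) (auto simp: rsum_Suc mu_pos less_imp_le)

lemma rsum_diff: "k \<le> n \<Longrightarrow> 1 / mu q k \<le> rsum (Suc n) - rsum k"
  using rsum_mono[of "Suc k" "Suc n"] by (simp add: rsum_Suc)

text \<open>Iterating \<open>survival_step\<close> back from generation n adds a constant in each
  generation and divides by the mean, which solves to \<kappa> mu_k times the sum of 1 / mu_i over i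
  from k to n.\<close>

lemma survival_bound:
  "\<exists>\<kappa>>0. \<forall>n. \<forall>k\<le>n. \<kappa> * (mu q k * (rsum (Suc n) - rsum k)) \<le> 1 / measure_pmf.prob (generation_law q k (n - k)) {1..}"
proof -
  from ex_prob_ge_2 obtain \<delta> where \<delta>: "\<delta> > 0" "\<And>n. n \<ge> 1 \<Longrightarrow> \<delta> \<le> measure_pmf.prob (q n) {2..}"
    by blast
  \<comment> \<open>The 1 is for the last generation, where survival is certain; the other bound is
    for the recursion step.\<close>
  define \<kappa> where "\<kappa> = min 1 (\<delta> / A\<^sup>2)"
  have \<kappa>: "0 < \<kappa>" using \<delta> A_pos by (simp add: \<kappa>_def)
  have *: "\<kappa> * (mu q k * (rsum (Suc (k + j)) - rsum k)) \<le> 1 / measure_pmf.prob (generation_law q k j) {1..}" for k j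
  proof (induction j arbitrary: k)
    case 0
    then show ?case using mu_pos[of k] by (simp add: rsum_Suc \<kappa>_def)
  next
    case (Suc j)
    define m where "m = fmoment 1 (q (Suc k))"
    have m: "0 < m" "m \<le> A" using moment1[of "Suc k"] a_pos by (auto simp: m_def)
    have "\<kappa> * (mu q k * (rsum (Suc (k + Suc j)) - rsum k))
        = \<kappa> * (mu q (Suc k) * (rsum (Suc (Suc k + j)) - rsum (Suc k))) / m + \<kappa>"
    proof -
      have "mu q (Suc k) = mu q k * m" by (simp only: mu_Suc m_def)
      then show ?thesis using mu_pos[of k] m by (simp add: rsum_Suc[of k] field_simps)
    qed
    also have "\<dots> \<le> (1 / measure_pmf.prob (generation_law q (Suc k) j) {1..}) / m + \<delta> / m\<^sup>2"
    proof (intro add_mono divide_right_mono Suc)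
      have "\<kappa> \<le> \<delta> / A\<^sup>2" by (simp add: \<kappa>_def)
      also have "\<dots> \<le> \<delta> / m\<^sup>2" using m \<delta> by (intro divide_left_mono) (auto intro: power_mono)
      finally show "\<kappa> \<le> \<delta> / m\<^sup>2" .
    qed (use m in auto)
    also have "\<dots> \<le> 1 / measure_pmf.prob (generation_law q k (Suc j)) {1..}"
      using survival_step[OF offspring offspring_generation_law, of "Suc k" \<delta> "Suc k" j] \<delta>
      unfolding m_def fmoment_1 by (simp add: mult.commute)
    finally show ?case .
  qed
  have "\<kappa> * (mu q k * (rsum (Suc n) - rsum k)) \<le> 1 / measure_pmf.prob (generation_law q k (n - k)) {1..}"
    if "k \<le> n" for k n
    using *[of k "n - k"] that by simp
  then show ?thesis using \<kappa> by blast
qed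

text \<open>\<open>lip_close_tl_pmf\<close> made uniform in the generation. The factor 1 - x stays
  explicit because it will be a survival probability.\<close>

lemma lip_close_offspring:
  "\<exists>C\<ge>0. \<forall>n\<ge>1. \<forall>x. 0 \<le> x \<longrightarrow> x \<le> 1 \<longrightarrow> lip_close (tl_pmf (q n) 1) (tl_pmf (q n) x) ((1 - x) * C)"
proof -
  from ex_prob_ge_2 obtain \<delta> where \<delta>: "\<delta> > 0" "\<And>n. n \<ge> 1 \<Longrightarrow> \<delta> \<le> measure_pmf.prob (q n) {2..}"
    by blast
  define C where "C = (A\<^sup>2 / (4 * a) + \<bar>B\<bar> / 6) / \<delta>"
  have "C \<ge> 0" using a_pos \<delta> by (simp add: C_def)
  moreover have "lip_close (tl_pmf (q n) 1) (tl_pmf (q n) x) ((1 - x) * C)"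
    if n: "n \<ge> 1" and x: "0 \<le> x" "x \<le> 1" for n x
  proof -
    interpret offspring3 "q n" using n by (rule offspring3)
    show ?thesis
    proof (rule lip_close_mono[OF lip_close_tl_pmf[OF x]])
      have "\<delta> \<le> measure_pmf.prob (q n) {2..}" by (rule \<delta>(2)[OF n])
      also have "\<dots> \<le> measure_pmf.prob (q n) {1..}"
        by (intro measure_pmf.finite_measure_mono) auto
      finally have d: "\<delta> \<le> measure_pmf.prob (q n) {1..}" .
      have "((fmoment 2 (q n))\<^sup>2 / (4 * measure_pmf.expectation (q n) real) + fmoment 3 (q n) / 6)
          / measure_pmf.prob (q n) {1..} \<le> C"
        unfolding C_def
      proof (rule frac_le)
        show "0 \<le> A\<^sup>2 / (4 * a) + \<bar>B\<bar> / 6" using a_pos by simp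
        show "(fmoment 2 (q n))\<^sup>2 / (4 * measure_pmf.expectation (q n) real) + fmoment 3 (q n) / 6
            \<le> A\<^sup>2 / (4 * a) + \<bar>B\<bar> / 6"
          using moment1[OF n] moment2[OF n] moment3[OF n] a_pos
          by (intro add_mono frac_le power_mono) (auto simp flip: fmoment_1)
      qed (use d \<delta> in auto)
      then show "(1 - x) * ((fmoment 2 (q n))\<^sup>2 / (4 * measure_pmf.expectation (q n) real) + fmoment 3 (q n) / 6)
          / measure_pmf.prob (q n) {1..} \<le> (1 - x) * C"
        using x mult_left_mono[of _ C "1 - x"] by (simp only: times_divide_eq_right[symmetric])
    qed
  qed
  ultimately show ?thesis by blast
qed

text \<open>Repeated use of \<open>lip_close_bind_nsum\<close> with \<open>q (Suc k)\<close> as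
  \<open>r\<close> and the later population as \<open>p\<close>. The mean of \<open>p\<close> is
  mu_n / mu_(k+1) and 1 - \<open>pgf p 0\<close> is its survival probability; together they form the
  summand l = k + 1.\<close>

lemma lip_close_generation_law:
  assumes C: "\<And>n x. n \<ge> 1 \<Longrightarrow> 0 \<le> x \<Longrightarrow> x \<le> 1 \<Longrightarrow> lip_close (tl_pmf (q n) 1) (tl_pmf (q n) x) ((1 - x) * C)"
  assumes "k + j = n"
  shows "lip_close (tl_pmf (generation_law q k j) 1) (tl_pmf (generation_law q k j) 0)
    (C * (\<Sum>l\<in>{k<..n}. mu q n / mu q l * measure_pmf.prob (generation_law q l (n - l)) {1..}))"
  using assms(2)
proof (induction j arbitrary: k)
  case 0
  interpret offspring "return_pmf 1"
    using offspring_generation_law[of k 0] by simp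
  \<comment> \<open>A single individual has only the position 0, whatever the point \<open>x\<close>
    is.\<close>
  have e: "measure_pmf.expectation (tl_pmf (return_pmf 1) x) h = h 0"
    if "0 \<le> x" "x \<le> 1" "\<And>i. \<bar>h i\<bar> \<le> K" 
    for x and h :: "nat \<Rightarrow> real" and K
    using expectation_tl_pmf[OF that] by (simp add: dquot_def)
  show ?case
    unfolding lip_close_def
  proof (intro allI impI)
    fix h :: "nat \<Rightarrow> real" and K L :: real
    assume "\<forall>i. \<bar>h i\<bar> \<le> K"
    then show "\<bar>measure_pmf.expectation (tl_pmf (generation_law q k 0) 1) h
        - measure_pmf.expectation (tl_pmf (generation_law q k 0) 0) h\<bar>
      \<le> L * (C * (\<Sum>l\<in>{k<..n}. mu q n / mu q l * measure_pmf.prob (generation_law q l (n - l)) {1..}))"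
      using e[of 1 h K] e[of 0 h K] 0 by simp
  qed
next
  case (Suc j)
  let ?G = "generation_law q (Suc k) j"
  let ?S = "\<lambda>l. measure_pmf.prob (generation_law q l (n - l)) {1..}"
  have n: "n - Suc k = j" using Suc.prems by simp
  have "lip_close (tl_pmf (q (Suc k)) 1) (tl_pmf (q (Suc k)) (pgf ?G 0)) ((1 - pgf ?G 0) * C)"
    using pgf_bounds[of 0] by (intro C) auto
  then have "lip_close (tl_pmf (generation_law q k (Suc j)) 1) (tl_pmf (generation_law q k (Suc j)) 0)
    (C * (\<Sum>l\<in>{Suc k<..n}. mu q n / mu q l * ?S l) + measure_pmf.expectation ?G real * ((1 - pgf ?G 0) * C))"
    unfolding generation_law.simps using Suc
    by (intro lip_close_bind_nsum offspring offspring_generation_law) auto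
  also have "C * (\<Sum>l\<in>{Suc k<..n}. mu q n / mu q l * ?S l) + measure_pmf.expectation ?G real * ((1 - pgf ?G 0) * C)
    = C * (\<Sum>l\<in>{k<..n}. mu q n / mu q l * ?S l)"
  proof -
    have "{k<..n} = insert (Suc k) {Suc k<..n}" using Suc.prems by auto
    then show ?thesis
      using Suc.prems by (simp add: mean_generation_law pgf_0 n algebra_simps)
  qed
  finally show ?case .
qed

text \<open>The conditional mean mu_n / S_0 is at least of order mu_n times
  \<open>rsum (Suc n)\<close>, and \<open>D\<close> is at most of order mu_n times the sum, so mu_n
  cancels in the second term. The bound is finite for every \<open>n\<close> and therefore also
  serves for the small ones at the end.\<close>

lemma wasserstein_bound:
  assumes "gwve M q \<xi>"
  shows "\<exists>C>0. \<forall>n. wasserstein (scaled_cond_law M \<xi> n) std_exponential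
    \<le> ereal (C * (1 / (mu q n * rsum (Suc n))
        + (\<Sum>k\<in>{0<..n}. 1 / mu q k * (1 / mu q k / (rsum (Suc n) - rsum k))) / rsum (Suc n)))"
proof -
  interpret gwve M q \<xi> by fact
  from survival_bound obtain \<kappa> where \<kappa>: "\<kappa> > 0"
    "\<And>n k. k \<le> n \<Longrightarrow> \<kappa> * (mu q k * (rsum (Suc n) - rsum k)) \<le> 1 / measure_pmf.prob (generation_law q k (n - k)) {1..}"
    by blast
  from lip_close_offspring obtain C where C: "C \<ge> 0"
    "\<And>n x. n \<ge> 1 \<Longrightarrow> 0 \<le> x \<Longrightarrow> x \<le> 1 \<Longrightarrow> lip_close (tl_pmf (q n) 1) (tl_pmf (q n) x) ((1 - x) * C)"
    by blast
  define C' where "C' = 2 / \<kappa> + 2 * C / \<kappa>\<^sup>2"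
  have C': "C' > 0" using \<kappa>(1) C(1) by (simp add: C'_def add_pos_nonneg)
  have "wasserstein (scaled_cond_law M \<xi> n) std_exponential
    \<le> ereal (C' * (1 / (mu q n * rsum (Suc n))
        + (\<Sum>k\<in>{0<..n}. 1 / mu q k * (1 / mu q k / (rsum (Suc n) - rsum k))) / rsum (Suc n)))" for n
  proof -
    define S where "S k = measure_pmf.prob (generation_law q k (n - k)) {1..}" for k
    define \<Sigma> where "\<Sigma> = (\<Sum>k\<in>{0<..n}. 1 / mu q k * (1 / mu q k / (rsum (Suc n) - rsum k)))"
    define R where "R = rsum (Suc n)"
    define b where "b = mu q n / S 0"
    have d: "0 < rsum (Suc n) - rsum k" if "k \<le> n" for k
      using rsum_diff[OF that] mu_pos[of k] by (meson divide_pos_pos less_le_trans zero_less_one)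
    have S: "0 < S k" for k
      unfolding S_def using offspring.surv_pos[OF offspring_generation_law] .
    have S_le: "S k \<le> 1 / (\<kappa> * mu q k * (rsum (Suc n) - rsum k))" if "k \<le> n" for k
    proof -
      have "0 < \<kappa> * mu q k * (rsum (Suc n) - rsum k)"
        using \<kappa>(1) mu_pos[of k] d[OF that] by simp
      moreover have "\<kappa> * mu q k * (rsum (Suc n) - rsum k) \<le> 1 / S k"
        using \<kappa>(2)[OF that] by (simp only: S_def mult.assoc)
      ultimately show ?thesis
        using S[of k] by (simp add: pos_le_divide_eq mult.commute[of "S k"])
    qed
    have R: "0 < R" using d[of 0] by (simp add: R_def rsum_def)
    have \<Sigma>: "0 \<le> \<Sigma>"
      unfolding \<Sigma>_def using d mu_pos by (intro sum_nonneg) (auto simp: less_imp_le)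
    have "\<kappa> * R \<le> 1 / S 0"
      using \<kappa>(2)[of 0 n] by (simp add: S_def R_def rsum_def mu_def)
    then have b_ge: "\<kappa> * R * mu q n \<le> b"
      using mult_right_mono[of "\<kappa> * R" "1 / S 0" "mu q n"] mu_pos[of n] by (simp add: b_def)
    have kR: "0 < \<kappa> * R * mu q n" using \<kappa>(1) R mu_pos[of n] by simp
    define D where "D = C * (\<Sum>l\<in>{0<..n}. mu q n / mu q l * S l)"
    have "(\<Sum>l\<in>{0<..n}. mu q n / mu q l * S l) \<le> (\<Sum>l\<in>{0<..n}. mu q n / \<kappa> * (1 / mu q l * (1 / mu q l / (rsum (Suc n) - rsum l))))"
    proof (rule sum_mono)
      fix l assume "l \<in> {0<..n}"
      then have "mu q n / mu q l * S l \<le> mu q n / mu q l * (1 / (\<kappa> * mu q l * (rsum (Suc n) - rsum l)))"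
        using mu_pos by (intro mult_left_mono S_le) (auto simp: less_imp_le)
      then show "mu q n / mu q l * S l \<le> mu q n / \<kappa> * (1 / mu q l * (1 / mu q l / (rsum (Suc n) - rsum l)))"
        by (simp add: ac_simps)
    qed
    then have D: "D \<le> C * (mu q n / \<kappa> * \<Sigma>)"
      unfolding D_def \<Sigma>_def sum_distrib_left[symmetric] using C(1) by (rule mult_left_mono)
    have D0: "0 \<le> D"
      unfolding D_def using C(1) S mu_pos by (intro mult_nonneg_nonneg sum_nonneg) (auto simp: less_imp_le)
    have "2 / b * (1 + D) \<le> 2 / (\<kappa> * R * mu q n) * (1 + C * (mu q n / \<kappa> * \<Sigma>))"
      using b_ge kR D D0 by (intro mult_mono divide_left_mono add_left_mono) auto
    also have "\<dots> = 2 / \<kappa> * (1 / (mu q n * R)) + 2 * C / \<kappa>\<^sup>2 * (\<Sigma> / R)"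
      using \<kappa>(1) R mu_pos[of n] by (simp add: field_simps power2_eq_square)
    also have "\<dots> \<le> C' * (1 / (mu q n * R)) + C' * (\<Sigma> / R)"
      unfolding C'_def using \<kappa>(1) C(1) R \<Sigma> mu_pos[of n]
      by (intro add_mono mult_right_mono) (auto simp: less_imp_le)
    finally have "2 / b * (1 + D) \<le> C' * (1 / (mu q n * R) + \<Sigma> / R)"
      by (simp add: distrib_left)
    moreover have "wasserstein (scaled_cond_law M \<xi> n) std_exponential \<le> ereal (2 / b * (1 + D))"
      using wasserstein_scaled_cond_law[OF offspring_generation_law lip_close_generation_law[OF C(2), of 0 n n]]
      by (simp add: mean_generation_law b_def D_def S_def mu_def)
    ultimately have "wasserstein (scaled_cond_law M \<xi> n) std_exponential
        \<le> ereal (C' * (1 / (mu q n * R) + \<Sigma> / R))"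
      by (auto elim!: order_trans)
    then show ?thesis by (simp only: \<Sigma>_def R_def)
  qed
  then show ?thesis using C' by blast
qed

subsection \<open>Summation of the errors\<close>

lemma inverse_mu_le: "1 / mu q k \<le> A * (1 / mu q (Suc k))"
  and inverse_mu_ge: "a * (1 / mu q (Suc k)) \<le> 1 / mu q k"
  using mu_pos[of k] moment1[of "Suc k"] a_pos by (auto simp: mu_Suc field_simps)

definition gap :: "nat \<Rightarrow> real" where
  "gap j = \<bar>1 / mu q (j - 2) - 1 / mu q j\<bar>"

text \<open>Up to a constant the upper bound for the probability to survive from generation
  \<open>k\<close> to \<open>n\<close>, and at the same time the relative decrease of
  \<open>rsum (Suc n) - rsum k\<close> in one step.\<close>

definition ratio :: "nat \<Rightarrow> nat \<Rightarrow> real" where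
  "ratio n k = 1 / mu q k / (rsum (Suc n) - rsum k)"

lemma rsum_diff_pos: "k \<le> n \<Longrightarrow> 0 < rsum (Suc n) - rsum k"
proof -
  assume "k \<le> n"
  moreover have "0 < 1 / mu q k" using mu_pos by simp
  ultimately show ?thesis using rsum_diff[of k n] by linarith
qed

lemma ratio_nonneg: "k \<le> n \<Longrightarrow> 0 \<le> ratio n k"
  using rsum_diff_pos[of k n] mu_pos[of k] by (simp add: ratio_def)

lemma rsum_pos: "0 < rsum (Suc n)"
  using rsum_diff_pos[of 0 n] by (simp add: rsum_def)

text \<open>Telescoping in steps of two as long as the next index is at most n - 1, which matches
  the range of summation of \<open>s_env\<close>. The remaining distance to \<open>n\<close> is at
  most two generations and costs at most A^2. Gaps of the other parity are added for free.\<close>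

lemma inverse_mu_two_step:
  "k \<le> n \<Longrightarrow> 1 / mu q k \<le> (1 + A)\<^sup>2 * (1 / mu q n) + (\<Sum>j\<in>{k + 2..n - 1}. gap j)"
proof (induction "n - k" arbitrary: k rule: less_induct)
  case less
  have A: "0 < A" by (rule A_pos)
  have s: "0 \<le> (\<Sum>j\<in>{k + 2..n - 1}. gap j)" by (intro sum_nonneg) (simp add: gap_def)
  have m: "0 < 1 / mu q n" using mu_pos by simp
  consider "n = k" | "n = Suc k" | "n = Suc (Suc k)" | "k + 2 \<le> n - 1"
    using less.prems by linarith
  then show ?case
  proof cases
    case 1
    have "1 \<le> (1 + A)\<^sup>2" using A by (intro one_le_power) simp
    then show ?thesis using 1 s m mult_right_mono[of 1 "(1 + A)\<^sup>2" "1 / mu q n"] by simp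
  next
    case 2
    have "A \<le> (1 + A)\<^sup>2" using A by (simp add: power2_eq_square algebra_simps)
    then have "A * (1 / mu q n) \<le> (1 + A)\<^sup>2 * (1 / mu q n)" using m by (intro mult_right_mono) auto
    then show ?thesis using inverse_mu_le[of k] 2 s by simp
  next
    case 3
    have "1 / mu q k \<le> A * (A * (1 / mu q n))"
      using inverse_mu_le[of k] mult_left_mono[OF inverse_mu_le[of "Suc k"], of A] A 3 by simp
    moreover have "A * A \<le> (1 + A)\<^sup>2" using A by (simp add: power2_eq_square algebra_simps)
    then have "A * A * (1 / mu q n) \<le> (1 + A)\<^sup>2 * (1 / mu q n)" using m by (intro mult_right_mono) auto
    ultimately show ?thesis using s by simp
  next
    case 4
    have "1 / mu q (k + 2) \<le> (1 + A)\<^sup>2 * (1 / mu q n) + (\<Sum>j\<in>{k + 2 + 2..n - 1}. gap j)"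
      using 4 by (intro less.hyps) auto
    moreover have "1 / mu q k - 1 / mu q (k + 2) \<le> gap (k + 2)"
      by (simp add: gap_def)
    moreover have "gap (k + 2) + (\<Sum>j\<in>{k + 2 + 2..n - 1}. gap j) \<le> (\<Sum>j\<in>{k + 2..n - 1}. gap j)"
    proof -
      have "gap (k + 2) + (\<Sum>j\<in>{k + 2 + 2..n - 1}. gap j) = (\<Sum>j\<in>insert (k + 2) {k + 2 + 2..n - 1}. gap j)"
        by simp
      also have "\<dots> \<le> (\<Sum>j\<in>{k + 2..n - 1}. gap j)"
        using 4 by (intro sum_mono2) (auto simp: gap_def)
      finally show ?thesis .
    qed
    ultimately show ?thesis by linarith
  qed
qed

text \<open>Each summand is at most the increment of \<open>- ln (rsum (Suc n) - rsum k)\<close>.\<close>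

lemma sum_ratio_le:
  "j \<le> n \<Longrightarrow> (\<Sum>k<j. ratio n k) \<le> ln (rsum (Suc n) / (rsum (Suc n) - rsum j))"
proof (induction j)
  case 0
  then show ?case using rsum_pos[of n] by (simp add: rsum_def)
next
  case (Suc j)
  define R where "R = rsum (Suc n)"
  have d: "0 < R - rsum j" "0 < R - rsum (Suc j)" "0 < R"
    using Suc.prems rsum_diff_pos[of j n] rsum_diff_pos[of "Suc j" n] rsum_pos by (auto simp: R_def)
  have "ln ((R - rsum (Suc j)) / (R - rsum j)) \<le> (R - rsum (Suc j)) / (R - rsum j) - 1"
    using d by (intro ln_le_minus_one) simp
  also have "\<dots> = - ratio n j"
    using d by (simp add: ratio_def rsum_Suc[of j] R_def[symmetric] field_simps)
  finally have "ratio n j \<le> ln ((R - rsum j) / (R - rsum (Suc j)))"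
    using d by (simp add: ln_div)
  moreover have "(\<Sum>k<j. ratio n k) \<le> ln (R / (R - rsum j))"
    using Suc by (simp add: R_def)
  ultimately show ?case
    using d by (simp add: ln_div flip: R_def)
qed

definition log_weight :: "nat \<Rightarrow> real" where
  "log_weight j = ln (2 + 2 * (rsum j * mu q j))"

lemma rsum_nonneg: "0 \<le> rsum j"
  using rsum_mono[of 0 j] by (simp add: rsum_def)

text \<open>With R = \<open>rsum (Suc n)\<close> and r = \<open>rsum j\<close>, the difference R - r
  is at least 1 / mu_j, so R / (R - r) is at most 1 + r mu_j, half of the argument of the logarithm
  in \<open>log_weight\<close>. The bound does not depend on \<open>n\<close>.\<close>

lemma sum_ratio_le_log_weight:
  assumes "j \<le> n"
  shows "(\<Sum>k<j. ratio n k) \<le> log_weight j"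
proof -
  define R where "R = rsum (Suc n)"
  have d: "0 < R - rsum j" "1 / mu q j \<le> R - rsum j" "0 < R"
    using assms rsum_diff_pos[of j n] rsum_diff[of j n] rsum_pos by (auto simp: R_def)
  have m: "0 < mu q j" by (rule mu_pos)
  have r: "0 \<le> rsum j * mu q j" using rsum_nonneg[of j] m by simp
  have "R / (R - rsum j) \<le> 2 + 2 * (rsum j * mu q j)"
  proof -
    have "rsum j \<le> rsum j * mu q j * (R - rsum j)"
      using mult_left_mono[OF d(2), of "rsum j * mu q j"] r m by simp
    then have "R \<le> (R - rsum j) + rsum j * mu q j * (R - rsum j)" by linarith
    also have "\<dots> \<le> 2 * (R - rsum j) + 2 * (rsum j * mu q j * (R - rsum j))"
    proof -
      have "v + w \<le> 2 * v + 2 * w" if "0 < v" "0 \<le> w" for v w :: real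
        using that by linarith
      then show ?thesis using d(1) mult_nonneg_nonneg[OF r less_imp_le[OF d(1)]] by blast
    qed
    also have "\<dots> = (2 + 2 * (rsum j * mu q j)) * (R - rsum j)"
      by (simp only: distrib_right mult.assoc)
    finally show ?thesis using d by (simp add: pos_divide_le_eq)
  qed
  then have "ln (R / (R - rsum j)) \<le> log_weight j"
    unfolding log_weight_def using d by (intro ln_mono) auto
  then show ?thesis
    using sum_ratio_le[OF assms] by (simp add: R_def)
qed

text \<open>Summation by parts: 1 / mu_k is replaced by the two-step bound and the sums are
  exchanged. The gap at \<open>j\<close> then meets only ratios with k < j, whose sum is logarithmic
  in \<open>j\<close>.\<close>

lemma error_sum_le:
  assumes n: "n \<ge> 1"
  shows "(\<Sum>k\<in>{0<..n}. 1 / mu q k * ratio n k)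
    \<le> (1 + A)\<^sup>2 * (1 / mu q n) * (1 + ln (mu q n * rsum (Suc n))) + (\<Sum>j\<in>{2..n - 1}. gap j * log_weight j)"
proof -
  have "(\<Sum>k\<in>{0<..n}. 1 / mu q k * ratio n k)
      \<le> (\<Sum>k\<in>{0<..n}. ((1 + A)\<^sup>2 * (1 / mu q n) + (\<Sum>j\<in>{2..n - 1}. if k + 2 \<le> j then gap j else 0)) * ratio n k)"
  proof (intro sum_mono mult_right_mono)
    fix k assume k: "k \<in> {0<..n}"
    have "(\<Sum>j\<in>{k + 2..n - 1}. gap j) = (\<Sum>j\<in>{2..n - 1}. if k + 2 \<le> j then gap j else 0)"
      by (intro sum.mono_neutral_cong_left) auto
    then show "1 / mu q k \<le> (1 + A)\<^sup>2 * (1 / mu q n) + (\<Sum>j\<in>{2..n - 1}. if k + 2 \<le> j then gap j else 0)"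
      using inverse_mu_two_step[of k n] k by simp
  qed (simp add: ratio_nonneg)
  also have "\<dots> = (1 + A)\<^sup>2 * (1 / mu q n) * (\<Sum>k\<in>{0<..n}. ratio n k)
      + (\<Sum>k\<in>{0<..n}. \<Sum>j\<in>{2..n - 1}. (if k + 2 \<le> j then gap j else 0) * ratio n k)"
    by (simp add: distrib_right sum.distrib sum_distrib_left sum_distrib_right)
  also have "(\<Sum>k\<in>{0<..n}. \<Sum>j\<in>{2..n - 1}. (if k + 2 \<le> j then gap j else 0) * ratio n k)
      = (\<Sum>j\<in>{2..n - 1}. \<Sum>k\<in>{0<..n}. (if k + 2 \<le> j then gap j else 0) * ratio n k)"
    by (rule sum.swap)
  also have "\<dots> \<le> (\<Sum>j\<in>{2..n - 1}. gap j * log_weight j)"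
  proof (rule sum_mono)
    fix j assume j: "j \<in> {2..n - 1}"
    have "(\<Sum>k\<in>{0<..n}. (if k + 2 \<le> j then gap j else 0) * ratio n k)
        = (\<Sum>k\<in>{k\<in>{0<..n}. k + 2 \<le> j}. gap j * ratio n k)"
      by (intro sum.mono_neutral_cong_right) auto
    also have "\<dots> \<le> (\<Sum>k<j. gap j * ratio n k)"
      using j by (intro sum_mono2 mult_nonneg_nonneg ratio_nonneg) (auto simp: gap_def)
    also have "\<dots> \<le> gap j * log_weight j"
      unfolding sum_distrib_left[symmetric] using j sum_ratio_le_log_weight[of j n]
      by (intro mult_left_mono) (auto simp: gap_def)
    finally show "(\<Sum>k\<in>{0<..n}. (if k + 2 \<le> j then gap j else 0) * ratio n k) \<le> gap j * log_weight j" .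
  qed
  finally have le: "(\<Sum>k\<in>{0<..n}. 1 / mu q k * ratio n k)
      \<le> (1 + A)\<^sup>2 * (1 / mu q n) * (\<Sum>k\<in>{0<..n}. ratio n k) + (\<Sum>j\<in>{2..n - 1}. gap j * log_weight j)"
    by simp
  have "(\<Sum>k\<in>{0<..n}. ratio n k) \<le> (\<Sum>k<Suc n. ratio n k)"
    by (intro sum_mono2 ratio_nonneg) auto
  \<comment> \<open>The logarithmic bound covers k < n; the last ratio equals 1.\<close>
  also have "\<dots> \<le> ln (rsum (Suc n) / (rsum (Suc n) - rsum n)) + 1"
    using sum_ratio_le[of n n] mu_pos[of n] by (simp add: ratio_def rsum_Suc)
  also have "rsum (Suc n) / (rsum (Suc n) - rsum n) = mu q n * rsum (Suc n)"
    by (simp add: rsum_Suc)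
  finally have "(1 + A)\<^sup>2 * (1 / mu q n) * (\<Sum>k\<in>{0<..n}. ratio n k)
      \<le> (1 + A)\<^sup>2 * (1 / mu q n) * (1 + ln (mu q n * rsum (Suc n)))"
    using mu_pos[of n] by (intro mult_left_mono) (simp_all add: add.commute less_imp_le)
  then show ?thesis using le by linarith
qed

section \<open>From \<open>rsum\<close> and \<open>log_weight\<close> to \<open>rho\<close> and
  \<open>s_env\<close>\<close>

lemma
  shows rho_ge: "a / A\<^sup>2 * rsum n \<le> rho q n"
    and rho_le: "rho q n \<le> A / a\<^sup>2 * rsum n"
proof -
  have nu: "a / A\<^sup>2 \<le> nu q (Suc k)" "nu q (Suc k) \<le> A / a\<^sup>2" for k
    unfolding nu_def using moment1[of "Suc k"] moment2[of "Suc k"] a_pos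
    by (auto intro!: frac_le power_mono)
  show "a / A\<^sup>2 * rsum n \<le> rho q n"
    unfolding rsum_def rho_def sum_distrib_left
  proof (rule sum_mono)
    show "a / A\<^sup>2 * (1 / mu q k) \<le> nu q (Suc k) / mu q k" for k
      using mult_right_mono[OF nu(1)[of k], of "1 / mu q k"] mu_pos[of k] by simp
  qed
  show "rho q n \<le> A / a\<^sup>2 * rsum n"
    unfolding rsum_def rho_def sum_distrib_left
  proof (rule sum_mono)
    show "nu q (Suc k) / mu q k \<le> A / a\<^sup>2 * (1 / mu q k)" for k
      using mult_right_mono[OF nu(2)[of k], of "1 / mu q k"] mu_pos[of k] by simp
  qed
qed

lemma rho_pos:
  assumes "n \<ge> 1"
  shows "0 < rho q n"
proof -
  obtain k where "n = Suc k" using assms by (cases n) auto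
  then have "0 < a / A\<^sup>2 * rsum n"
    using rsum_pos[of k] a_pos A_pos by simp
  then show ?thesis using rho_ge[of n] by linarith
qed

text \<open>Only constants are lost when \<open>rsum (Suc n)\<close> is replaced by
  \<open>rho q n\<close>. The factor inside the logarithm keeps its argument at least 1.\<close>

lemma wasserstein_bound_rho:
  assumes "gwve M q \<xi>"
  shows "\<exists>C>0. \<exists>\<kappa>>0. \<forall>n\<ge>1. 1 \<le> \<kappa> * (mu q n * rho q n) \<and> wasserstein (scaled_cond_law M \<xi> n) std_exponential
    \<le> ereal (C * ((1 + ln (\<kappa> * (mu q n * rho q n))) / (mu q n * rho q n)
        + (\<Sum>j\<in>{2..n - 1}. gap j * log_weight j) / rho q n))"
proof -
  from wasserstein_bound[OF assms] obtain C where C: "C > 0"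
    "\<And>n. wasserstein (scaled_cond_law M \<xi> n) std_exponential
      \<le> ereal (C * (1 / (mu q n * rsum (Suc n)) + (\<Sum>k\<in>{0<..n}. 1 / mu q k * ratio n k) / rsum (Suc n)))"
    unfolding ratio_def by blast
  define C0 where "C0 = (1 + A)\<^sup>2"
  define \<kappa>\<^sub>2 where "\<kappa>\<^sub>2 = A / a\<^sup>2"
  define \<kappa> where "\<kappa> = (1 + 1 / a) * (A\<^sup>2 / a)"
  define C' where "C' = C * (1 + C0) * \<kappa>\<^sub>2"
  have C0: "0 < C0" using A_pos by (simp add: C0_def)
  have \<kappa>\<^sub>2: "0 < \<kappa>\<^sub>2" and \<kappa>: "0 < \<kappa>" using a_pos A_pos by (auto simp: \<kappa>\<^sub>2_def \<kappa>_def add_pos_pos)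
  have C': "0 < C'" using C(1) C0 \<kappa>\<^sub>2 by (simp add: C'_def)
  have "1 \<le> \<kappa> * (mu q n * rho q n) \<and> wasserstein (scaled_cond_law M \<xi> n) std_exponential
    \<le> ereal (C' * ((1 + ln (\<kappa> * (mu q n * rho q n))) / (mu q n * rho q n)
        + (\<Sum>j\<in>{2..n - 1}. gap j * log_weight j) / rho q n))" if n: "n \<ge> 1" for n
  proof -
    define R where "R = rsum (Suc n)"
    define T where "T = (\<Sum>j\<in>{2..n - 1}. gap j * log_weight j)"
    define y where "y = mu q n * rho q n"
    define y' where "y' = mu q n * R"
    define \<Sigma> where "\<Sigma> = (\<Sum>k\<in>{0<..n}. 1 / mu q k * ratio n k)"
    have m: "0 < mu q n" by (rule mu_pos)
    have R: "0 < R" unfolding R_def by (rule rsum_pos)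
    have \<rho>: "0 < rho q n" using n by (rule rho_pos)
    have y: "0 < y" using m \<rho> by (simp add: y_def)
    have y'1: "1 \<le> y'"
      using rsum_nonneg[of n] m by (simp add: y'_def R_def rsum_Suc distrib_left)
    have "rho q n \<le> \<kappa>\<^sub>2 * rsum n" unfolding \<kappa>\<^sub>2_def by (rule rho_le)
    also have "\<dots> \<le> \<kappa>\<^sub>2 * R" using \<kappa>\<^sub>2 m by (intro mult_left_mono) (auto simp: R_def rsum_Suc)
    finally have \<rho>R: "rho q n \<le> \<kappa>\<^sub>2 * R" .
    then have yy': "y \<le> \<kappa>\<^sub>2 * y'"
      using mult_left_mono[of "rho q n" "\<kappa>\<^sub>2 * R" "mu q n"] m by (simp add: y_def y'_def ac_simps)
    \<comment> \<open>\<open>rsum (Suc n)\<close> has one term more than \<open>rsum n\<close>. As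
      means are at least \<open>a\<close>, this term is at most 1 / a times the previous one, which
      exists since n is positive.\<close>
    have R\<rho>: "R \<le> \<kappa> * rho q n"
    proof -
      obtain k where k: "n = Suc k" using n by (cases n) auto
      have "1 / mu q n \<le> 1 / a * (1 / mu q k)"
        using mult_left_mono[OF inverse_mu_ge[of k], of "1 / a"] a_pos k by simp
      also have "1 / mu q k \<le> rsum n" using rsum_nonneg[of k] by (simp add: k rsum_Suc)
      finally have "R \<le> (1 + 1 / a) * rsum n"
        using a_pos by (simp add: R_def rsum_Suc distrib_right divide_right_mono)
      also have "rsum n \<le> A\<^sup>2 / a * rho q n"
        using rho_ge[of n] a_pos A_pos by (simp add: field_simps)
      finally show ?thesis
        using a_pos by (simp add: \<kappa>_def mult_left_mono)
    qed
    then have y'y: "y' \<le> \<kappa> * y"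
      using mult_left_mono[of R "\<kappa> * rho q n" "mu q n"] m by (simp add: y_def y'_def ac_simps)
    have T: "0 \<le> T"
      unfolding T_def log_weight_def using rsum_nonneg mu_pos
      by (intro sum_nonneg mult_nonneg_nonneg ln_ge_zero) (auto simp: gap_def less_imp_le)
    have ln: "0 \<le> ln y'" "ln y' \<le> ln (\<kappa> * y)"
      using y'1 y'y by auto
    have \<Sigma>: "\<Sigma> \<le> C0 * (1 / mu q n) * (1 + ln y') + T"
      using error_sum_le[OF n] by (simp only: \<Sigma>_def C0_def y'_def R_def T_def)
    have "1 / (mu q n * R) + \<Sigma> / R \<le> 1 / y' + (C0 * (1 / mu q n) * (1 + ln y') + T) / R"
      using \<Sigma> R by (simp add: y'_def divide_right_mono)
    also have "\<dots> = 1 / y' + C0 * ((1 + ln y') / y') + T / R"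
      using m R by (simp add: y'_def field_simps)
    also have "\<dots> \<le> (1 + C0) * ((1 + ln y') / y' + T / R)"
    proof -
      have "1 / y' \<le> (1 + ln y') / y'" using ln y'1 by (intro divide_right_mono) auto
      moreover have "0 \<le> C0 * (T / R)" using C0 T R by simp
      ultimately show ?thesis by (simp only: distrib_right distrib_left mult_1_left)
    qed
    also have "(1 + ln y') / y' + T / R \<le> \<kappa>\<^sub>2 * ((1 + ln (\<kappa> * y)) / y + T / rho q n)"
    proof -
      have l0: "0 \<le> 1 + ln (\<kappa> * y)" using ln by linarith
      have "1 / y' \<le> \<kappa>\<^sub>2 / y" using yy' y y'1 by (simp add: field_simps)
      then have "(1 + ln y') * (1 / y') \<le> (1 + ln (\<kappa> * y)) * (\<kappa>\<^sub>2 / y)"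
        using ln l0 y'1 \<kappa>\<^sub>2 y by (intro mult_mono add_left_mono) (simp_all del: ln_ge_zero_iff)
      moreover have "1 / R \<le> \<kappa>\<^sub>2 / rho q n" using \<rho>R \<rho> R by (simp add: field_simps)
      then have "T * (1 / R) \<le> T * (\<kappa>\<^sub>2 / rho q n)" using T by (rule mult_left_mono)
      ultimately show ?thesis by (simp add: field_simps)
    qed
    finally have "C * (1 / (mu q n * R) + \<Sigma> / R) \<le> C' * ((1 + ln (\<kappa> * y)) / y + T / rho q n)"
      using C(1) C0 by (simp add: C'_def mult.assoc mult_left_mono)
    then have "wasserstein (scaled_cond_law M \<xi> n) std_exponential
        \<le> ereal (C' * ((1 + ln (\<kappa> * y)) / y + T / rho q n))"
      using C(2)[of n] by (auto simp: R_def \<Sigma>_def elim!: order_trans)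
    then show ?thesis
      using y'1 y'y by (simp add: y_def T_def)
  qed
  then show ?thesis using C' \<kappa> by blast
qed

definition s_weight :: "nat \<Rightarrow> real" where
  "s_weight j = ln (rho q j * mu q j) + ln (fmoment 1 (q j))"

lemma s_env_alt: "s_env q n = (\<Sum>j\<in>{2..n - 1}. gap j * s_weight j)"
  by (simp add: s_env_def s_weight_def gap_def mult.commute)

lemma s_env_Suc: "n \<ge> 2 \<Longrightarrow> s_env q (Suc n) = s_env q n + gap n * s_weight n"
proof -
  assume "n \<ge> 2"
  then have "{2..Suc n - 1} = insert n {2..n - 1}" by auto
  then show ?thesis unfolding s_env_alt using \<open>n \<ge> 2\<close> by simp
qed

text \<open>With y = mu_j rho_j both weights are logarithms of y up to constants:
  \<open>s_weight\<close> is at least ln (a y), and the argument of \<open>log_weight\<close> is at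
  most linear in y, hence at most (a y)^3 once y is large.\<close>

lemma weights_eventually:
  assumes "filterlim (\<lambda>n. mu q n * rho q n) at_top sequentially"
  shows "\<exists>J\<ge>2. \<forall>j\<ge>J. 1 \<le> s_weight j \<and> log_weight j \<le> 3 * s_weight j"
proof -
  define K where "K = 2 * (A\<^sup>2 / a)"
  have K: "0 < K" using a_pos A_pos by (simp add: K_def)
  \<comment> \<open>In turn: y is at least 1, ln (a y) is at least 1, and a^3 y is at least 2 +
    K.\<close>
  define Y where "Y = max 1 (max (exp 1 / a) ((2 + K) / a ^ 3))"
  from assms have "eventually (\<lambda>n. Y \<le> mu q n * rho q n) sequentially"
    by (simp add: filterlim_at_top)
  then obtain J where J: "\<And>n. n \<ge> J \<Longrightarrow> Y \<le> mu q n * rho q n"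
    by (auto simp: eventually_sequentially)
  have "1 \<le> s_weight j \<and> log_weight j \<le> 3 * s_weight j" if j: "j \<ge> max J 2" for j
  proof -
    define y where "y = mu q j * rho q j"
    have y: "1 \<le> y" "exp 1 / a \<le> y" "(2 + K) / a ^ 3 \<le> y"
      using J[of j] j by (auto simp: y_def Y_def)
    define z where "z = ln (a * y)"
    have ay: "exp 1 \<le> a * y" using y(2) a_pos by (simp add: field_simps)
    then have z: "1 \<le> z"
      using ln_mono[of "exp 1" "a * y"] by (simp add: z_def)
    have "ln a \<le> ln (fmoment 1 (q j))"
      using moment1[of j] j a_pos by (intro ln_mono) auto
    moreover have "z = ln a + ln y" using a_pos y by (simp add: z_def ln_mult)
    moreover have "rho q j * mu q j = y" by (simp add: y_def)
    ultimately have zs: "z \<le> s_weight j"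
      unfolding s_weight_def by simp
    have "rsum j * mu q j \<le> A\<^sup>2 / a * y"
      using mult_right_mono[OF rho_ge[of j], of "mu q j"] mu_pos[of j] a_pos A_pos by (simp add: y_def field_simps)
    then have "2 + 2 * (rsum j * mu q j) \<le> 2 + K * y"
      by (simp add: K_def)
    also have "\<dots> \<le> (2 + K) * y" using y by (simp add: distrib_right)
    also have "\<dots> \<le> a ^ 3 * y * y"
      using y a_pos by (intro mult_right_mono) (simp_all add: field_simps)
    also have "\<dots> \<le> (a * y) ^ 3"
      using mult_left_mono[of 1 y "a ^ 3 * y * y"] y a_pos by (simp add: power3_eq_cube ac_simps)
    finally have "log_weight j \<le> ln ((a * y) ^ 3)"
      unfolding log_weight_def using rsum_nonneg[of j] mu_pos[of j] by (intro ln_mono) (auto intro!: add_pos_nonneg)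
    also have "\<dots> = 3 * z"
      using a_pos y by (simp add: z_def ln_realpow)
    finally show ?thesis using z zs by linarith
  qed
  then show ?thesis by (intro exI[of _ "max J 2"]) auto
qed

lemma wasserstein_bound_eventually:
  assumes "gwve M q \<xi>"
    and y: "filterlim (\<lambda>n. mu q n * rho q n) at_top sequentially"
  shows "\<exists>C>0. \<exists>K\<ge>0. \<exists>N\<ge>1. \<forall>n\<ge>N. 1 \<le> ln (mu q n * rho q n) \<and>
    wasserstein (scaled_cond_law M \<xi> n) std_exponential
      \<le> ereal (C * (ln (mu q n * rho q n) / (mu q n * rho q n) + (K + s_env q n) / rho q n))"
proof -
  from wasserstein_bound_rho[OF assms(1)] obtain C \<kappa> where C: "C > 0" "\<kappa> > 0"
    "\<And>n. n \<ge> 1 \<Longrightarrow> wasserstein (scaled_cond_law M \<xi> n) std_exponential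
    \<le> ereal (C * ((1 + ln (\<kappa> * (mu q n * rho q n))) / (mu q n * rho q n)
        + (\<Sum>j\<in>{2..n - 1}. gap j * log_weight j) / rho q n))"
    by blast
  from weights_eventually[OF y] obtain J where J: "\<And>j. j \<ge> J \<Longrightarrow> log_weight j \<le> 3 * s_weight j" by blast
  \<comment> \<open>The cost of the finitely many indices at which the comparison of the two weights
    may fail.\<close>
  define K where "K = (\<Sum>j\<in>{2..J}. gap j * \<bar>log_weight j - 3 * s_weight j\<bar>)"
  have gap0: "0 \<le> gap j" for j by (simp add: gap_def)
  have K: "0 \<le> K" unfolding K_def using gap0 by (intro sum_nonneg) auto
  have T: "(\<Sum>j\<in>{2..n - 1}. gap j * log_weight j) \<le> K + 3 * s_env q n" for n
  proof -
    have "(\<Sum>j\<in>{2..n - 1}. gap j * log_weight j) - 3 * s_env q n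
        = (\<Sum>j\<in>{2..n - 1}. gap j * (log_weight j - 3 * s_weight j))"
      unfolding s_env_alt sum_distrib_left sum_subtractf[symmetric] by (intro sum.cong) (auto simp: algebra_simps)
    also have "\<dots> \<le> (\<Sum>j\<in>{2..n - 1}. if j \<le> J then gap j * \<bar>log_weight j - 3 * s_weight j\<bar> else 0)"
      using gap0 J by (intro sum_mono) (auto intro: mult_left_mono simp: mult_nonneg_nonpos)
    also have "\<dots> = (\<Sum>j\<in>{j\<in>{2..n - 1}. j \<le> J}. gap j * \<bar>log_weight j - 3 * s_weight j\<bar>)"
      by (intro sum.mono_neutral_cong_right) auto
    also have "\<dots> \<le> K"
      unfolding K_def using gap0 by (intro sum_mono2) auto
    finally show ?thesis by simp
  qed
  \<comment> \<open>Since ln y is at least 1 for large \<open>n\<close>, the constants 1 and ln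
    \<kappa> are bounded by multiples of ln y.\<close>
  define C\<^sub>2 where "C\<^sub>2 = 2 + \<bar>ln \<kappa>\<bar>"
  from y have "eventually (\<lambda>n. exp 1 \<le> mu q n * rho q n) sequentially"
    by (simp add: filterlim_at_top)
  then obtain N where N: "\<And>n. n \<ge> N \<Longrightarrow> exp 1 \<le> mu q n * rho q n"
    by (auto simp: eventually_sequentially)
  have "1 \<le> ln (mu q n * rho q n) \<and> wasserstein (scaled_cond_law M \<xi> n) std_exponential
      \<le> ereal (3 * C * C\<^sub>2 * (ln (mu q n * rho q n) / (mu q n * rho q n) + (K / 3 + s_env q n) / rho q n))"
    if n: "n \<ge> max N 1" for n
  proof -
    define y where "y = mu q n * rho q n"
    define T where "T = (\<Sum>j\<in>{2..n - 1}. gap j * log_weight j)"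
    have "exp 1 \<le> y" using N[of n] n by (simp add: y_def)
    then have ln: "1 \<le> ln y" and y0: "0 < y"
      using ln_mono[of "exp 1" y] by (auto intro: less_le_trans[of 0 "exp 1"])
    have \<rho>: "0 < rho q n" using n by (intro rho_pos) auto
    have C\<^sub>2: "1 \<le> C\<^sub>2" by (simp add: C\<^sub>2_def)
    have T0: "0 \<le> T"
      unfolding T_def log_weight_def using rsum_nonneg mu_pos gap0
      by (intro sum_nonneg mult_nonneg_nonneg ln_ge_zero) (auto simp: less_imp_le)
    then have Ts: "0 \<le> K + 3 * s_env q n" "T \<le> K + 3 * s_env q n"
      using T[of n] by (auto simp: T_def)
    have "1 + ln (\<kappa> * y) \<le> C\<^sub>2 * ln y"
    proof -
      have "\<bar>ln \<kappa>\<bar> * 1 \<le> \<bar>ln \<kappa>\<bar> * ln y" using ln by (intro mult_left_mono) auto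
      then show ?thesis
        using C(2) y0 ln abs_ge_self[of "ln \<kappa>"] by (simp add: C\<^sub>2_def ln_mult distrib_right)
    qed
    then have "(1 + ln (\<kappa> * y)) / y \<le> C\<^sub>2 * (ln y / y)"
      using y0 by (simp add: divide_right_mono)
    also have "\<dots> \<le> 3 * C\<^sub>2 * (ln y / y)"
      using C\<^sub>2 ln y0 by (intro mult_right_mono divide_nonneg_pos) (auto simp del: ln_ge_zero_iff)
    finally have 1: "(1 + ln (\<kappa> * y)) / y \<le> 3 * C\<^sub>2 * (ln y / y)" .
    have "T \<le> C\<^sub>2 * (K + 3 * s_env q n)"
      using order_trans[OF Ts(2)] mult_right_mono[OF C\<^sub>2 Ts(1)] by simp
    then have "T / rho q n \<le> C\<^sub>2 * (K + 3 * s_env q n) / rho q n"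
      using \<rho> by (intro divide_right_mono) auto
    also have "C\<^sub>2 * (K + 3 * s_env q n) = 3 * C\<^sub>2 * (K / 3 + s_env q n)"
      by (simp add: algebra_simps)
    also have "\<dots> / rho q n = 3 * C\<^sub>2 * ((K / 3 + s_env q n) / rho q n)"
      by (rule times_divide_eq_right[symmetric])
    finally have "(1 + ln (\<kappa> * y)) / y + T / rho q n \<le> 3 * C\<^sub>2 * (ln y / y + (K / 3 + s_env q n) / rho q n)"
      using 1 by (simp only: distrib_left)
    then have "C * ((1 + ln (\<kappa> * y)) / y + T / rho q n)
        \<le> 3 * C * C\<^sub>2 * (ln y / y + (K / 3 + s_env q n) / rho q n)"
      using mult_left_mono[of _ _ C] C(1) by (simp add: ac_simps)
    then have "wasserstein (scaled_cond_law M \<xi> n) std_exponential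
        \<le> ereal (3 * C * C\<^sub>2 * (ln y / y + (K / 3 + s_env q n) / rho q n))"
      using C(3)[of n] n by (auto simp: T_def y_def elim!: order_trans)
    then show ?thesis using ln by (simp add: y_def)
  qed
  moreover have "0 < 3 * C * C\<^sub>2" using C(1) by (simp add: C\<^sub>2_def)
  moreover have "0 \<le> K / 3" using K by simp
  ultimately show ?thesis
    by (intro exI[of _ "3 * C * C\<^sub>2"] exI[of _ "K / 3"] exI[of _ "max N 1"] conjI) auto
qed

text \<open>
  An additive constant in \<open>s_env\<close> is harmless: either \<open>s_env\<close> is eventually bounded below by a
  positive constant, or it vanishes eventually; then \<open>mu\<close> is eventually 2-periodic, hence bounded,
  and \<open>1 / rho\<close> is dominated by the first term of the bound.
\<close>

lemma absorb_constant:
  assumes y: "filterlim (\<lambda>n. mu q n * rho q n) at_top sequentially" and K: "0 \<le> K"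
  shows "\<exists>C>0. \<exists>N. \<forall>n\<ge>N. 1 \<le> ln (mu q n * rho q n) \<longrightarrow> 0 \<le> s_env q n \<longrightarrow>
    ln (mu q n * rho q n) / (mu q n * rho q n) + (K + s_env q n) / rho q n
      \<le> C * (ln (mu q n * rho q n) / (mu q n * rho q n) + s_env q n / rho q n)"
proof -
  from weights_eventually[OF y] obtain J where J: "J \<ge> 2" "\<And>j. j \<ge> J \<Longrightarrow> 1 \<le> s_weight j" by blast
  have mono: "s_env q n \<le> s_env q k" if "J \<le> n" "n \<le> k" for n k
    using that(2)
  proof (induction k rule: dec_induct)
    case (step k)
    have "0 \<le> gap k * s_weight k"
      using J(2)[of k] step that(1) by (intro mult_nonneg_nonneg) (auto simp: gap_def)
    then show ?case using s_env_Suc[of k] step J(1) that(1) by simp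
  qed simp
  have yp: "0 < mu q n * rho q n" if "n \<ge> J" for n
    using that J(1) by (intro mult_pos_pos mu_pos rho_pos) auto
  have \<rho>p: "0 < rho q n" if "n \<ge> J" for n
    using that J(1) by (intro rho_pos) auto
  \<comment> \<open>From \<open>J\<close> on \<open>s_env\<close> is nondecreasing. If it stays
    negative there, the claim is vacuous; otherwise one nonnegative value decides.\<close>
  consider (pos) n\<^sub>0 where "n\<^sub>0 \<ge> J" "0 < s_env q n\<^sub>0"
    | (zero) n\<^sub>0 where "n\<^sub>0 \<ge> J" "s_env q n\<^sub>0 = 0" "\<And>n. n \<ge> J \<Longrightarrow> s_env q n \<le> 0"
    | (neg) "\<And>n. n \<ge> J \<Longrightarrow> s_env q n < 0"
    by (metis less_eq_real_def not_le)
  then show ?thesis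
  proof cases
    case pos
    \<comment> \<open>By monotonicity K is at most K / s_env(n0) times the current value of
      \<open>s_env\<close>.\<close>
    define C where "C = 1 + K / s_env q n\<^sub>0"
    have C: "1 \<le> C" using pos K by (simp add: C_def)
    have "ln (mu q n * rho q n) / (mu q n * rho q n) + (K + s_env q n) / rho q n
        \<le> C * (ln (mu q n * rho q n) / (mu q n * rho q n) + s_env q n / rho q n)"
      if n: "n \<ge> n\<^sub>0" and l: "1 \<le> ln (mu q n * rho q n)" for n
    proof -
      have "K \<le> K / s_env q n\<^sub>0 * s_env q n"
        using mult_left_mono[OF mono[OF pos(1) n], of "K / s_env q n\<^sub>0"] pos K by simp
      then have "K + s_env q n \<le> C * s_env q n"
        by (simp add: C_def distrib_right)
      then have "(K + s_env q n) / rho q n \<le> C * (s_env q n / rho q n)"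
        using \<rho>p[of n] n pos(1) by (simp add: divide_right_mono)
      moreover have "1 * (ln (mu q n * rho q n) / (mu q n * rho q n)) \<le> C * (ln (mu q n * rho q n) / (mu q n * rho q n))"
        using C yp[of n] n pos(1) l by (intro mult_right_mono divide_nonneg_pos) (auto simp del: ln_ge_zero_iff)
      ultimately show ?thesis by (simp add: distrib_left)
    qed
    then show ?thesis using C by (intro exI[of _ C]) auto
  next
    case zero
    have s0: "s_env q n = 0" if "n \<ge> n\<^sub>0" for n
      using mono[OF zero(1) that] zero(2) zero(3)[of n] that zero(1) by linarith
    have per: "mu q (n + 2) = mu q n" if "n \<ge> n\<^sub>0" for n
    proof -
      have "gap (n + 2) * s_weight (n + 2) = 0"
        using s_env_Suc[of "n + 2"] s0[of "n + 2"] s0[of "Suc (n + 2)"] that by simp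
      moreover have "1 \<le> s_weight (n + 2)" using J(2)[of "n + 2"] that zero(1) by simp
      ultimately have "gap (n + 2) = 0" by auto
      then show ?thesis using mu_pos[of n] mu_pos[of "n + 2"] by (simp add: gap_def field_simps)
    qed
    define B' where "B' = max (mu q n\<^sub>0) (mu q (Suc n\<^sub>0))"
    have B': "mu q n \<le> B'" if "n \<ge> n\<^sub>0" for n
      using that
    proof (induction n rule: less_induct)
      case (less n)
      show ?case
      proof (cases "n \<ge> n\<^sub>0 + 2")
        case True
        then obtain k where "n = k + 2" "n\<^sub>0 \<le> k"
          by (metis add_le_imp_le_right le_add2 le_add_diff_inverse2 le_trans)
        then show ?thesis using less.IH[of k] per[of k] by simp
      next
        case False
        then have "n = n\<^sub>0 \<or> n = Suc n\<^sub>0" using less.prems by linarith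
        then show ?thesis by (auto simp: B'_def)
      qed
    qed
    \<comment> \<open>With y = mu_n rho_n, K / rho_n = K mu_n / y is at most K B' ln y / y, because
      ln y is at least 1.\<close>
    define C where "C = 1 + K * B'"
    have B'0: "0 < B'" using mu_pos[of n\<^sub>0] by (simp add: B'_def)
    have C: "1 \<le> C" using K B'0 by (simp add: C_def)
    have "ln (mu q n * rho q n) / (mu q n * rho q n) + (K + s_env q n) / rho q n
        \<le> C * (ln (mu q n * rho q n) / (mu q n * rho q n) + s_env q n / rho q n)"
      if n: "n \<ge> n\<^sub>0" and l: "1 \<le> ln (mu q n * rho q n)" for n
    proof -
      define y where "y = mu q n * rho q n"
      have y: "0 < y" using yp[of n] n zero(1) by (simp add: y_def)
      have "K / rho q n = K * mu q n / y"
        using mu_pos[of n] by (simp add: y_def)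
      also have "\<dots> \<le> K * B' * ln y / y"
      proof (intro divide_right_mono)
        have "K * mu q n * 1 \<le> K * B' * ln y"
          using B'[OF n] B'0 K l mu_pos[of n] by (intro mult_mono) (auto simp: y_def less_imp_le)
        then show "K * mu q n \<le> K * B' * ln y" by simp
      qed (use y in auto)
      also have "\<dots> = K * B' * (ln y / y)"
        by (rule times_divide_eq_right[symmetric])
      finally show ?thesis
        by (simp only: s0[OF n] C_def y_def[symmetric] add_0_right div_0 distrib_right mult_1_left add_le_cancel_left)
    qed
    then show ?thesis using C by (intro exI[of _ C]) auto
  next
    case neg
    then show ?thesis by (intro exI[of _ 1] conjI exI[of _ J]) (auto simp: not_le[symmetric])
  qed
qed

end

text \<open>For the finitely many n below \<open>N\<close> the constant is enlarged by the quotients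
  of a crude finite bound \<open>e\<close> and the desired bound \<open>g\<close>. The guard
  \<open>P\<close> keeps \<open>g\<close> positive, so that these quotients make sense.\<close>

lemma extend_bound_to_all:
  fixes W :: "nat \<Rightarrow> ereal" and g e :: "nat \<Rightarrow> real"
  assumes C: "0 < C" "\<And>n. n \<ge> N \<Longrightarrow> P n \<Longrightarrow> W n \<le> ereal (C * g n)"
    and e: "\<And>n. W n \<le> ereal (e n)" and g: "\<And>n. P n \<Longrightarrow> 0 < g n"
  shows "\<exists>C>0. \<forall>n. P n \<longrightarrow> W n \<le> ereal (C * g n)"
proof (intro exI conjI allI impI)
  define C' where "C' = C + (\<Sum>n<N. \<bar>e n / g n\<bar>)"
  have "0 \<le> (\<Sum>n<N. \<bar>e n / g n\<bar>)" by (intro sum_nonneg) auto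
  then have CC': "C \<le> C'" by (simp add: C'_def)
  then show "0 < C'" using C(1) by linarith
  fix n assume P: "P n"
  show "W n \<le> ereal (C' * g n)"
  proof (cases "n \<ge> N")
    case True
    have "C * g n \<le> C' * g n" using CC' g[OF P] by (intro mult_right_mono) auto
    then show ?thesis using C(2)[OF True P] by (auto elim!: order_trans)
  next
    case False
    then have "\<bar>e n / g n\<bar> \<le> (\<Sum>n<N. \<bar>e n / g n\<bar>)" by (intro member_le_sum) auto
    then have "e n / g n \<le> C'"
      using C(1) abs_ge_self[of "e n / g n"] unfolding C'_def by linarith
    then have "e n \<le> C' * g n" using g[OF P] by (simp add: pos_divide_le_eq)
    then show ?thesis using e[of n] by (auto elim!: order_trans)
  qed
qed

theorem corollary1p7:
  fixes M :: "'a measure" and q :: "nat \<Rightarrow> nat pmf" and \<xi> :: "nat \<Rightarrow> nat \<Rightarrow> 'a \<Rightarrow> nat"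
    and c a A :: real
  assumes "gwve M q \<xi>"
    and "critical_env q"
    and "c > 0"
    and "\<And>n. n \<ge> 1 \<Longrightarrow> integrable (measure_pmf (q n)) (falling_fact 3)"
    and "\<And>n. n \<ge> 1 \<Longrightarrow> fmoment 3 (q n) \<le> c * fmoment 2 (q n) * (1 + fmoment 1 (q n))"
    and "0 < a" and "a \<le> A"
    and "\<And>n. n \<ge> 1 \<Longrightarrow> a \<le> fmoment 1 (q n) \<and> fmoment 1 (q n) \<le> A"
    and "\<And>n. n \<ge> 1 \<Longrightarrow> a \<le> fmoment 2 (q n) \<and> fmoment 2 (q n) \<le> A"
  shows "(\<exists>C>0. \<forall>n\<ge>3. mu q n * rho q n > 1 \<longrightarrow> s_env q n \<ge> 0 \<longrightarrow>
            wasserstein (scaled_cond_law M \<xi> n) std_exponential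
              \<le> ereal (C * (ln (mu q n * rho q n) / (mu q n * rho q n) + s_env q n / rho q n)))
       \<and> (convergent (s_env q) \<longrightarrow>
           (\<exists>C>0. \<forall>n\<ge>1. mu q n * rho q n \<ge> 1 \<longrightarrow>
            wasserstein (scaled_cond_law M \<xi> n) std_exponential
              \<le> ereal (C * (ln (mu q n * rho q n) / (mu q n * rho q n) + 1 / rho q n))))"
proof -
  have "offspring3 (q n)" if n: "n \<ge> 1" for n
    by unfold_locales
      (use gwve.mean_finite[OF assms(1) n] gwve.mean_pos[OF assms(1) n] assms(4)[OF n] in auto)
  moreover have "fmoment 3 (q n) \<le> c * A * (1 + A)" if n: "n \<ge> 1" for n
  proof -
    have "c * fmoment 2 (q n) * (1 + fmoment 1 (q n)) \<le> c * A * (1 + A)"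
      using assms(3,6) assms(8)[OF n] assms(9)[OF n] by (intro mult_mono) auto
    then show ?thesis using assms(5)[OF n] by linarith
  qed
  ultimately interpret bounded_env q a A "c * A * (1 + A)"
    using assms(6,8,9) by (intro bounded_env.intro) auto
  define y where "y n = mu q n * rho q n" for n
  define W where "W n = wasserstein (scaled_cond_law M \<xi> n) std_exponential" for n
  have ylim: "filterlim (\<lambda>n. mu q n * rho q n) at_top sequentially"
    using assms(2) by (simp add: critical_env_def)
  define error where "error n = 1 / (mu q n * rsum (Suc n))
    + (\<Sum>k\<in>{0<..n}. 1 / mu q k * (1 / mu q k / (rsum (Suc n) - rsum k))) / rsum (Suc n)" for n
  from wasserstein_bound[OF assms(1)] obtain C\<^sub>0 where e: "\<And>n. W n \<le> ereal (C\<^sub>0 * error n)"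
    unfolding W_def error_def by blast
  from wasserstein_bound_eventually[OF assms(1) ylim] obtain C K N where C: "C > 0" "K \<ge> 0" "N \<ge> 1"
    "\<And>n. n \<ge> N \<Longrightarrow> 1 \<le> ln (y n)"
    "\<And>n. n \<ge> N \<Longrightarrow> W n \<le> ereal (C * (ln (y n) / y n + (K + s_env q n) / rho q n))"
    unfolding y_def W_def by blast
  from absorb_constant[OF ylim C(2)] obtain C' N' where C': "C' > 0"
    "\<And>n. n \<ge> N' \<Longrightarrow> 1 \<le> ln (y n) \<Longrightarrow> 0 \<le> s_env q n \<Longrightarrow>
      ln (y n) / y n + (K + s_env q n) / rho q n \<le> C' * (ln (y n) / y n + s_env q n / rho q n)"
    unfolding y_def by blast
  have 1: "\<exists>C>0. \<forall>n. n \<ge> 3 \<and> y n > 1 \<and> s_env q n \<ge> 0 \<longrightarrow> W n \<le> ereal (C * (ln (y n) / y n + s_env q n / rho q n))"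
  proof (rule extend_bound_to_all[OF _ _ e, where N = "max N N'"])
    show "0 < C * C'" using C(1) C'(1) by simp
    fix n assume n: "n \<ge> 3 \<and> y n > 1 \<and> s_env q n \<ge> 0"
    show "0 < ln (y n) / y n + s_env q n / rho q n"
      using n rho_pos[of n] by (intro add_pos_nonneg) auto
    assume "n \<ge> max N N'"
    then have "C * (ln (y n) / y n + (K + s_env q n) / rho q n) \<le> C * (C' * (ln (y n) / y n + s_env q n / rho q n))"
      using C(1) C(4)[of n] C'(2)[of n] n by (intro mult_left_mono) auto
    then show "W n \<le> ereal (C * C' * (ln (y n) / y n + s_env q n / rho q n))"
      using C(5)[of n] \<open>n \<ge> max N N'\<close> by (auto simp: mult.assoc elim!: order_trans)
  qed
  have 2: "\<exists>C>0. \<forall>n. n \<ge> 1 \<and> y n \<ge> 1 \<longrightarrow> W n \<le> ereal (C * (ln (y n) / y n + 1 / rho q n))"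
    if "convergent (s_env q)"
  proof -
    from convergent_imp_Bseq[OF that] obtain B where B: "B > 0" "\<And>n. \<bar>s_env q n\<bar> \<le> B"
      by (auto simp: Bseq_def)
    \<comment> \<open>\<open>B\<close> bounds the convergent sequence \<open>s_env\<close>, so K + B
      bounds the numerator over \<open>rho\<close>; the 1 makes \<open>D\<close> at least 1 for the
      logarithmic term.\<close>
    define D where "D = 1 + K + B"
    show ?thesis
    proof (rule extend_bound_to_all[OF _ _ e, where N = N])
      show "0 < C * D" using C(1,2) B(1) by (simp add: D_def)
      fix n assume n: "n \<ge> 1 \<and> y n \<ge> 1"
      then have \<rho>: "0 < rho q n" by (intro rho_pos) auto
      have l: "0 \<le> ln (y n) / y n" using n by simp
      show "0 < ln (y n) / y n + 1 / rho q n"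
        using l \<rho> by (intro add_nonneg_pos) auto
      assume N: "n \<ge> N"
      have "(K + s_env q n) / rho q n \<le> D * (1 / rho q n)"
        using \<rho> B(2)[of n] by (simp add: D_def divide_right_mono)
      moreover have "1 * (ln (y n) / y n) \<le> D * (ln (y n) / y n)"
        using l C(2) B(1) by (intro mult_right_mono) (auto simp: D_def)
      ultimately have "C * (ln (y n) / y n + (K + s_env q n) / rho q n) \<le> C * (D * (ln (y n) / y n + 1 / rho q n))"
        using C(1) by (intro mult_left_mono) (auto simp: distrib_left)
      then show "W n \<le> ereal (C * D * (ln (y n) / y n + 1 / rho q n))"
        using C(5)[OF N] by (auto simp: mult.assoc elim!: order_trans)
    qed
  qed
  show ?thesis
    using 1 2 by (simp add: y_def W_def imp_conjL)
qed

end
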